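(* Let $d\ge2$. For every $\eta\in(0,1)$ there are $L_0,c_0$ such that for all $c\ge c_0$ and all $\delta$ with $L_0\le L=\ln\frac1\delta\le c^{1/3}$ and $\delta\le2^{-d}$, $$\Lambda_\delta(c;d)\ \ge\ \Bigl[(1-\eta)\,\frac{L}{\pi^2}\,\ln\frac{4\pi^2c}{L}\Bigr]^{d}.$$
   Context: For the cubes $A=(0,c)^d$ and $B=(-\tfrac12,\tfrac12)^d$ let $P_A$ be multiplication by the indicator of $A$ on $L^2(\mathbb R^d)$ and $Q_B$ the orthogonal projection onto functions whose Fourier transform $\int f(x)e^{-2\pi i x\cdot\xi}dx$ is supported in $B$. $\Lambda_\varepsilon(c;d)$ is the number, with multiplicity, of eigenvalues $\mu$ of the concentration operator $P_AQ_BP_A$ with $\varepsilon<\mu\le1-\varepsilon$. Equivalently, $\Lambda_\varepsilon(c;d)$ is the number of multi-indices $(n_1,\dots,n_d)$ of nonnegative integers with $\varepsilon<\prod_{i=1}^d\lambda_{n_i}(c)\le1-\varepsilon$, where $1>\lambda_0(c)>\lambda_1(c)>\cdots>0$ are the eigenvalues of the integral operator on $L^2(0,c)$ with kernel $\frac{\sin(\pi(x-y))}{\pi(x-y)}$. $\ln$ is the natural logarithm. *)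

theory Defs
  imports "HOL-Analysis.Analysis"
begin

text \<open>
  Elements of \<open>L\<^sup>2\<close> of a Euclidean space are represented by Borel measurable
  square-integrable functions; two of them are the same element iff they agree almost everywhere.
\<close>

definition L2 :: "('a::euclidean_space \<Rightarrow> complex) set" where
  "L2 = {f. f \<in> borel_measurable lborel \<and> integrable lborel (\<lambda>x. (cmod (f x))\<^sup>2)}"

definition L2_inner :: "('a::euclidean_space \<Rightarrow> complex) \<Rightarrow> ('a \<Rightarrow> complex) \<Rightarrow> complex" where
  "L2_inner f g = (LINT x|lborel. f x * cnj (g x))"

definition fourier_integral :: "('a::euclidean_space \<Rightarrow> complex) \<Rightarrow> 'a \<Rightarrow> complex" where
  "fourier_integral f \<xi> = (LINT x|lborel. f x * exp (- 2 * pi * \<i> * of_real (x \<bullet> \<xi>)))"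

text \<open>
  The Fourier transform on \<open>L\<^sup>2\<close> is the \<open>L\<^sup>2\<close>-limit of the Fourier integrals of the truncations
  of \<open>f\<close> to balls of radius \<open>R\<close> as \<open>R\<close> tends to infinity (these truncations are integrable).
  It is only determined up to null sets, hence a relation. The error is a nonnegative Lebesgue
  integral, so that no integrability convention enters.
\<close>

definition has_fourier_transform ::
    "('a::euclidean_space \<Rightarrow> complex) \<Rightarrow> ('a \<Rightarrow> complex) \<Rightarrow> bool" where
  "has_fourier_transform f F \<longleftrightarrow> f \<in> L2 \<and> F \<in> L2 \<and>
     ((\<lambda>R. \<integral>\<^sup>+\<xi>. ennreal ((cmod (fourier_integral (\<lambda>x. indicator (cball 0 R) x * f x) \<xi> - F \<xi>))\<^sup>2)
            \<partial>lborel) \<longlongrightarrow> 0) at_top"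

definition bandlimited :: "'a::euclidean_space set \<Rightarrow> ('a \<Rightarrow> complex) set" where
  "bandlimited B = {f. \<exists>F. has_fourier_transform f F \<and> (AE \<xi> in lborel. \<xi> \<notin> B \<longrightarrow> F \<xi> = 0)}"

text \<open>
  The orthogonal projections \<open>Q\<^sub>B\<close> onto the (closed) subspace of band-limited functions and \<open>P\<^sub>A\<close>
  onto functions living on \<open>A\<close>. The projection \<open>Q\<^sub>B f\<close> is unique only up to null sets; the choice
  of representative made by \<open>SOME\<close> is irrelevant below, where all equations hold almost everywhere.
\<close>

definition band_projection ::
    "'a::euclidean_space set \<Rightarrow> ('a \<Rightarrow> complex) \<Rightarrow> ('a \<Rightarrow> complex)" where
  "band_projection B f =
     (SOME g. g \<in> bandlimited B \<and> (\<forall>h\<in>bandlimited B. L2_inner (\<lambda>x. f x - g x) h = 0))"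

definition space_projection ::
    "'a::euclidean_space set \<Rightarrow> ('a \<Rightarrow> complex) \<Rightarrow> ('a \<Rightarrow> complex)" where
  "space_projection A f = (\<lambda>x. indicator A x * f x)"

definition concentration_operator ::
    "'a::euclidean_space set \<Rightarrow> 'a set \<Rightarrow> ('a \<Rightarrow> complex) \<Rightarrow> ('a \<Rightarrow> complex)" where
  "concentration_operator A B f = space_projection A (band_projection B (space_projection A f))"

text \<open>
  The operator is self-adjoint, so only real eigenvalues are considered.
\<close>

definition eigenspace ::
    "'a::euclidean_space set \<Rightarrow> 'a set \<Rightarrow> real \<Rightarrow> ('a \<Rightarrow> complex) set" where
  "eigenspace A B \<mu> =
     {f \<in> L2. AE x in lborel. concentration_operator A B f x = of_real \<mu> * f x}"

definition L2_independent :: "nat \<Rightarrow> (nat \<Rightarrow> 'a::euclidean_space \<Rightarrow> complex) \<Rightarrow> bool" where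
  "L2_independent n f \<longleftrightarrow>
     (\<forall>a :: nat \<Rightarrow> complex. (AE x in lborel. (\<Sum>i<n. a i * f i x) = 0) \<longrightarrow> (\<forall>i<n. a i = 0))"

text \<open>
  The complex dimension of a subspace of \<open>L\<^sup>2\<close> (taken modulo null functions); it is \<open>\<infinity>\<close> for
  infinite-dimensional subspaces and \<open>0\<close> if \<open>\<mu>\<close> is not an eigenvalue.
\<close>

definition L2_dim :: "('a::euclidean_space \<Rightarrow> complex) set \<Rightarrow> enat" where
  "L2_dim V = Sup {enat n | n. \<exists>f. (\<forall>i<n. f i \<in> V) \<and> L2_independent n f}"

definition multiplicity_of ::
    "'a::euclidean_space set \<Rightarrow> 'a set \<Rightarrow> real \<Rightarrow> enat" where
  "multiplicity_of A B \<mu> = L2_dim (eigenspace A B \<mu>)"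

definition space_cube :: "real \<Rightarrow> (real ^ 'n) set" where
  "space_cube c = {x. \<forall>i. 0 < x $ i \<and> x $ i < c}"

definition frequency_cube :: "(real ^ 'n) set" where
  "frequency_cube = {\<xi>. \<forall>i. - 1/2 < \<xi> $ i \<and> \<xi> $ i < 1/2}"

text \<open>
  \<open>plunge_count TYPE('n) \<epsilon> c\<close> is \<open>\<Lambda>\<^sub>\<epsilon>(c;d)\<close> for \<open>d = CARD('n)\<close>. Infinite sums of extended natural
  numbers always converge, to the supremum of the finite partial sums.
\<close>

definition plunge_count :: "'n::finite itself \<Rightarrow> real \<Rightarrow> real \<Rightarrow> enat" where
  "plunge_count _ \<epsilon> c =
     (\<Sum>\<^sub>\<infinity>\<mu>\<in>{\<epsilon><..1 - \<epsilon>}. multiplicity_of (space_cube c :: (real ^ 'n) set) frequency_cube \<mu>)"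

end

theory Submission
  imports Defs "HOL-Probability.Probability" "HOL-Complex_Analysis.Great_Picard" "HOL-Real_Asymp.Real_Asymp"
begin

text \<open>
  The bound is far below the true size of the plunge region, so an argument at one face of the
  cube suffices. With \<open>T = P\<^sub>A Q\<^sub>B P\<^sub>A\<close> one has
  \<open>\<langle>T w, w\<rangle> - \<parallel>T w\<parallel>\<^sup>2 = \<integral>\<^bsub>-A\<^esub> \<bar>Q\<^sub>B w\<bar>\<^sup>2\<close> for \<open>w\<close> supported in \<open>A\<close>, so a subspace
  on which this is at least \<open>\<kappa> \<parallel>w\<parallel>\<^sup>2\<close> yields as many orthonormal eigenvectors with
  \<open>\<mu> - \<mu>\<^sup>2 \<ge> \<kappa>\<close> as its dimension. Take \<open>w\<close> constant on each of the small cubes \<open>k + (0,s)\<^sup>d\<close>,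
  where \<open>k\<close> runs over the about \<open>c\<^bsup>d-1\<^esup>\<close> integer points of one face. In the frequency cube the
  exponentials \<open>exp (- 2 \<pi> i k \<bullet> \<xi>)\<close> are orthonormal and the Fourier transform of a small cube is
  bounded below, so \<open>\<integral> \<bar>Q\<^sub>B w\<bar>\<^sup>2\<close> is comparable to \<open>\<parallel>w\<parallel>\<^sup>2\<close>; since \<open>Q\<^sub>B w\<close> has a fixed
  profile in the direction normal to the face, a fixed fraction of this integral lies outside \<open>A\<close>.
  Hence there are at least \<open>\<lfloor>c\<rfloor>\<^bsup>d-1\<^esup>\<close> eigenvalues in \<open>[\<kappa>, 1 - \<kappa>]\<close> with \<open>\<kappa>\<close> depending only on
  \<open>d\<close>, and \<open>d - 1 \<ge> d / 2\<close> beats the \<open>d\<close>-th power of \<open>c\<^bsup>1/3\<^esup> ln c\<close>.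
\<close>

text \<open>The plunge count is defined through a projection picked by \<open>SOME\<close> and
  through eigenspaces in \<open>L2\<close>, whereas the variational argument wants an explicit
  integral operator. Two choices bridge this gap. The variational part runs on bounded real Borel
  functions with the form \<open>ip f g\<close>, the integral of \<open>f g\<close> over the cube.
  This space is neither complete nor is the form definite, but images of bounded sequences under
  \<open>T\<close> have uniformly convergent subsequences, and the eigenvector is assembled from
  such a limit. An eigenvector \<open>f\<close> is then replaced by \<open>T f / \<mu>\<close> cut
  to the cube, which is the same element of \<open>L2\<close> and is continuous off the boundary.
  Plancherel and the identification of \<open>band_projection\<close> can therefore be confined to
  bounded, almost everywhere continuous functions, where Gaussian summation with pointwise limits
  does the work. Maximization is applied to \<open>D = T - T^2\<close> rather than to
  \<open>T\<close>: the energy outside the cube is exactly the form of \<open>D\<close>, so one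
  lower bound keeps \<mu> away from 0 and from 1 simultaneously.\<close>

section \<open>Lebesgue integrals of coordinate products and affine substitution\<close>

lemma
  fixes f :: "'a::euclidean_space \<Rightarrow> real \<Rightarrow> 'b::{real_normed_field,banach,second_countable_topology}"
  assumes f: "\<And>b. b \<in> Basis \<Longrightarrow> integrable lborel (f b)"
  shows integrable_prod_Basis: "integrable lborel (\<lambda>x::'a. \<Prod>b\<in>Basis. f b (x \<bullet> b))"
    and integral_prod_Basis:
      "(LINT x|lborel. (\<Prod>b\<in>Basis. f b ((x::'a) \<bullet> b))) = (\<Prod>b\<in>Basis. (LINT t|lborel. f b t))"
proof -
  interpret product_sigma_finite "\<lambda>_::'a. lborel :: real measure" by standard
  have [measurable]: "f b \<in> borel_measurable borel" if "b \<in> Basis" for b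
    using borel_measurable_integrable[OF f[OF that]] by simp
  have m: "(\<lambda>x::'a\<Rightarrow>real. \<Sum>b\<in>Basis. x b *\<^sub>R b) \<in> (\<Pi>\<^sub>M b\<in>Basis. lborel) \<rightarrow>\<^sub>M borel"
    by measurable
  have m2: "(\<lambda>x::'a. \<Prod>b\<in>Basis. f b (x \<bullet> b)) \<in> borel_measurable borel"
    by measurable
  have c: "(\<Prod>b\<in>Basis. f b ((\<Sum>i\<in>Basis. x i *\<^sub>R i) \<bullet> b)) = (\<Prod>b\<in>Basis. f b (x b))" for x :: "'a \<Rightarrow> real"
    by (intro prod.cong) auto
  show "integrable lborel (\<lambda>x::'a. \<Prod>b\<in>Basis. f b (x \<bullet> b))"
    by (subst lborel_eq, subst integrable_distr_eq[OF m m2], subst c)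
       (intro product_integrable_prod f, auto)
  show "(LINT x|lborel. (\<Prod>b\<in>Basis. f b ((x::'a) \<bullet> b))) = (\<Prod>b\<in>Basis. (LINT t|lborel. f b t))"
    by (subst lborel_eq, subst integral_distr[OF m m2], subst c)
       (intro product_integral_prod f, auto)
qed

lemma
  fixes f :: "'a::euclidean_space \<Rightarrow> 'b::{banach,second_countable_topology}" and t :: 'a
  assumes c: "c \<noteq> 0" and f: "f \<in> borel_measurable borel"
  shows integrable_lborel_affine: "integrable lborel (\<lambda>x. f (t + c *\<^sub>R x)) \<longleftrightarrow> integrable lborel f"
    and integral_lborel_affine: "(LINT x|lborel. f x) = \<bar>c\<bar> ^ DIM('a) *\<^sub>R (LINT x|lborel. f (t + c *\<^sub>R x))"
proof -
  note [measurable] = f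
  have eq: "lborel = density (distr lborel borel (\<lambda>x::'a. t + c *\<^sub>R x)) (\<lambda>_. ennreal (\<bar>c\<bar> ^ DIM('a)))"
    by (rule lborel_affine[OF c])
  show "integrable lborel (\<lambda>x. f (t + c *\<^sub>R x)) \<longleftrightarrow> integrable lborel f"
  proof -
    have *: "integrable lborel (\<lambda>x. \<bar>c\<bar> ^ DIM('a) *\<^sub>R g x) \<longleftrightarrow> integrable lborel g" for g :: "'a \<Rightarrow> 'b"
    proof
      assume "integrable lborel (\<lambda>x. \<bar>c\<bar> ^ DIM('a) *\<^sub>R g x)"
      then have "integrable lborel (\<lambda>x. (1 / \<bar>c\<bar> ^ DIM('a)) *\<^sub>R (\<bar>c\<bar> ^ DIM('a) *\<^sub>R g x))"
        by (rule integrable_scaleR_right)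
      moreover have "(\<lambda>x. (1 / \<bar>c\<bar> ^ DIM('a)) *\<^sub>R (\<bar>c\<bar> ^ DIM('a) *\<^sub>R g x)) = g"
        using c by (simp add: fun_eq_iff)
      ultimately show "integrable lborel g" by (simp only:)
    qed auto
    have "integrable lborel f \<longleftrightarrow> integrable lborel (\<lambda>x. \<bar>c\<bar> ^ DIM('a) *\<^sub>R f (t + c *\<^sub>R x))"
      by (subst eq) (simp add: integrable_density integrable_distr_eq)
    then show ?thesis
      unfolding * ..
  qed
  show "(LINT x|lborel. f x) = \<bar>c\<bar> ^ DIM('a) *\<^sub>R (LINT x|lborel. f (t + c *\<^sub>R x))"
  proof -
    have "(LINT x|density (distr lborel borel (\<lambda>x::'a. t + c *\<^sub>R x)) (\<lambda>_. ennreal (\<bar>c\<bar> ^ DIM('a))). f x) =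
        (LINT x|lborel. \<bar>c\<bar> ^ DIM('a) *\<^sub>R f (t + c *\<^sub>R x))"
      by (subst integral_density) (simp_all add: integral_distr)
    then show ?thesis unfolding eq[symmetric] integral_scaleR_right .
  qed
qed

lemma
  fixes f :: "'a::euclidean_space \<Rightarrow> 'b::{banach,second_countable_topology}"
  assumes "f \<in> borel_measurable borel"
  shows integrable_lborel_minus: "integrable lborel (\<lambda>x. f (- x)) \<longleftrightarrow> integrable lborel f"
    and integral_lborel_minus: "(LINT x|lborel. f (- x)) = (LINT x|lborel. f x)"
proof -
  show "integrable lborel (\<lambda>x. f (- x)) \<longleftrightarrow> integrable lborel f"
    using integrable_lborel_affine[of "-1" f 0] assms by simp
  have "(LINT x|lborel. f x) = \<bar>-1\<bar> ^ DIM('a) *\<^sub>R (LINT x|lborel. f (0 + (-1) *\<^sub>R x))"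
    using assms by (intro integral_lborel_affine) auto
  also have "\<dots> = (LINT x|lborel. f (- x))"
    by simp
  finally show "(LINT x|lborel. f (- x)) = (LINT x|lborel. f x)" ..
qed

section \<open>Gaussians\<close>

text \<open>Written as a product of one-dimensional normal densities so that its mass and its
  characteristic function follow from the one-dimensional ones by Fubini.\<close>

definition gauss :: "'a::euclidean_space \<Rightarrow> real" where
  "gauss x = (\<Prod>b\<in>Basis. std_normal_density (x \<bullet> b))"

lemma gauss_eq: "gauss (x::'a::euclidean_space) = (1 / sqrt (2 * pi)) ^ DIM('a) * exp (- (norm x)\<^sup>2 / 2)"
proof -
  have "(norm x)\<^sup>2 = (\<Sum>b\<in>Basis. (x \<bullet> b)\<^sup>2)"
    unfolding power2_norm_eq_inner euclidean_inner[of x x] by (simp add: power2_eq_square)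
  then have "(\<Sum>b\<in>Basis. - (x \<bullet> b)\<^sup>2 / 2) = - (norm x)\<^sup>2 / 2"
    by (simp add: sum_negf sum_divide_distrib)
  moreover have "gauss x = (1 / sqrt (2 * pi)) ^ DIM('a) * exp (\<Sum>b\<in>Basis. - (x \<bullet> b)\<^sup>2 / 2)"
    unfolding gauss_def std_normal_density_def by (simp only: prod.distrib prod_constant exp_sum finite_Basis)
  ultimately show ?thesis by simp
qed

lemma gauss_nonneg: "gauss x \<ge> 0"
  by (simp add: gauss_eq)

lemma borel_measurable_gauss [measurable]: "gauss \<in> borel_measurable borel"
  unfolding gauss_def[abs_def] by measurable

lemma integrable_gauss: "integrable lborel (gauss :: 'a::euclidean_space \<Rightarrow> real)"
  unfolding gauss_def[abs_def]
  by (intro integrable_prod_Basis integrable_normal_density) auto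

lemma integral_gauss: "(LINT x|lborel. gauss (x::'a::euclidean_space)) = 1"
  unfolding gauss_def
  by (subst integral_prod_Basis) (auto intro!: integrable_normal_density prod.neutral integral_normal_density)

lemma std_normal_density_exp:
  "(LINT x|lborel. of_real (std_normal_density x) * exp (\<i> * of_real (t * x))) = complex_of_real (exp (- t\<^sup>2 / 2))"
  "integrable lborel (\<lambda>x. of_real (std_normal_density x) * exp (\<i> * of_real (t * x)))"
proof -
  have "char std_normal_distribution t = (LINT x|lborel. std_normal_density x *\<^sub>R iexp (t * x))"
    unfolding char_def by (subst integral_density) (auto simp: normal_density_nonneg)
  then show "(LINT x|lborel. of_real (std_normal_density x) * exp (\<i> * of_real (t * x))) = complex_of_real (exp (- t\<^sup>2 / 2))"
    by (simp add: char_std_normal_distribution scaleR_conv_of_real)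
  show "integrable lborel (\<lambda>x. of_real (std_normal_density x) * exp (\<i> * of_real (t * x)) :: complex)"
    by (rule Bochner_Integration.integrable_bound[OF integrable_normal_density[of 1 0]])
       (auto simp: norm_mult)
qed

lemma gauss_char:
  fixes t :: "'a::euclidean_space"
  shows "(LINT x|lborel. of_real (gauss x) * exp (\<i> * of_real (t \<bullet> x))) = of_real (exp (- (norm t)\<^sup>2 / 2))"
proof -
  have nt: "(norm t)\<^sup>2 = (\<Sum>b\<in>Basis. (t \<bullet> b)\<^sup>2)"
    unfolding power2_norm_eq_inner euclidean_inner[of t t] by (simp add: power2_eq_square)
  have "of_real (gauss x) * exp (\<i> * of_real (t \<bullet> x)) =
      (\<Prod>b\<in>Basis. of_real (std_normal_density (x \<bullet> b)) * exp (\<i> * of_real ((t \<bullet> b) * (x \<bullet> b))))" for x :: 'a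
    by (simp add: gauss_def prod.distrib euclidean_inner[of t x] sum_distrib_left exp_sum)
  then have "(LINT x|lborel. of_real (gauss x) * exp (\<i> * of_real (t \<bullet> x))) =
      (\<Prod>b\<in>Basis. complex_of_real (exp (- (t \<bullet> b)\<^sup>2 / 2)))"
    by (simp only: std_normal_density_exp integral_prod_Basis[where
      f="\<lambda>b s. of_real (std_normal_density s) * exp (\<i> * of_real ((t \<bullet> b) * s))"])
  also have "\<dots> = of_real (exp (- (norm t)\<^sup>2 / 2))"
    unfolding of_real_prod[symmetric] exp_sum[OF finite_Basis, symmetric] nt sum_divide_distrib sum_negf[symmetric] ..
  finally show ?thesis .
qed

section \<open>Fourier integrals\<close>

lemma integrable_mult_fourier_kernel:
  "integrable lborel f \<Longrightarrow> integrable lborel (\<lambda>x. f x * exp (- 2 * pi * \<i> * of_real (x \<bullet> \<xi>)))"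
  by (rule Bochner_Integration.integrable_bound[where f=f]) (auto simp: norm_mult)

lemma fourier_integral_bound:
  "cmod (fourier_integral f \<xi>) \<le> (LINT x|lborel. cmod (f x))"
proof -
  have "cmod (fourier_integral f \<xi>) \<le> (LINT x|lborel. cmod (f x * exp (- 2 * pi * \<i> * of_real (x \<bullet> \<xi>))))"
    unfolding fourier_integral_def by (rule integral_norm_bound)
  then show ?thesis
    by (simp add: norm_mult)
qed

lemma continuous_fourier_integral:
  assumes f: "integrable lborel f"
  shows "continuous_on UNIV (fourier_integral f)"
proof -
  have [measurable]: "f \<in> borel_measurable borel"
    using borel_measurable_integrable[OF f] by simp
  have "fourier_integral f \<midarrow>\<xi>\<rightarrow> fourier_integral f \<xi>" for \<xi>
  proof (subst tendsto_at_iff_sequentially, intro allI impI)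
    fix X assume X: "X \<longlonglongrightarrow> \<xi>"
    show "(fourier_integral f \<circ> X) \<longlonglongrightarrow> fourier_integral f \<xi>"
      unfolding fourier_integral_def o_def
    proof (rule integral_dominated_convergence[where w="\<lambda>x. cmod (f x)"])
      show "AE x in lborel. (\<lambda>i. f x * exp (- 2 * pi * \<i> * of_real (x \<bullet> X i)))
          \<longlonglongrightarrow> f x * exp (- 2 * pi * \<i> * of_real (x \<bullet> \<xi>))"
        by (intro AE_I2 tendsto_intros X)
    qed (use f in \<open>auto simp: norm_mult\<close>)
  qed
  then show ?thesis
    by (auto simp: continuous_on_def)
qed

lemma borel_measurable_fourier_integral:
  "integrable lborel f \<Longrightarrow> fourier_integral f \<in> borel_measurable borel"
  using continuous_fourier_integral by (rule borel_measurable_continuous_onI)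

lemma cnj_fourier_integral:
  "cnj (fourier_integral f \<xi>) = fourier_integral (\<lambda>x. cnj (f x)) (- \<xi>)"
  unfolding fourier_integral_def
  by (subst Bochner_Integration.integral_cnj[symmetric]) (simp add: exp_cnj)

lemma integrable_mult_bounded:
  fixes f g :: "_ \<Rightarrow> complex"
  assumes "integrable M f" "g \<in> borel_measurable M" "\<And>x. cmod (g x) \<le> C"
  shows "integrable M (\<lambda>x. f x * g x)"
proof (rule Bochner_Integration.integrable_bound[where f="\<lambda>x. C * cmod (f x)"])
  show "AE x in M. norm (f x * g x) \<le> norm (C * cmod (f x))"
  proof (intro AE_I2)
    fix x
    have "0 \<le> C" using assms(3)[of x] norm_ge_zero[of "g x"] by linarith
    then show "norm (f x * g x) \<le> norm (C * cmod (f x))"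
      using assms(3)[of x] by (simp add: norm_mult mult.commute[of "cmod (f x)"] mult_right_mono)
  qed
qed (use assms in auto)

text \<open>Fubini, with a kernel symmetric in \<open>x\<close> and \<open>\<xi>\<close>. The scale
  \<open>s\<close> is there for the values 1 and -1: the latter absorbs the reflection that
  conjugation produces in \<open>cnj_fourier_integral\<close>.\<close>

lemma fourier_multiplication_formula:
  assumes f: "integrable lborel f" and g: "integrable lborel g"
  shows "(LINT \<xi>|lborel. fourier_integral f (s *\<^sub>R \<xi>) * g \<xi>) = (LINT x|lborel. f x * fourier_integral g (s *\<^sub>R x))"
proof -
  have [measurable]: "f \<in> borel_measurable borel" "g \<in> borel_measurable borel"
    using borel_measurable_integrable[OF f] borel_measurable_integrable[OF g] by simp_all
  have p: "integrable (lborel \<Otimes>\<^sub>M lborel) (\<lambda>(x, y). f x * g y)"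
  proof (rule lborel_pair.Fubini_integrable)
    show "integrable lborel (\<lambda>x. LINT y|lborel. norm (case (x, y) of (x, y) \<Rightarrow> f x * g y))"
      using f by (simp add: norm_mult)
  qed (use g in auto)
  have "integrable (lborel \<Otimes>\<^sub>M lborel)
      (\<lambda>(x, \<xi>). f x * exp (- 2 * pi * \<i> * of_real (x \<bullet> (s *\<^sub>R \<xi>))) * g \<xi>)"
    by (rule Bochner_Integration.integrable_bound[OF p]) (auto simp: norm_mult)
  from lborel_pair.Fubini_integral[OF this]
  have "(LINT \<xi>|lborel. (LINT x|lborel. f x * exp (- 2 * pi * \<i> * of_real (x \<bullet> (s *\<^sub>R \<xi>))) * g \<xi>)) =
      (LINT x|lborel. (LINT \<xi>|lborel. f x * exp (- 2 * pi * \<i> * of_real (x \<bullet> (s *\<^sub>R \<xi>))) * g \<xi>))"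
    by simp
  moreover have "(LINT \<xi>|lborel. f x * exp (- 2 * pi * \<i> * of_real (x \<bullet> (s *\<^sub>R \<xi>))) * g \<xi>) =
      f x * fourier_integral g (s *\<^sub>R x)" for x
    unfolding fourier_integral_def
    by (subst integral_mult_right_zero[symmetric]) (simp add: inner_commute mult_ac)
  ultimately show ?thesis
    by (simp add: fourier_integral_def integral_mult_left_zero)
qed

section \<open>Gaussian summation of Fourier integrals\<close>

text \<open>The normalization makes the Fourier integral of the cutoff the probability density of a
  normal vector with standard deviation \<open>\<epsilon>\<close> in each coordinate, that is, an
  approximate identity as \<open>\<epsilon>\<close> tends to 0.\<close>

definition gauss_cutoff :: "real \<Rightarrow> 'a::euclidean_space \<Rightarrow> real" where
  "gauss_cutoff \<epsilon> \<xi> = exp (- (norm ((2 * pi * \<epsilon>) *\<^sub>R \<xi>))\<^sup>2 / 2)"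

lemma gauss_cutoff_eq:
  "gauss_cutoff \<epsilon> \<xi> = sqrt (2 * pi) ^ DIM('a) * gauss ((2 * pi * \<epsilon>) *\<^sub>R (\<xi>::'a::euclidean_space))"
  by (simp add: gauss_cutoff_def gauss_eq power_divide)

lemma integrable_gauss_cutoff:
  assumes "\<epsilon> > 0"
  shows "integrable lborel (gauss_cutoff \<epsilon> :: 'a::euclidean_space \<Rightarrow> real)"
  unfolding gauss_cutoff_eq[abs_def]
  using integrable_lborel_affine[of "2 * pi * \<epsilon>" gauss "0::'a"] assms integrable_gauss by simp

lemma borel_measurable_gauss_cutoff [measurable]: "gauss_cutoff \<epsilon> \<in> borel_measurable borel"
  unfolding gauss_cutoff_def[abs_def] by measurable

lemma gauss_cutoff_bounds: "0 \<le> gauss_cutoff \<epsilon> \<xi>" "gauss_cutoff \<epsilon> \<xi> \<le> 1"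
  by (auto simp: gauss_cutoff_def)

lemma fourier_integral_gauss_cutoff:
  fixes u :: "'a::euclidean_space"
  assumes e: "\<epsilon> > 0"
  shows "fourier_integral (\<lambda>\<xi>. of_real (gauss_cutoff \<epsilon> \<xi>)) u = of_real ((1 / \<epsilon>) ^ DIM('a) * gauss ((1 / \<epsilon>) *\<^sub>R u))"
proof -
  let ?c = "2 * pi * \<epsilon>"
  have c: "?c \<noteq> 0" "?c > 0" using e by auto
  let ?v = "- (1 / \<epsilon>) *\<^sub>R u"
  let ?g = "\<lambda>x::'a. of_real (gauss x) * exp (\<i> * of_real (?v \<bullet> x))"
  have "?v \<bullet> (?c *\<^sub>R \<xi>) = - 2 * pi * (\<xi> \<bullet> u)" for \<xi>
    using e by (simp add: inner_commute)
  then have eq: "of_real (gauss_cutoff \<epsilon> \<xi>) * exp (- 2 * pi * \<i> * of_real (\<xi> \<bullet> u)) =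
      of_real (sqrt (2 * pi) ^ DIM('a)) * ?g (?c *\<^sub>R \<xi>)" for \<xi>
    unfolding gauss_cutoff_eq by (simp add: mult_ac)
  have "?g \<in> borel_measurable borel" by measurable
  from integral_lborel_affine[OF c(1) this, of 0] gauss_char[of ?v]
  have A: "?c ^ DIM('a) *\<^sub>R (LINT x|lborel. ?g (?c *\<^sub>R x)) = of_real (exp (- (norm ?v)\<^sup>2 / 2))"
    using c by simp
  have "fourier_integral (\<lambda>\<xi>. of_real (gauss_cutoff \<epsilon> \<xi>)) u =
      of_real (sqrt (2 * pi) ^ DIM('a)) * (LINT x|lborel. ?g (?c *\<^sub>R x))"
    unfolding fourier_integral_def eq by simp
  also have "(LINT x|lborel. ?g (?c *\<^sub>R x)) = of_real (exp (- (norm ?v)\<^sup>2 / 2) / ?c ^ DIM('a))"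
  proof -
    have "I = of_real (E / a)" if "a *\<^sub>R I = of_real E" "a \<noteq> 0" for a E :: real and I :: complex
      using that by (auto simp: scaleR_conv_of_real field_simps)
    from this[OF A] c show ?thesis by simp
  qed
  also have "of_real (sqrt (2 * pi) ^ DIM('a)) * of_real (exp (- (norm ?v)\<^sup>2 / 2) / ?c ^ DIM('a)) =
     (of_real ((1 / \<epsilon>) ^ DIM('a) * gauss ((1 / \<epsilon>) *\<^sub>R u)) :: complex)"
  proof -
    have "sqrt (2 * pi) / ?c = (1 / \<epsilon>) * (1 / sqrt (2 * pi))"
      using e by (simp add: field_simps flip: power2_eq_square)
    then have 1: "sqrt (2 * pi) ^ DIM('a) / ?c ^ DIM('a) = (1 / \<epsilon>) ^ DIM('a) * (1 / sqrt (2 * pi)) ^ DIM('a)"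
      by (simp only: power_divide[symmetric] power_mult_distrib[symmetric])
    have 2: "gauss ((1 / \<epsilon>) *\<^sub>R u) = (1 / sqrt (2 * pi)) ^ DIM('a) * exp (- (norm ?v)\<^sup>2 / 2)"
      by (simp add: gauss_eq)
    have 3: "S * (E / C) = P * G" if "S / C = P * Q" "G = Q * E" for S E C P Q G :: real
    proof -
      have "S * (E / C) = (S / C) * E" by simp
      then show ?thesis by (simp add: that)
    qed
    have "sqrt (2 * pi) ^ DIM('a) * (exp (- (norm ?v)\<^sup>2 / 2) / ?c ^ DIM('a)) =
      (1 / \<epsilon>) ^ DIM('a) * gauss ((1 / \<epsilon>) *\<^sub>R u)"
      by (rule 3[OF 1 2])
    then show ?thesis by (simp only: of_real_mult[symmetric])
  qed
  finally show ?thesis .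
qed

lemma fourier_integral_modulate:
  "fourier_integral (\<lambda>\<xi>. exp (2 * pi * \<i> * of_real (y \<bullet> \<xi>)) * g \<xi>) x = fourier_integral g (x - y)"
  unfolding fourier_integral_def
proof (intro Bochner_Integration.integral_cong refl)
  fix \<xi>
  have **: "exp (2 * pi * \<i> * of_real (y \<bullet> \<xi>)) * exp (- 2 * pi * \<i> * of_real (\<xi> \<bullet> x)) =
      exp (- 2 * pi * \<i> * of_real (\<xi> \<bullet> (x - y)))"
  proof -
    have "2 * pi * \<i> * of_real (y \<bullet> \<xi>) + - 2 * pi * \<i> * of_real (\<xi> \<bullet> x) = - 2 * pi * \<i> * of_real (\<xi> \<bullet> (x - y))"
      by (simp add: inner_diff_right inner_commute[of y \<xi>] right_diff_distrib)
    then show ?thesis by (simp only: exp_add[symmetric])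
  qed
  have *: "a * b * c = b * d" if "a * c = d" for a b c d :: complex
    by (simp add: that[symmetric])
  show "exp (2 * pi * \<i> * of_real (y \<bullet> \<xi>)) * g \<xi> * exp (- 2 * pi * \<i> * of_real (\<xi> \<bullet> x)) =
      g \<xi> * exp (- 2 * pi * \<i> * of_real (\<xi> \<bullet> (x - y)))"
    by (rule *[OF **])
qed

lemma borel_measurable_cnj [measurable (raw)]:
  assumes "f \<in> borel_measurable M"
  shows "(\<lambda>x. cnj (f x)) \<in> borel_measurable M"
proof -
  have "cnj \<in> borel_measurable borel"
    by (intro borel_measurable_continuous_onI continuous_intros)
  then show ?thesis using assms by (rule measurable_compose[rotated])
qed

text \<open>The multiplication formula for \<open>f\<close> and the modulated cutoff turns the left
  side into \<open>f\<close> averaged against a Gaussian of width \<open>\<epsilon>\<close> about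
  \<open>y\<close>. Substituting \<open>x = y + \<epsilon> z\<close> moves \<open>\<epsilon>\<close>
  from the Gaussian into the argument of \<open>f\<close>, so that small \<open>\<epsilon>\<close>
  becomes a question of pointwise continuity.\<close>

lemma fourier_inversion_gauss:
  fixes f :: "'a::euclidean_space \<Rightarrow> complex"
  assumes f: "integrable lborel f" and e: "\<epsilon> > 0"
  shows "fourier_integral (\<lambda>\<xi>. fourier_integral f \<xi> * of_real (gauss_cutoff \<epsilon> \<xi>)) (- y) =
    (LINT z|lborel. f (y + \<epsilon> *\<^sub>R z) * of_real (gauss z))"
proof -
  have [measurable]: "f \<in> borel_measurable borel"
    using borel_measurable_integrable[OF f] by simp
  have [measurable]: "(gauss :: 'a \<Rightarrow> real) \<in> borel_measurable borel"
    by (rule borel_measurable_gauss)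
  let ?G = "\<lambda>\<xi>::'a. complex_of_real (gauss_cutoff \<epsilon> \<xi>)"
  let ?m = "\<lambda>\<xi>. exp (2 * pi * \<i> * of_real (y \<bullet> \<xi>)) * ?G \<xi>"
  have G: "integrable lborel ?G"
    using integrable_gauss_cutoff[OF e] by (rule integrable_of_real)
  have m: "integrable lborel ?m"
  proof (rule Bochner_Integration.integrable_bound[OF G])
    show "?m \<in> borel_measurable lborel" by measurable
  qed (simp add: norm_mult norm_exp_eq_Re)
  have "fourier_integral (\<lambda>\<xi>. fourier_integral f \<xi> * ?G \<xi>) (- y) = (LINT \<xi>|lborel. fourier_integral f (1 *\<^sub>R \<xi>) * ?m \<xi>)"
    unfolding fourier_integral_def[of "\<lambda>\<xi>. fourier_integral f \<xi> * ?G \<xi>"]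
    by (intro Bochner_Integration.integral_cong refl) (simp add: inner_commute)
  also have "\<dots> = (LINT x|lborel. f x * fourier_integral ?m (1 *\<^sub>R x))"
    by (rule fourier_multiplication_formula[OF f m])
  also have "\<dots> = (LINT x|lborel. f x * of_real ((1 / \<epsilon>) ^ DIM('a) * gauss ((1 / \<epsilon>) *\<^sub>R (x - y))))"
    by (simp only: fourier_integral_modulate fourier_integral_gauss_cutoff[OF e] scaleR_one)
  also have "\<dots> = \<bar>\<epsilon>\<bar> ^ DIM('a) *\<^sub>R (LINT z|lborel. f (y + \<epsilon> *\<^sub>R z) *
      of_real ((1 / \<epsilon>) ^ DIM('a) * gauss ((1 / \<epsilon>) *\<^sub>R (y + \<epsilon> *\<^sub>R z - y))))"
    using e by (intro integral_lborel_affine) auto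
  also have "\<dots> = (LINT z|lborel. \<bar>\<epsilon>\<bar> ^ DIM('a) *\<^sub>R (f (y + \<epsilon> *\<^sub>R z) *
      of_real ((1 / \<epsilon>) ^ DIM('a) * gauss ((1 / \<epsilon>) *\<^sub>R (y + \<epsilon> *\<^sub>R z - y)))))"
    by (rule integral_scaleR_right[symmetric])
  also have "\<dots> = (LINT z|lborel. f (y + \<epsilon> *\<^sub>R z) * of_real (gauss z))"
    using e by (intro Bochner_Integration.integral_cong refl) (simp add: scaleR_conv_of_real power_divide)
  finally show ?thesis .
qed

text \<open>The Gaussian averages of \<open>f\<close> are bounded by \<open>M\<close> and converge
  to \<open>f\<close> at each continuity point, so dominated convergence against the integrable
  \<open>h\<close> applies. Boundedness and continuity almost everywhere take the place of a density
  argument in \<open>L2\<close>.\<close>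

lemma parseval_gauss_limit:
  fixes f h :: "'a::euclidean_space \<Rightarrow> complex"
  assumes f: "integrable lborel f" and h: "integrable lborel h"
    and M: "\<And>x. cmod (f x) \<le> M" and c: "AE x in lborel. isCont f x"
  shows "(\<lambda>n. LINT \<xi>|lborel. fourier_integral f \<xi> * cnj (fourier_integral h \<xi>) * of_real (gauss_cutoff (1 / Suc n) \<xi>))
     \<longlonglongrightarrow> (LINT x|lborel. f x * cnj (h x))"
proof -
  have [measurable]: "f \<in> borel_measurable borel" "h \<in> borel_measurable borel"
    using borel_measurable_integrable[OF f] borel_measurable_integrable[OF h] by simp_all
  have [measurable]: "(gauss :: 'a \<Rightarrow> real) \<in> borel_measurable borel"
    by (rule borel_measurable_gauss)
  \<comment> \<open>The average of \<open>f\<close> around \<open>y\<close> at scale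
    \<open>1 / Suc n\<close>; by \<open>fourier_inversion_gauss\<close> it is what pairs with
    \<open>cnj h\<close> once the transform of \<open>h\<close> has been moved over.\<close>
  define A where "A n y = (LINT z|lborel. f (y + (1 / Suc n) *\<^sub>R z) * of_real (gauss z))" for n y
  have gi: "integrable lborel (\<lambda>z::'a. M * gauss z)"
    by (intro integrable_mult_right integrable_gauss)
  have bd: "cmod (f x * of_real (gauss z)) \<le> M * gauss z" for x z
    using M[of x] gauss_nonneg[of z] by (simp add: norm_mult mult_right_mono)
  have [measurable]: "A n \<in> borel_measurable borel" for n
    unfolding A_def by measurable
  have A_bound: "cmod (A n y) \<le> M" for n y
  proof -
    have "cmod (A n y) \<le> (LINT z|lborel. cmod (f (y + (1 / Suc n) *\<^sub>R z) * of_real (gauss z)))"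
      unfolding A_def by (rule integral_norm_bound)
    also have "\<dots> \<le> (LINT z|lborel. M * gauss (z::'a))"
      by (rule integral_mono'[OF gi]) (use bd gauss_nonneg in \<open>auto intro: order_trans[OF norm_ge_zero bd]\<close>)
    finally have "cmod (A n y) \<le> (LINT z|lborel. M * gauss (z::'a))" .
    then show ?thesis by (simp add: integral_gauss)
  qed
  have A_lim: "(\<lambda>n. A n y) \<longlonglongrightarrow> f y" if y: "isCont f y" for y
  proof -
    have "(\<lambda>n. A n y) \<longlonglongrightarrow> (LINT z|lborel. f y * of_real (gauss (z::'a)))"
      unfolding A_def
    proof (rule integral_dominated_convergence[where w="\<lambda>z. M * gauss z"])
      show "AE z in lborel. (\<lambda>n. f (y + (1 / Suc n) *\<^sub>R z) * of_real (gauss z)) \<longlonglongrightarrow> f y * of_real (gauss z)"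
      proof (intro AE_I2 tendsto_mult tendsto_const)
        fix z :: 'a
        have "(\<lambda>n. y + (1 / real (Suc n)) *\<^sub>R z) \<longlonglongrightarrow> y + 0 *\<^sub>R z"
          using LIMSEQ_inverse_real_of_nat by (intro tendsto_intros) (simp add: inverse_eq_divide)
        then show "(\<lambda>n. f (y + (1 / Suc n) *\<^sub>R z)) \<longlonglongrightarrow> f y"
          using isCont_tendsto_compose[OF y] by simp
      qed
    qed (use gi bd in auto)
    then show ?thesis
      by (simp add: integral_gauss)
  qed
  have "(LINT \<xi>|lborel. fourier_integral f \<xi> * cnj (fourier_integral h \<xi>) * of_real (gauss_cutoff (1 / Suc n) \<xi>)) =
      (LINT y|lborel. cnj (h y) * A n y)" for n
  proof -
    let ?k = "\<lambda>\<xi>. fourier_integral f \<xi> * of_real (gauss_cutoff (1 / Suc n) \<xi>)"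
    have k: "integrable lborel ?k"
      unfolding mult.commute[of "fourier_integral f _"]
      by (rule integrable_mult_bounded[where C="LINT x|lborel. cmod (f x)"])
         (use f in \<open>auto intro!: fourier_integral_bound borel_measurable_fourier_integral integrable_of_real integrable_gauss_cutoff\<close>)
    have "(LINT \<xi>|lborel. fourier_integral f \<xi> * cnj (fourier_integral h \<xi>) * of_real (gauss_cutoff (1 / Suc n) \<xi>)) =
       (LINT \<xi>|lborel. fourier_integral (\<lambda>x. cnj (h x)) (- 1 *\<^sub>R \<xi>) * ?k \<xi>)"
      by (intro Bochner_Integration.integral_cong refl) (simp add: cnj_fourier_integral mult_ac)
    also have "\<dots> = (LINT x|lborel. cnj (h x) * fourier_integral ?k (- 1 *\<^sub>R x))"
      using h k by (intro fourier_multiplication_formula) auto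
    also have "\<dots> = (LINT y|lborel. cnj (h y) * A n y)"
      unfolding A_def by (intro Bochner_Integration.integral_cong refl) (simp add: fourier_inversion_gauss[OF f])
    finally show ?thesis .
  qed
  moreover have "(\<lambda>n. LINT y|lborel. cnj (h y) * A n y) \<longlonglongrightarrow> (LINT y|lborel. cnj (h y) * f y)"
  proof (rule integral_dominated_convergence[where w="\<lambda>y. M * cmod (h y)"])
    show "AE y in lborel. (\<lambda>n. cnj (h y) * A n y) \<longlonglongrightarrow> cnj (h y) * f y"
      using c by eventually_elim (intro tendsto_intros A_lim)
    show "AE y in lborel. norm (cnj (h y) * A n y) \<le> M * cmod (h y)" for n
      using A_bound by (simp add: norm_mult mult.commute[of M] mult_left_mono)
  qed (use h in auto)
  ultimately show ?thesis
    by (simp add: mult.commute)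
qed

lemma gauss_cutoff_tendsto: "(\<lambda>n. gauss_cutoff (1 / Suc n) \<xi>) \<longlonglongrightarrow> 1"
proof -
  have "(\<lambda>n. 1 / real (Suc n)) \<longlonglongrightarrow> 0"
    using LIMSEQ_inverse_real_of_nat by (simp add: inverse_eq_divide)
  then have "(\<lambda>n. exp (- (norm ((2 * pi * (1 / real (Suc n))) *\<^sub>R \<xi>))\<^sup>2 / 2)) \<longlonglongrightarrow>
      exp (- (norm ((2 * pi * 0) *\<^sub>R \<xi>))\<^sup>2 / 2)"
    by (intro tendsto_intros) auto
  then show ?thesis
    by (simp add: gauss_cutoff_def)
qed

lemma gauss_cutoff_mono: "mono (\<lambda>n. gauss_cutoff (1 / Suc n) \<xi>)"
proof (rule monoI)
  fix m n :: nat assume "m \<le> n"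
  then have "1 / real (Suc n) \<le> 1 / real (Suc m)"
    by (simp add: frac_le)
  then have "2 * pi * (1 / real (Suc n)) \<le> 2 * pi * (1 / real (Suc m))"
    by (rule mult_left_mono) simp
  then have "norm ((2 * pi * (1 / real (Suc n))) *\<^sub>R \<xi>) \<le> norm ((2 * pi * (1 / real (Suc m))) *\<^sub>R \<xi>)"
    unfolding norm_scaleR by (intro mult_right_mono) auto
  then show "gauss_cutoff (1 / Suc m) \<xi> \<le> gauss_cutoff (1 / Suc n) \<xi>"
    by (simp add: gauss_cutoff_def power_mono)
qed

section \<open>Plancherel and Parseval for bounded, almost everywhere continuous functions\<close>

text \<open>Take \<open>h = f\<close> in the Gaussian limit. The cutoffs increase to 1, so monotone
  convergence yields the square-integrability of the transform together with the value of the
  integral.\<close>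

lemma
  fixes f :: "'a::euclidean_space \<Rightarrow> complex"
  assumes f: "integrable lborel f" and M: "\<And>x. cmod (f x) \<le> M" and c: "AE x in lborel. isCont f x"
  shows integrable_fourier_integral_square: "integrable lborel (\<lambda>\<xi>. (cmod (fourier_integral f \<xi>))\<^sup>2)"
    and plancherel_bounded: "(LINT \<xi>|lborel. (cmod (fourier_integral f \<xi>))\<^sup>2) = (LINT x|lborel. (cmod (f x))\<^sup>2)"
proof -
  let ?u = "\<lambda>n \<xi>. (cmod (fourier_integral f \<xi>))\<^sup>2 * gauss_cutoff (1 / Suc n) \<xi>"
  have [measurable]: "fourier_integral f \<in> borel_measurable borel"
    by (rule borel_measurable_fourier_integral[OF f])
  have sq: "z * cnj z = of_real ((cmod z)\<^sup>2)" for z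
    by (simp only: complex_norm_square)
  have int: "integrable lborel (?u n)" for n
  proof (rule Bochner_Integration.integrable_bound[where f="\<lambda>\<xi>. (LINT x|lborel. cmod (f x))\<^sup>2 * gauss_cutoff (1 / Suc n) \<xi>"])
    show "AE \<xi> in lborel. norm (?u n \<xi>) \<le> norm ((LINT x|lborel. cmod (f x))\<^sup>2 * gauss_cutoff (1 / Suc n) \<xi>)"
      by (auto simp: abs_mult gauss_cutoff_bounds intro!: mult_right_mono power_mono fourier_integral_bound)
    show "integrable lborel (\<lambda>\<xi>. (LINT x|lborel. cmod (f x))\<^sup>2 * gauss_cutoff (1 / Suc n) \<xi>)"
      by (intro integrable_mult_right integrable_gauss_cutoff) auto
  qed auto
  have "(\<lambda>n. LINT \<xi>|lborel. fourier_integral f \<xi> * cnj (fourier_integral f \<xi>) * of_real (gauss_cutoff (1 / Suc n) \<xi>))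
     \<longlonglongrightarrow> (LINT x|lborel. f x * cnj (f x))"
    by (rule parseval_gauss_limit[OF f f M c])
  then have "(\<lambda>n. complex_of_real (LINT \<xi>|lborel. ?u n \<xi>)) \<longlonglongrightarrow> of_real (LINT x|lborel. (cmod (f x))\<^sup>2)"
    unfolding sq of_real_mult[symmetric] integral_complex_of_real .
  then have lim: "(\<lambda>n. LINT \<xi>|lborel. ?u n \<xi>) \<longlonglongrightarrow> (LINT x|lborel. (cmod (f x))\<^sup>2)"
    using tendsto_of_real_iff by blast
  have mono: "AE \<xi> in lborel. mono (\<lambda>n. ?u n \<xi>)"
  proof (intro AE_I2 monoI)
    fix \<xi> :: 'a and m n :: nat assume "m \<le> n"
    then show "?u m \<xi> \<le> ?u n \<xi>"
      by (intro mult_left_mono monoD[OF gauss_cutoff_mono]) auto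
  qed
  have conv: "AE \<xi> in lborel. (\<lambda>n. ?u n \<xi>) \<longlonglongrightarrow> (cmod (fourier_integral f \<xi>))\<^sup>2"
  proof (intro AE_I2)
    fix \<xi> :: 'a
    show "(\<lambda>n. ?u n \<xi>) \<longlonglongrightarrow> (cmod (fourier_integral f \<xi>))\<^sup>2"
      using tendsto_mult[OF tendsto_const gauss_cutoff_tendsto, of "(cmod (fourier_integral f \<xi>))\<^sup>2" \<xi>] by simp
  qed
  have meas: "(\<lambda>\<xi>. (cmod (fourier_integral f \<xi>))\<^sup>2) \<in> borel_measurable lborel"
    by measurable
  show "integrable lborel (\<lambda>\<xi>. (cmod (fourier_integral f \<xi>))\<^sup>2)"
    by (rule integrable_monotone_convergence[OF int mono conv lim meas])
  show "(LINT \<xi>|lborel. (cmod (fourier_integral f \<xi>))\<^sup>2) = (LINT x|lborel. (cmod (f x))\<^sup>2)"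
    by (rule integral_monotone_convergence[OF int mono conv lim meas])
qed

lemma cmod_mult_le_squares: "cmod (a * b) \<le> (cmod a)\<^sup>2 + (cmod b)\<^sup>2"
proof -
  have "0 \<le> (cmod a - cmod b)\<^sup>2" "0 \<le> (cmod a)\<^sup>2" "0 \<le> (cmod b)\<^sup>2" by auto
  moreover have "0 \<le> cmod a * cmod b" by simp
  ultimately show ?thesis unfolding norm_mult power2_diff by linarith
qed

lemma integrable_mult_cnj:
  fixes f g :: "_ \<Rightarrow> complex"
  assumes "f \<in> borel_measurable M" "g \<in> borel_measurable M"
    "integrable M (\<lambda>x. (cmod (f x))\<^sup>2)" "integrable M (\<lambda>x. (cmod (g x))\<^sup>2)"
  shows "integrable M (\<lambda>x. f x * cnj (g x))"
  by (rule Bochner_Integration.integrable_bound[OF Bochner_Integration.integrable_add[OF assms(3,4)]])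
     (use assms cmod_mult_le_squares[of "f _" "cnj (g _)"] in \<open>auto intro: order_trans[OF _ abs_ge_self]\<close>)

text \<open>Both transforms being square-integrable, their product is integrable and dominates the
  cut-off integrands. The assumptions on \<open>f\<close> and \<open>h\<close> differ because
  \<open>h\<close> will be the truncation of an arbitrary band-limited function, which need be
  neither bounded nor continuous.\<close>

lemma parseval_bounded:
  fixes f h :: "'a::euclidean_space \<Rightarrow> complex"
  assumes f: "integrable lborel f" and M: "\<And>x. cmod (f x) \<le> M" and c: "AE x in lborel. isCont f x"
    and h: "integrable lborel h" and h2: "integrable lborel (\<lambda>\<xi>. (cmod (fourier_integral h \<xi>))\<^sup>2)"
  shows "(LINT \<xi>|lborel. fourier_integral f \<xi> * cnj (fourier_integral h \<xi>)) = (LINT x|lborel. f x * cnj (h x))"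
proof -
  have [measurable]: "fourier_integral f \<in> borel_measurable borel" "fourier_integral h \<in> borel_measurable borel"
    by (rule borel_measurable_fourier_integral[OF f] borel_measurable_fourier_integral[OF h])+
  have "integrable lborel (\<lambda>\<xi>. fourier_integral f \<xi> * cnj (fourier_integral h \<xi>))"
    by (intro integrable_mult_cnj h2 integrable_fourier_integral_square[OF f M c]) auto
  then have w: "integrable lborel (\<lambda>\<xi>. norm (fourier_integral f \<xi> * cnj (fourier_integral h \<xi>)))"
    by (rule integrable_norm)
  have "(\<lambda>n. LINT \<xi>|lborel. fourier_integral f \<xi> * cnj (fourier_integral h \<xi>) * of_real (gauss_cutoff (1 / Suc n) \<xi>))
     \<longlonglongrightarrow> (LINT \<xi>|lborel. fourier_integral f \<xi> * cnj (fourier_integral h \<xi>))"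
  proof (rule integral_dominated_convergence[OF _ _ w])
    show "AE \<xi> in lborel. (\<lambda>n. fourier_integral f \<xi> * cnj (fourier_integral h \<xi>) * of_real (gauss_cutoff (1 / Suc n) \<xi>))
        \<longlonglongrightarrow> fourier_integral f \<xi> * cnj (fourier_integral h \<xi>)"
    proof (intro AE_I2)
      fix \<xi> :: 'a
      show "(\<lambda>n. fourier_integral f \<xi> * cnj (fourier_integral h \<xi>) * of_real (gauss_cutoff (1 / Suc n) \<xi>))
        \<longlonglongrightarrow> fourier_integral f \<xi> * cnj (fourier_integral h \<xi>)"
        using tendsto_mult[OF tendsto_const tendsto_of_real[OF gauss_cutoff_tendsto],
            of "fourier_integral f \<xi> * cnj (fourier_integral h \<xi>)" \<xi>] by simp
    qed
    show "AE \<xi> in lborel. norm (fourier_integral f \<xi> * cnj (fourier_integral h \<xi>) * of_real (gauss_cutoff (1 / Suc n) \<xi>))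
        \<le> norm (fourier_integral f \<xi> * cnj (fourier_integral h \<xi>))" for n
      by (intro AE_I2) (simp add: norm_mult gauss_cutoff_bounds mult_left_le)
  qed auto
  with parseval_gauss_limit[OF f h M c] show ?thesis
    using LIMSEQ_unique by blast
qed

section \<open>The Fourier transform on square-integrable functions\<close>

lemma L2_I:
  "f \<in> borel_measurable borel \<Longrightarrow> integrable lborel (\<lambda>x. (cmod (f x))\<^sup>2) \<Longrightarrow> f \<in> L2"
  by (simp add: L2_def)

lemma L2_D:
  assumes "f \<in> L2"
  shows "f \<in> borel_measurable borel" "integrable lborel (\<lambda>x. (cmod (f x))\<^sup>2)"
  using assms by (auto simp: L2_def)

lemma integrable_L2_mult_cnj: "f \<in> L2 \<Longrightarrow> g \<in> L2 \<Longrightarrow> integrable lborel (\<lambda>x. f x * cnj (g x))"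
  by (intro integrable_mult_cnj) (auto dest: L2_D)

lemma L2_bounded:
  assumes "integrable lborel f" "\<And>x. cmod (f x) \<le> C"
  shows "f \<in> L2"
proof (rule L2_I)
  show m: "f \<in> borel_measurable borel"
    using borel_measurable_integrable[OF assms(1)] by simp
  have "integrable lborel (\<lambda>x. cmod (f x * f x))"
    using integrable_mult_bounded[OF assms(1) _ assms(2)] m by (intro integrable_norm) auto
  then show "integrable lborel (\<lambda>x. (cmod (f x))\<^sup>2)"
    by (simp add: norm_mult power2_eq_square)
qed

lemma cmod_diff_square_le: "(cmod (a - b))\<^sup>2 \<le> 2 * (cmod a)\<^sup>2 + 2 * (cmod b)\<^sup>2"
proof -
  have "(cmod (a - b))\<^sup>2 \<le> (cmod a + cmod b)\<^sup>2"
    by (intro power_mono norm_triangle_ineq4) auto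
  moreover have "0 \<le> (cmod a - cmod b)\<^sup>2" by simp
  ultimately show ?thesis
    unfolding power2_sum power2_diff by linarith
qed

lemma L2_diff:
  assumes "f \<in> L2" "g \<in> L2"
  shows "(\<lambda>x. f x - g x) \<in> L2"
proof (rule L2_I)
  have [measurable]: "f \<in> borel_measurable borel" "g \<in> borel_measurable borel"
    using assms by (auto dest: L2_D)
  show "(\<lambda>x. f x - g x) \<in> borel_measurable borel" by measurable
  have "integrable lborel (\<lambda>x. 2 * (cmod (f x))\<^sup>2 + 2 * (cmod (g x))\<^sup>2)"
    by (intro Bochner_Integration.integrable_add integrable_mult_right L2_D assms)
  then show "integrable lborel (\<lambda>x. (cmod (f x - g x))\<^sup>2)"
    by (rule Bochner_Integration.integrable_bound)
       (auto intro!: order_trans[OF cmod_diff_square_le])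
qed

lemma Cauchy_Schwarz_L2:
  assumes f: "f \<in> L2" and g: "g \<in> L2"
  shows "(cmod (LINT x|lborel. f x * cnj (g x)))\<^sup>2 \<le>
    (LINT x|lborel. (cmod (f x))\<^sup>2) * (LINT x|lborel. (cmod (g x))\<^sup>2)"
proof -
  note [measurable] = L2_D(1)[OF f] L2_D(1)[OF g]
  let ?I = "LINT x|lborel. f x * cnj (g x)"
  have "ennreal (cmod ?I) \<le> (\<integral>\<^sup>+x. ennreal (cmod (f x * cnj (g x))) \<partial>lborel)"
    by (rule integral_norm_bound_ennreal[OF integrable_L2_mult_cnj[OF f g]])
  also have "\<dots> = (\<integral>\<^sup>+x. ennreal (cmod (f x)) * ennreal (cmod (g x)) \<partial>lborel)"
    by (simp add: norm_mult ennreal_mult)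
  finally have "(ennreal (cmod ?I))\<^sup>2 \<le> (\<integral>\<^sup>+x. ennreal (cmod (f x)) * ennreal (cmod (g x)) \<partial>lborel)\<^sup>2"
    by (rule power_mono) simp
  also have "\<dots> \<le> (\<integral>\<^sup>+x. (ennreal (cmod (f x)))\<^sup>2 \<partial>lborel) * (\<integral>\<^sup>+x. (ennreal (cmod (g x)))\<^sup>2 \<partial>lborel)"
    by (rule Cauchy_Schwarz_nn_integral) auto
  also have "\<dots> = ennreal (LINT x|lborel. (cmod (f x))\<^sup>2) * ennreal (LINT x|lborel. (cmod (g x))\<^sup>2)"
    using L2_D(2)[OF f] L2_D(2)[OF g] by (simp add: ennreal_power nn_integral_eq_integral)
  also have "\<dots> = ennreal ((LINT x|lborel. (cmod (f x))\<^sup>2) * (LINT x|lborel. (cmod (g x))\<^sup>2))"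
    by (rule ennreal_mult[symmetric]) auto
  finally show ?thesis
    by (simp add: ennreal_power)
qed

text \<open>Cauchy-Schwarz bounds the error by the norm of \<open>f\<close> times the
  \<open>L2\<close> distance of \<open>u R\<close> and \<open>H\<close>. Membership of
  \<open>u R\<close> in \<open>L2\<close> is asked for eventually only, which is all that finiteness
  of the error integrals provides.\<close>

lemma L2_norm_tendsto_imp_inner_tendsto:
  fixes f H :: "'a::euclidean_space \<Rightarrow> complex" and u :: "real \<Rightarrow> 'a \<Rightarrow> complex"
  assumes f: "f \<in> L2" and H: "H \<in> L2" and u: "eventually (\<lambda>R. u R \<in> L2) at_top"
    and lim: "((\<lambda>R. \<integral>\<^sup>+\<xi>. ennreal ((cmod (u R \<xi> - H \<xi>))\<^sup>2) \<partial>lborel) \<longlongrightarrow> 0) at_top"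
  shows "((\<lambda>R. LINT \<xi>|lborel. f \<xi> * cnj (u R \<xi>)) \<longlongrightarrow> (LINT \<xi>|lborel. f \<xi> * cnj (H \<xi>))) at_top"
proof -
  let ?N = "LINT x|lborel. (cmod (f x))\<^sup>2"
  let ?e = "\<lambda>R. enn2real (\<integral>\<^sup>+\<xi>. ennreal ((cmod (u R \<xi> - H \<xi>))\<^sup>2) \<partial>lborel)"
  have "(?e \<longlongrightarrow> enn2real 0) at_top"
    using lim by (intro tendsto_enn2real) auto
  then have e: "(?e \<longlongrightarrow> 0) at_top" by simp
  have "eventually (\<lambda>R. norm ((LINT \<xi>|lborel. f \<xi> * cnj (u R \<xi>)) - (LINT \<xi>|lborel. f \<xi> * cnj (H \<xi>))) \<le>
      sqrt (?N * ?e R)) at_top"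
    using u
  proof eventually_elim
    case (elim R)
    have d: "(\<lambda>\<xi>. u R \<xi> - H \<xi>) \<in> L2"
      by (rule L2_diff[OF elim H])
    have "(LINT \<xi>|lborel. f \<xi> * cnj (u R \<xi>)) - (LINT \<xi>|lborel. f \<xi> * cnj (H \<xi>)) =
        (LINT \<xi>|lborel. f \<xi> * cnj (u R \<xi> - H \<xi>))"
      by (subst Bochner_Integration.integral_diff[symmetric])
         (auto intro: integrable_L2_mult_cnj f H elim simp: algebra_simps)
    moreover have "?e R = (LINT \<xi>|lborel. (cmod (u R \<xi> - H \<xi>))\<^sup>2)"
      using L2_D(2)[OF d] by (simp add: nn_integral_eq_integral)
    ultimately show ?case
      using Cauchy_Schwarz_L2[OF f d] by (simp add: real_le_rsqrt)
  qed
  moreover have "((\<lambda>R. sqrt (?N * ?e R)) \<longlongrightarrow> 0) at_top"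
    using tendsto_real_sqrt[OF tendsto_mult[OF tendsto_const[of ?N] e]] by simp
  ultimately have "((\<lambda>R. (LINT \<xi>|lborel. f \<xi> * cnj (u R \<xi>)) - (LINT \<xi>|lborel. f \<xi> * cnj (H \<xi>))) \<longlongrightarrow> 0) at_top"
    by (rule Lim_null_comparison)
  then show ?thesis
    by (rule LIM_zero_cancel)
qed

text \<open>The bound \<open>t \<le> 1 + t^2\<close> on a ball, which has finite measure.\<close>

lemma integrable_L2_truncation:
  fixes h :: "'a::euclidean_space \<Rightarrow> complex"
  assumes h: "h \<in> L2"
  shows "integrable lborel (\<lambda>x. indicator (cball 0 R) x * h x)"
proof -
  note [measurable] = L2_D(1)[OF h]
  have "integrable lborel (\<lambda>x. indicator (cball (0::'a) R) x + (cmod (h x))\<^sup>2 :: real)"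
    using L2_D(2)[OF h] by (intro Bochner_Integration.integrable_add integrable_real_indicator)
      (auto simp: emeasure_bounded_finite[OF bounded_cball, unfolded infinity_ennreal_def])
  moreover have "t \<le> 1 + t\<^sup>2" for t :: real
  proof -
    have "0 \<le> (t - 1)\<^sup>2" "0 \<le> t\<^sup>2" by auto
    then have "0 \<le> t\<^sup>2 - 2 * t + 1" "0 \<le> t\<^sup>2" by (simp_all add: power2_diff)
    then show ?thesis by linarith
  qed
  ultimately show ?thesis
    by (elim Bochner_Integration.integrable_bound) (auto simp: norm_mult indicator_def)
qed

text \<open>The definition bounds the difference to \<open>H\<close> by a nonnegative integral that
  tends to 0, hence is finite from some \<open>R\<close> on; adding \<open>H\<close> back gives
  square-integrability.\<close>

lemma has_fourier_transform_truncations_L2: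
  assumes "has_fourier_transform h H"
  shows "eventually (\<lambda>R. fourier_integral (\<lambda>x. indicator (cball 0 R) x * h x) \<in> L2) at_top"
proof -
  have h: "h \<in> L2" and H: "H \<in> L2"
    and lim: "((\<lambda>R. \<integral>\<^sup>+\<xi>. ennreal ((cmod (fourier_integral (\<lambda>x. indicator (cball 0 R) x * h x) \<xi> - H \<xi>))\<^sup>2)
            \<partial>lborel) \<longlongrightarrow> 0) at_top"
    using assms by (auto simp: has_fourier_transform_def)
  have "eventually (\<lambda>R. (\<integral>\<^sup>+\<xi>. ennreal ((cmod (fourier_integral (\<lambda>x. indicator (cball 0 R) x * h x) \<xi> - H \<xi>))\<^sup>2) \<partial>lborel) < top) at_top"
    using lim by (rule order_tendstoD) simp
  then show ?thesis
  proof eventually_elim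
    case (elim R)
    let ?u = "fourier_integral (\<lambda>x. indicator (cball 0 R) x * h x)"
    note [measurable] = borel_measurable_fourier_integral[OF integrable_L2_truncation[OF h, of R]] L2_D(1)[OF H]
    have "(\<lambda>\<xi>. ?u \<xi> - H \<xi>) \<in> L2"
      using elim by (intro L2_I integrableI_nonneg) (auto simp: AE_I2)
    moreover have "(\<lambda>\<xi>. - H \<xi>) \<in> L2"
      using L2_D(2)[OF H] by (intro L2_I) auto
    ultimately show "?u \<in> L2"
      using L2_diff by fastforce
  qed
qed

text \<open>The linearity used for uniqueness of the band projection: the difference of two
  candidates has to be band-limited again.\<close>

lemma has_fourier_transform_diff:
  assumes g: "has_fourier_transform g G" and h: "has_fourier_transform h H"
  shows "has_fourier_transform (\<lambda>x. g x - h x) (\<lambda>\<xi>. G \<xi> - H \<xi>)"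
  unfolding has_fourier_transform_def
proof (intro conjI)
  let ?u = "\<lambda>R. fourier_integral (\<lambda>x. indicator (cball 0 R) x * g x)"
  let ?v = "\<lambda>R. fourier_integral (\<lambda>x. indicator (cball 0 R) x * h x)"
  let ?w = "\<lambda>R. fourier_integral (\<lambda>x. indicator (cball 0 R) x * (g x - h x))"
  have L: "g \<in> L2" "G \<in> L2" "h \<in> L2" "H \<in> L2"
    and lim: "((\<lambda>R. \<integral>\<^sup>+\<xi>. ennreal ((cmod (?u R \<xi> - G \<xi>))\<^sup>2) \<partial>lborel) \<longlongrightarrow> 0) at_top"
      "((\<lambda>R. \<integral>\<^sup>+\<xi>. ennreal ((cmod (?v R \<xi> - H \<xi>))\<^sup>2) \<partial>lborel) \<longlongrightarrow> 0) at_top"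
    using g h by (auto simp: has_fourier_transform_def)
  show "(\<lambda>x. g x - h x) \<in> L2" "(\<lambda>\<xi>. G \<xi> - H \<xi>) \<in> L2"
    by (intro L2_diff L)+
  have w: "?w R \<xi> = ?u R \<xi> - ?v R \<xi>" for R \<xi>
    unfolding fourier_integral_def
      Bochner_Integration.integral_diff[OF integrable_mult_fourier_kernel[OF integrable_L2_truncation[OF L(1)]]
        integrable_mult_fourier_kernel[OF integrable_L2_truncation[OF L(3)]], symmetric]
    by (simp only: left_diff_distrib right_diff_distrib)
  have le: "(\<integral>\<^sup>+\<xi>. ennreal ((cmod (?w R \<xi> - (G \<xi> - H \<xi>)))\<^sup>2) \<partial>lborel) \<le>
     2 * (\<integral>\<^sup>+\<xi>. ennreal ((cmod (?u R \<xi> - G \<xi>))\<^sup>2) \<partial>lborel) + 2 * (\<integral>\<^sup>+\<xi>. ennreal ((cmod (?v R \<xi> - H \<xi>))\<^sup>2) \<partial>lborel)" for R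
  proof -
    note [measurable] = borel_measurable_fourier_integral[OF integrable_L2_truncation[OF L(1), of R]]
      borel_measurable_fourier_integral[OF integrable_L2_truncation[OF L(3), of R]] L2_D(1)[OF L(2)] L2_D(1)[OF L(4)]
    have "(\<integral>\<^sup>+\<xi>. ennreal ((cmod (?w R \<xi> - (G \<xi> - H \<xi>)))\<^sup>2) \<partial>lborel) \<le>
      (\<integral>\<^sup>+\<xi>. 2 * ennreal ((cmod (?u R \<xi> - G \<xi>))\<^sup>2) + 2 * ennreal ((cmod (?v R \<xi> - H \<xi>))\<^sup>2) \<partial>lborel)"
    proof (rule nn_integral_mono)
      fix \<xi>
      have "(cmod (?w R \<xi> - (G \<xi> - H \<xi>)))\<^sup>2 = (cmod ((?u R \<xi> - G \<xi>) - (?v R \<xi> - H \<xi>)))\<^sup>2"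
        by (subst w) (simp only: diff_diff_eq2 diff_diff_add add_diff_eq diff_add_eq add_ac)
      also have "\<dots> \<le> 2 * (cmod (?u R \<xi> - G \<xi>))\<^sup>2 + 2 * (cmod (?v R \<xi> - H \<xi>))\<^sup>2"
        by (rule cmod_diff_square_le)
      finally have "ennreal ((cmod (?w R \<xi> - (G \<xi> - H \<xi>)))\<^sup>2) \<le>
         ennreal (2 * (cmod (?u R \<xi> - G \<xi>))\<^sup>2 + 2 * (cmod (?v R \<xi> - H \<xi>))\<^sup>2)"
        by (rule ennreal_leI)
      then show "ennreal ((cmod (?w R \<xi> - (G \<xi> - H \<xi>)))\<^sup>2) \<le>
         2 * ennreal ((cmod (?u R \<xi> - G \<xi>))\<^sup>2) + 2 * ennreal ((cmod (?v R \<xi> - H \<xi>))\<^sup>2)"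
        by (simp add: ennreal_plus ennreal_mult)
    qed
    also have "\<dots> = 2 * (\<integral>\<^sup>+\<xi>. ennreal ((cmod (?u R \<xi> - G \<xi>))\<^sup>2) \<partial>lborel) + 2 * (\<integral>\<^sup>+\<xi>. ennreal ((cmod (?v R \<xi> - H \<xi>))\<^sup>2) \<partial>lborel)"
      by (simp add: nn_integral_add nn_integral_cmult)
    finally show ?thesis .
  qed
  have "((\<lambda>R. 2 * (\<integral>\<^sup>+\<xi>. ennreal ((cmod (?u R \<xi> - G \<xi>))\<^sup>2) \<partial>lborel) + 2 * (\<integral>\<^sup>+\<xi>. ennreal ((cmod (?v R \<xi> - H \<xi>))\<^sup>2) \<partial>lborel))
     \<longlongrightarrow> 2 * 0 + 2 * 0) at_top"
    using lim by (intro tendsto_add ennreal_tendsto_cmult) auto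
  then have lim0: "((\<lambda>R. 2 * (\<integral>\<^sup>+\<xi>. ennreal ((cmod (?u R \<xi> - G \<xi>))\<^sup>2) \<partial>lborel) + 2 * (\<integral>\<^sup>+\<xi>. ennreal ((cmod (?v R \<xi> - H \<xi>))\<^sup>2) \<partial>lborel))
     \<longlongrightarrow> 0) at_top" by simp
  show "((\<lambda>R. \<integral>\<^sup>+\<xi>. ennreal ((cmod (?w R \<xi> - (G \<xi> - H \<xi>)))\<^sup>2) \<partial>lborel) \<longlongrightarrow> 0) at_top"
    by (rule tendsto_sandwich[OF _ _ tendsto_const lim0]) (use le in auto)
qed

lemma truncation_integral_tendsto:
  fixes k :: "'a::euclidean_space \<Rightarrow> 'b::{banach,second_countable_topology,real_normed_field}"
  assumes k: "integrable lborel k"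
  shows "((\<lambda>R. LINT x|lborel. indicator (cball 0 R) x * k x) \<longlongrightarrow> (LINT x|lborel. k x)) at_top"
proof (rule integral_dominated_convergence_at_top[where w="\<lambda>x. norm (k x)"])
  show "AE x in lborel. ((\<lambda>R. indicator (cball 0 R) x * k x) \<longlongrightarrow> k x) at_top"
  proof (intro AE_I2)
    fix x :: 'a
    have "eventually (\<lambda>R. indicator (cball 0 R) x * k x = k x) at_top"
      using eventually_ge_at_top[of "norm x"] by eventually_elim auto
    then show "((\<lambda>R. indicator (cball 0 R) x * k x) \<longlongrightarrow> k x) at_top"
      by (rule tendsto_eventually)
  qed
  show "\<forall>\<^sub>F i in at_top. AE x in lborel. norm (indicator (cball 0 i) x * k x) \<le> norm (k x)"
    by (intro always_eventually allI AE_I2) (auto simp: indicator_def norm_mult)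
  have [measurable]: "k \<in> borel_measurable borel"
    using borel_measurable_integrable[OF k] by simp
  show "(\<lambda>x. indicator (cball 0 R) x * k x) \<in> borel_measurable lborel" for R
    by (intro borel_measurable_times borel_measurable_indicator) auto
qed (use borel_measurable_integrable[OF k] k in auto)

text \<open>Together with the null boundary of a convex set, this keeps sharp cutoffs by balls,
  cubes and intervals within the class of almost everywhere continuous functions.\<close>

lemma isCont_indicator_mult:
  fixes u :: "'a::t2_space \<Rightarrow> 'b::real_normed_algebra_1"
  assumes x: "x \<notin> frontier S" and u: "isCont u x"
  shows "isCont (\<lambda>x. indicator S x * u x) x"
proof (cases "x \<in> interior S")
  case True
  then have "eventually (\<lambda>y. y \<in> interior S) (nhds x)"
    by (intro eventually_nhds_in_open) auto
  then have "eventually (\<lambda>y. indicator S y * u y = u y) (nhds x)"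
    by eventually_elim (use interior_subset in \<open>auto simp: indicator_def\<close>)
  then show ?thesis
    using u by (simp cong: isCont_cong)
next
  case False
  then have "x \<in> - closure S"
    using x by (auto simp: frontier_def)
  then have "eventually (\<lambda>y. y \<in> - closure S) (nhds x)"
    by (intro eventually_nhds_in_open) auto
  then have "eventually (\<lambda>y. indicator S y * u y = 0) (nhds x)"
    by eventually_elim (use closure_subset in \<open>auto simp: indicator_def\<close>)
  then show ?thesis
    by (simp cong: isCont_cong)
qed

lemma AE_notin_frontier_convex:
  fixes S :: "'a::euclidean_space set"
  assumes "convex S"
  shows "AE x in lborel. x \<notin> frontier S"
proof (rule AE_not_in)
  have "frontier S \<in> null_sets lebesgue"
    using negligible_convex_frontier[OF assms] by (simp add: negligible_iff_null_sets)
  moreover have "frontier S \<in> sets lborel"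
    by simp
  ultimately show "frontier S \<in> null_sets lborel"
    by (simp add: null_sets_completion_iff)
qed

lemma integrable_bounded_on_bounded_set:
  fixes f :: "'a::euclidean_space \<Rightarrow> 'b::{banach,second_countable_topology}"
  assumes "f \<in> borel_measurable borel" "bounded A" "\<And>x. norm (f x) \<le> C" "\<And>x. x \<notin> A \<Longrightarrow> f x = 0"
  shows "integrable lborel f"
proof -
  obtain r where r: "A \<subseteq> cball 0 r"
    using \<open>bounded A\<close> by (auto simp: bounded_iff subset_iff)
  have "integrable lborel (\<lambda>x. C * indicator (cball (0::'a) r) x :: real)"
    by (intro integrable_mult_right integrable_real_indicator) (auto simp: emeasure_bounded_finite[OF bounded_cball, unfolded infinity_ennreal_def])
  moreover have "norm (f x) \<le> norm (C * indicator (cball 0 r) x)" for x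
    using assms(3)[of x] assms(4)[of x] r by (cases "x \<in> A") (auto simp: indicator_def)
  ultimately show ?thesis
    using assms(1) by (elim Bochner_Integration.integrable_bound) auto
qed

text \<open>Let \<open>g\<close> be the inverse transform, \<open>gR R\<close> its truncation and
  \<open>u\<close> the transform of \<open>gR R\<close>. Plancherel makes the squared norm of
  \<open>u\<close> equal to that of \<open>gR R\<close>, and the multiplication formula gives the
  same value for the inner product of \<open>u\<close> with \<open>\<Phi>\<close>. Expanding the
  square, the squared distance of \<open>u\<close> and \<open>\<Phi>\<close> is the squared norm of
  \<open>\<Phi>\<close> minus that of \<open>gR R\<close>; it tends to 0 because \<open>g\<close>
  and \<open>\<Phi>\<close> have equal norms.\<close>

lemma has_fourier_transform_inverse:
  fixes \<Phi> :: "'a::euclidean_space \<Rightarrow> complex"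
  assumes \<Phi>: "integrable lborel \<Phi>" and M: "\<And>x. cmod (\<Phi> x) \<le> M" and c: "AE x in lborel. isCont \<Phi> x"
  shows "has_fourier_transform (\<lambda>x. fourier_integral \<Phi> (- x)) \<Phi>"
proof -
  define g where "g x = fourier_integral \<Phi> (- x)" for x
  define gR where "gR R x = indicator (cball 0 R) x * g x" for R x
  let ?u = "\<lambda>R. fourier_integral (gR R)"
  let ?N = "LINT x|lborel. (cmod (\<Phi> x))\<^sup>2"
  have cont: "continuous_on UNIV g"
    unfolding g_def[abs_def]
    by (intro continuous_on_compose2[OF continuous_fourier_integral[OF \<Phi>]] continuous_intros) auto
  have bd: "cmod (g x) \<le> (LINT x|lborel. cmod (\<Phi> x))" for x
    unfolding g_def by (rule fourier_integral_bound)
  have [measurable]: "g \<in> borel_measurable borel"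
    using cont by (rule borel_measurable_continuous_onI)
  have \<Phi>L2: "\<Phi> \<in> L2"
    by (rule L2_bounded[OF \<Phi> M])
  note [measurable] = L2_D(1)[OF \<Phi>L2] borel_measurable_fourier_integral[OF \<Phi>]
  have g2: "integrable lborel (\<lambda>x. (cmod (g x))\<^sup>2)" and gN: "(LINT x|lborel. (cmod (g x))\<^sup>2) = ?N"
    using integrable_fourier_integral_square[OF \<Phi> M c] plancherel_bounded[OF \<Phi> M c]
      integrable_lborel_minus[of "\<lambda>x. (cmod (fourier_integral \<Phi> x))\<^sup>2"]
      integral_lborel_minus[of "\<lambda>x. (cmod (fourier_integral \<Phi> x))\<^sup>2"]
    by (auto simp: g_def)
  have gL2: "g \<in> L2"
    using g2 by (intro L2_I) auto
  have gRm [measurable]: "gR R \<in> borel_measurable borel" for R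
    unfolding gR_def[abs_def] by (intro borel_measurable_times borel_measurable_indicator) auto
  have gRi: "integrable lborel (gR R)" for R
    unfolding gR_def by (rule integrable_L2_truncation[OF gL2])
  have gRb: "cmod (gR R x) \<le> (LINT x|lborel. cmod (\<Phi> x))" for R x
    using bd[of x] order_trans[OF norm_ge_zero bd] by (auto simp: gR_def indicator_def norm_mult)
  have gRc: "AE x in lborel. isCont (gR R) x" for R
    using AE_notin_frontier_convex[OF convex_cball, of 0 R] unfolding gR_def
    by eventually_elim (intro isCont_indicator_mult, use cont in \<open>auto simp: continuous_on_eq_continuous_at\<close>)
  have sq: "z * cnj z = of_real ((cmod z)\<^sup>2)" for z
    by (simp only: complex_norm_square)
  have inner: "(LINT \<xi>|lborel. ?u R \<xi> * cnj (\<Phi> \<xi>)) = of_real (LINT x|lborel. (cmod (gR R x))\<^sup>2)" for R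
  proof -
    have "(LINT \<xi>|lborel. ?u R (1 *\<^sub>R \<xi>) * cnj (\<Phi> \<xi>)) =
       (LINT x|lborel. gR R x * fourier_integral (\<lambda>\<xi>. cnj (\<Phi> \<xi>)) (1 *\<^sub>R x))"
      using \<Phi> gRi by (intro fourier_multiplication_formula) auto
    also have "\<dots> = (LINT x|lborel. gR R x * cnj (gR R x))"
    proof (intro Bochner_Integration.integral_cong refl)
      fix x
      have "fourier_integral (\<lambda>\<xi>. cnj (\<Phi> \<xi>)) (1 *\<^sub>R x) = cnj (g x)"
        by (simp add: g_def cnj_fourier_integral)
      then show "gR R x * fourier_integral (\<lambda>\<xi>. cnj (\<Phi> \<xi>)) (1 *\<^sub>R x) = gR R x * cnj (gR R x)"
        by (simp add: gR_def indicator_def)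
    qed
    finally show ?thesis
      unfolding sq integral_complex_of_real scaleR_one .
  qed
  have uL2: "?u R \<in> L2" for R
    using integrable_fourier_integral_square[OF gRi gRb gRc] borel_measurable_fourier_integral[OF gRi]
    by (intro L2_I) auto
  have uN: "(LINT \<xi>|lborel. (cmod (?u R \<xi>))\<^sup>2) = (LINT x|lborel. (cmod (gR R x))\<^sup>2)" for R
    by (rule plancherel_bounded[OF gRi gRb gRc])
  have dist: "(LINT \<xi>|lborel. (cmod (?u R \<xi> - \<Phi> \<xi>))\<^sup>2) = ?N - (LINT x|lborel. (cmod (gR R x))\<^sup>2)" for R
  proof -
    have "(cmod (a - b))\<^sup>2 = (cmod a)\<^sup>2 - 2 * Re (a * cnj b) + (cmod b)\<^sup>2" for a b
      by (simp add: cmod_power2 power2_diff algebra_simps)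
    then have "(LINT \<xi>|lborel. (cmod (?u R \<xi> - \<Phi> \<xi>))\<^sup>2) =
       (LINT \<xi>|lborel. (cmod (?u R \<xi>))\<^sup>2 - 2 * Re (?u R \<xi> * cnj (\<Phi> \<xi>)) + (cmod (\<Phi> \<xi>))\<^sup>2)"
      by simp
    also have "\<dots> = (LINT \<xi>|lborel. (cmod (?u R \<xi>))\<^sup>2) - 2 * (LINT \<xi>|lborel. Re (?u R \<xi> * cnj (\<Phi> \<xi>))) + ?N"
      using integrable_L2_mult_cnj[OF uL2[of R] \<Phi>L2] L2_D(2)[OF uL2[of R]] L2_D(2)[OF \<Phi>L2]
      by (subst Bochner_Integration.integral_add)
         (auto intro!: Bochner_Integration.integrable_diff integrable_mult_right integrable_Re
               simp del: times_complex.sel simp: Bochner_Integration.integral_diff)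
    also have "(LINT \<xi>|lborel. Re (?u R \<xi> * cnj (\<Phi> \<xi>))) = Re (LINT \<xi>|lborel. ?u R \<xi> * cnj (\<Phi> \<xi>))"
      by (rule integral_Re[OF integrable_L2_mult_cnj[OF uL2 \<Phi>L2]])
    finally show ?thesis
      by (simp add: inner uN del: times_complex.sel)
  qed
  have "((\<lambda>R. LINT x|lborel. indicator (cball 0 R) x * (cmod (g x))\<^sup>2) \<longlongrightarrow> (LINT x|lborel. (cmod (g x))\<^sup>2)) at_top"
    by (rule truncation_integral_tendsto[OF g2])
  moreover have "indicator (cball 0 R) x * (cmod (g x))\<^sup>2 = (cmod (gR R x))\<^sup>2" for R x
    by (simp add: gR_def indicator_def)
  ultimately have "((\<lambda>R. LINT x|lborel. (cmod (gR R x))\<^sup>2) \<longlongrightarrow> ?N) at_top"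
    by (simp add: gN)
  then have "((\<lambda>R. ?N - (LINT x|lborel. (cmod (gR R x))\<^sup>2)) \<longlongrightarrow> ?N - ?N) at_top"
    by (intro tendsto_intros)
  then have "((\<lambda>R. ennreal (LINT \<xi>|lborel. (cmod (?u R \<xi> - \<Phi> \<xi>))\<^sup>2)) \<longlongrightarrow> ennreal 0) at_top"
    unfolding dist by (intro tendsto_ennrealI) simp
  moreover have "ennreal (LINT \<xi>|lborel. (cmod (?u R \<xi> - \<Phi> \<xi>))\<^sup>2) = (\<integral>\<^sup>+\<xi>. ennreal ((cmod (?u R \<xi> - \<Phi> \<xi>))\<^sup>2) \<partial>lborel)" for R
    by (rule nn_integral_eq_integral[symmetric, OF L2_D(2)[OF L2_diff[OF uL2 \<Phi>L2]]]) simp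
  ultimately have "((\<lambda>R. \<integral>\<^sup>+\<xi>. ennreal ((cmod (?u R \<xi> - \<Phi> \<xi>))\<^sup>2) \<partial>lborel) \<longlongrightarrow> 0) at_top"
    by simp
  then show ?thesis
    using gL2 \<Phi>L2 unfolding has_fourier_transform_def g_def[symmetric] gR_def[abs_def] by simp
qed

section \<open>The band projection of a bounded function with bounded support\<close>

text \<open>The inner products of \<open>f\<close> and of its proposed projection with
  \<open>h\<close> are both carried to the frequency side, where they are the pairings of
  \<open>F\<close> and of \<open>indicator B * F\<close> with \<open>H\<close>. These agree because
  \<open>H\<close> vanishes almost everywhere off \<open>B\<close>. As \<open>H\<close> is only an
  \<open>L2\<close> limit, each transfer is made for truncations of \<open>h\<close> first.\<close>

lemma inner_band_projection:
  fixes f h :: "'a::euclidean_space \<Rightarrow> complex"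
  assumes f: "f \<in> borel_measurable borel" and M: "\<And>x. cmod (f x) \<le> M"
    and supp: "\<And>x. x \<notin> cball 0 r \<Longrightarrow> f x = 0" and c: "AE x in lborel. isCont f x"
    and B: "bounded B" "convex B" "B \<in> sets borel"
    and h: "has_fourier_transform h H" and HB: "AE \<xi> in lborel. \<xi> \<notin> B \<longrightarrow> H \<xi> = 0"
  defines "\<Phi> \<equiv> \<lambda>\<xi>. indicator B \<xi> * fourier_integral f \<xi>"
  shows "has_fourier_transform (\<lambda>x. fourier_integral \<Phi> (- x)) \<Phi>"
    and "L2_inner (\<lambda>x. f x - fourier_integral \<Phi> (- x)) h = 0"
proof -
  have fi: "integrable lborel f"
    by (rule integrable_bounded_on_bounded_set[OF f bounded_cball M supp])
  have fL2: "f \<in> L2"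
    by (rule L2_bounded[OF fi M])
  define F where "F = fourier_integral f"
  have Fcont: "continuous_on UNIV F"
    unfolding F_def by (rule continuous_fourier_integral[OF fi])
  have [measurable]: "F \<in> borel_measurable borel" "B \<in> sets borel"
    using Fcont B by (auto intro: borel_measurable_continuous_onI)
  have FL2: "F \<in> L2"
    unfolding F_def using integrable_fourier_integral_square[OF fi M c] borel_measurable_fourier_integral[OF fi]
    by (rule L2_I[rotated])
  have \<Phi>_eq: "\<Phi> = (\<lambda>\<xi>. indicator B \<xi> * F \<xi>)"
    by (simp add: \<Phi>_def F_def)
  have \<Phi>_bound: "cmod (\<Phi> \<xi>) \<le> (LINT x|lborel. cmod (f x))" for \<xi>
    using fourier_integral_bound[of f \<xi>] order_trans[OF norm_ge_zero fourier_integral_bound[of f \<xi>]]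
    by (auto simp: \<Phi>_def indicator_def)
  have \<Phi>i: "integrable lborel \<Phi>"
    by (rule integrable_bounded_on_bounded_set[OF _ B(1) \<Phi>_bound]) (auto simp: \<Phi>_eq)
  have \<Phi>c: "AE x in lborel. isCont \<Phi> x"
    using AE_notin_frontier_convex[OF B(2)] unfolding \<Phi>_eq
    by eventually_elim (intro isCont_indicator_mult, use Fcont in \<open>auto simp: continuous_on_eq_continuous_at\<close>)
  show FT: "has_fourier_transform (\<lambda>x. fourier_integral \<Phi> (- x)) \<Phi>"
    by (rule has_fourier_transform_inverse[OF \<Phi>i \<Phi>_bound \<Phi>c])
  define g where "g x = fourier_integral \<Phi> (- x)" for x
  have gL2: "g \<in> L2" and \<Phi>L2: "\<Phi> \<in> L2"
    using FT by (auto simp: has_fourier_transform_def g_def[abs_def])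
  have hL2: "h \<in> L2" and HL2: "H \<in> L2"
    and lim: "((\<lambda>R. \<integral>\<^sup>+\<xi>. ennreal ((cmod (fourier_integral (\<lambda>x. indicator (cball 0 R) x * h x) \<xi> - H \<xi>))\<^sup>2)
            \<partial>lborel) \<longlongrightarrow> 0) at_top"
    using h by (auto simp: has_fourier_transform_def)
  let ?h = "\<lambda>R x. indicator (cball 0 R) x * h x"
  let ?u = "\<lambda>R. fourier_integral (?h R)"
  note ev = has_fourier_transform_truncations_L2[OF h]
  have "((\<lambda>R. LINT \<xi>|lborel. F \<xi> * cnj (?u R \<xi>)) \<longlongrightarrow> (LINT \<xi>|lborel. F \<xi> * cnj (H \<xi>))) at_top"
    by (rule L2_norm_tendsto_imp_inner_tendsto[OF FL2 HL2 ev lim])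
  \<comment> \<open>Once the ball of radius \<open>R\<close> contains the support of
    \<open>f\<close>, truncating \<open>h\<close> leaves the pairing with \<open>f\<close>
    unchanged, so the limit is that of a constant.\<close>
  moreover have "eventually (\<lambda>R. (LINT \<xi>|lborel. F \<xi> * cnj (?u R \<xi>)) = (LINT x|lborel. f x * cnj (h x))) at_top"
    using ev eventually_ge_at_top[of r]
  proof eventually_elim
    case (elim R)
    have "(LINT \<xi>|lborel. F \<xi> * cnj (?u R \<xi>)) = (LINT x|lborel. f x * cnj (?h R x))"
      unfolding F_def
      by (rule parseval_bounded[OF fi M c integrable_L2_truncation[OF hL2] L2_D(2)[OF elim(1)]])
    also have "\<dots> = (LINT x|lborel. f x * cnj (h x))"
    proof (intro Bochner_Integration.integral_cong refl)
      fix x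
      show "f x * cnj (?h R x) = f x * cnj (h x)"
        using supp[of x] elim(2) by (cases "x \<in> cball 0 r") (auto simp: indicator_def)
    qed
    finally show ?case .
  qed
  ultimately have "((\<lambda>R::real. LINT x|lborel. f x * cnj (h x)) \<longlongrightarrow> (LINT \<xi>|lborel. F \<xi> * cnj (H \<xi>))) at_top"
    by (rule Lim_transform_eventually)
  then have 1: "(LINT x|lborel. f x * cnj (h x)) = (LINT \<xi>|lborel. F \<xi> * cnj (H \<xi>))"
    by (simp add: tendsto_const_iff)
  have "((\<lambda>R. LINT \<xi>|lborel. \<Phi> \<xi> * cnj (?u R \<xi>)) \<longlongrightarrow> (LINT \<xi>|lborel. \<Phi> \<xi> * cnj (H \<xi>))) at_top"
    by (rule L2_norm_tendsto_imp_inner_tendsto[OF \<Phi>L2 HL2 ev lim])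
  moreover have "(LINT \<xi>|lborel. \<Phi> \<xi> * cnj (?u R \<xi>)) = (LINT x|lborel. indicator (cball 0 R) x * (g x * cnj (h x)))" for R
  proof -
    have "(LINT \<xi>|lborel. \<Phi> \<xi> * cnj (?u R \<xi>)) =
        (LINT \<xi>|lborel. fourier_integral (\<lambda>x. cnj (?h R x)) (- 1 *\<^sub>R \<xi>) * \<Phi> \<xi>)"
      by (intro Bochner_Integration.integral_cong refl) (simp add: cnj_fourier_integral mult_ac)
    also have "\<dots> = (LINT x|lborel. cnj (?h R x) * fourier_integral \<Phi> (- 1 *\<^sub>R x))"
      by (intro fourier_multiplication_formula \<Phi>i integrable_cnj integrable_L2_truncation hL2)
    also have "\<dots> = (LINT x|lborel. indicator (cball 0 R) x * (g x * cnj (h x)))"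
      by (intro Bochner_Integration.integral_cong refl) (simp add: g_def indicator_def mult_ac)
    finally show ?thesis .
  qed
  moreover have "((\<lambda>R. LINT x|lborel. indicator (cball 0 R) x * (g x * cnj (h x))) \<longlongrightarrow> (LINT x|lborel. g x * cnj (h x))) at_top"
    by (rule truncation_integral_tendsto[OF integrable_L2_mult_cnj[OF gL2 hL2]])
  ultimately have 2: "(LINT x|lborel. g x * cnj (h x)) = (LINT \<xi>|lborel. \<Phi> \<xi> * cnj (H \<xi>))"
    using tendsto_unique[OF trivial_limit_at_top_linorder] by auto
  note [measurable] = L2_D(1)[OF HL2]
  have 3: "(LINT \<xi>|lborel. \<Phi> \<xi> * cnj (H \<xi>)) = (LINT \<xi>|lborel. F \<xi> * cnj (H \<xi>))"
  proof (rule integral_cong_AE)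
    show "AE \<xi> in lborel. \<Phi> \<xi> * cnj (H \<xi>) = F \<xi> * cnj (H \<xi>)"
      using HB by eventually_elim (auto simp: \<Phi>_eq indicator_def)
  qed (auto simp: \<Phi>_eq)
  have "L2_inner (\<lambda>x. f x - g x) h = (LINT x|lborel. f x * cnj (h x)) - (LINT x|lborel. g x * cnj (h x))"
    unfolding L2_inner_def left_diff_distrib
    by (intro Bochner_Integration.integral_diff integrable_L2_mult_cnj fL2 gL2 hL2)
  then show "L2_inner (\<lambda>x. f x - fourier_integral \<Phi> (- x)) h = 0"
    using 1 2 3 by (simp add: g_def)
qed

text \<open>The property under \<open>SOME\<close> determines its solution up to a null set: the
  difference \<open>d\<close> of two solutions is band-limited, both residuals are orthogonal to it,
  and the difference of the residuals is \<open>d\<close> itself, so \<open>d\<close> has norm 0.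
  The explicit formula supplies one solution.\<close>

theorem band_projection_eq:
  fixes f :: "'a::euclidean_space \<Rightarrow> complex"
  assumes f: "f \<in> borel_measurable borel" and M: "\<And>x. cmod (f x) \<le> M"
    and supp: "\<And>x. x \<notin> cball 0 r \<Longrightarrow> f x = 0" and c: "AE x in lborel. isCont f x"
    and B: "bounded B" "convex B" "B \<in> sets borel"
  shows "AE x in lborel. band_projection B f x = fourier_integral (\<lambda>\<xi>. indicator B \<xi> * fourier_integral f \<xi>) (- x)"
proof -
  let ?\<Phi> = "\<lambda>\<xi>. indicator B \<xi> * fourier_integral f \<xi>"
  define g where "g x = fourier_integral ?\<Phi> (- x)" for x
  define p where "p = band_projection B f"
  let ?P = "\<lambda>g. g \<in> bandlimited B \<and> (\<forall>h\<in>bandlimited B. L2_inner (\<lambda>x. f x - g x) h = 0)"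
  \<comment> \<open>A trivial transform pair that fills the place of \<open>h\<close> when just the
    first conclusion of \<open>inner_band_projection\<close> is wanted.\<close>
  have zero: "has_fourier_transform (\<lambda>x::'a. 0) (\<lambda>\<xi>. 0)"
    by (simp add: has_fourier_transform_def L2_def fourier_integral_def)
  have FT: "has_fourier_transform g ?\<Phi>"
    unfolding g_def[abs_def] by (rule inner_band_projection(1)[OF f M supp c B zero]) auto
  have gP: "?P g"
  proof (intro conjI ballI)
    show "g \<in> bandlimited B"
      using FT by (auto simp: bandlimited_def intro!: exI[of _ ?\<Phi>])
    fix h assume "h \<in> bandlimited B"
    then obtain H where H: "has_fourier_transform h H" "AE \<xi> in lborel. \<xi> \<notin> B \<longrightarrow> H \<xi> = 0"
      by (auto simp: bandlimited_def)
    show "L2_inner (\<lambda>x. f x - g x) h = 0"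
      unfolding g_def using inner_band_projection(2)[OF f M supp c B H] by simp
  qed
  have pP: "?P p"
    unfolding p_def band_projection_def by (rule someI[of ?P, OF gP])
  define d where "d x = p x - g x" for x
  obtain G K where G: "has_fourier_transform g G" "AE \<xi> in lborel. \<xi> \<notin> B \<longrightarrow> G \<xi> = 0"
    and K: "has_fourier_transform p K" "AE \<xi> in lborel. \<xi> \<notin> B \<longrightarrow> K \<xi> = 0"
    using gP pP by (auto simp: bandlimited_def)
  have dFT: "has_fourier_transform d (\<lambda>\<xi>. K \<xi> - G \<xi>)"
    unfolding d_def[abs_def] by (rule has_fourier_transform_diff[OF K(1) G(1)])
  have "AE \<xi> in lborel. \<xi> \<notin> B \<longrightarrow> K \<xi> - G \<xi> = 0"
    using G(2) K(2) by eventually_elim auto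
  with dFT have dB: "d \<in> bandlimited B"
    by (auto simp: bandlimited_def)
  have fi: "integrable lborel f"
    by (rule integrable_bounded_on_bounded_set[OF f bounded_cball M supp])
  have fL2: "f \<in> L2"
    by (rule L2_bounded[OF fi M])
  have L2s: "g \<in> L2" "p \<in> L2" "d \<in> L2"
    using G(1) K(1) dFT by (auto simp: has_fourier_transform_def)
  note [measurable] = L2_D(1)[OF L2s(3)]
  have int: "integrable lborel (\<lambda>x. (f x - g x) * cnj (d x))" "integrable lborel (\<lambda>x. (f x - p x) * cnj (d x))"
    by (intro integrable_L2_mult_cnj L2_diff fL2 L2s)+
  have "complex_of_real (LINT x|lborel. (cmod (d x))\<^sup>2) = (LINT x|lborel. d x * cnj (d x))"
    by (simp only: complex_norm_square[symmetric] integral_complex_of_real)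
  also have "\<dots> = (LINT x|lborel. (f x - g x) * cnj (d x) - (f x - p x) * cnj (d x))"
    by (intro Bochner_Integration.integral_cong refl) (simp add: d_def algebra_simps)
  also have "\<dots> = L2_inner (\<lambda>x. f x - g x) d - L2_inner (\<lambda>x. f x - p x) d"
    unfolding L2_inner_def by (rule Bochner_Integration.integral_diff[OF int])
  also have "\<dots> = 0"
    using gP pP dB by simp
  finally have "(LINT x|lborel. (cmod (d x))\<^sup>2) = 0"
    by simp
  then have "AE x in lborel. (cmod (d x))\<^sup>2 = 0"
    using integral_nonneg_eq_0_iff_AE[OF L2_D(2)[OF L2s(3)]] by simp
  then show ?thesis
    by eventually_elim (auto simp: d_def p_def g_def)
qed

section \<open>Eigenvectors of a compact symmetric operator\<close>

text \<open>Elimination with pivot \<open>p\<close> in the last equation. It provides a nonzero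
  combination of trial vectors orthogonal to the fewer eigenvectors found so far.\<close>

lemma nontrivial_solution:
  fixes C :: "'i \<Rightarrow> nat \<Rightarrow> real"
  assumes "finite I" "n < card I"
  shows "\<exists>a. (\<exists>i\<in>I. a i \<noteq> 0) \<and> (\<forall>j<n. (\<Sum>i\<in>I. a i * C i j) = 0)"
  using assms
proof (induction n arbitrary: I C)
  case 0
  then have "I \<noteq> {}" by auto
  then show ?case by (intro exI[of _ "\<lambda>_. 1"]) auto
next
  case (Suc n)
  show ?case
  proof (cases "\<forall>i\<in>I. C i n = 0")
    case True
    obtain a where "\<exists>i\<in>I. a i \<noteq> 0" "\<forall>j<n. (\<Sum>i\<in>I. a i * C i j) = 0"
      using Suc.IH[of I C] Suc.prems by auto
    then show ?thesis
      using True by (intro exI[of _ a]) (auto simp: less_Suc_eq)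
  next
    case False
    then obtain p where p: "p \<in> I" "C p n \<noteq> 0" by auto
    let ?C = "\<lambda>i j. C i j - C i n * C p j / C p n"
    have "n < card (I - {p})"
      using Suc.prems p by simp
    then obtain a where a: "\<exists>i\<in>I - {p}. a i \<noteq> 0" "\<forall>j<n. (\<Sum>i\<in>I - {p}. a i * ?C i j) = 0"
      using Suc.IH[of "I - {p}" ?C] Suc.prems by auto
    define s where "s = (\<Sum>i\<in>I - {p}. a i * C i n)"
    define b where "b = a(p := - s / C p n)"
    have sum_b: "(\<Sum>i\<in>I. b i * C i j) = - s / C p n * C p j + (\<Sum>i\<in>I - {p}. a i * C i j)" for j
      using Suc.prems p by (subst sum.remove[of I p]) (auto simp: b_def intro!: sum.cong)
    have "(\<Sum>i\<in>I. b i * C i j) = 0" if "j < Suc n" for j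
    proof (cases "j = n")
      case True
      then show ?thesis using p by (simp add: sum_b s_def)
    next
      case False
      have "(\<Sum>i\<in>I - {p}. a i * ?C i j) = (\<Sum>i\<in>I - {p}. a i * C i j) - s * C p j / C p n"
        by (simp add: s_def right_diff_distrib sum_subtractf sum_distrib_right sum_divide_distrib mult.assoc)
      then show ?thesis
        using a(2) that False by (simp add: sum_b)
    qed
    moreover have "\<exists>i\<in>I. b i \<noteq> 0"
      using a(1) by (auto simp: b_def)
    ultimately show ?thesis by blast
  qed
qed

text \<open>The homogeneous form in \<open>s\<close> and \<open>t\<close> covers degenerate forms,
  with \<open>C = 0\<close> allowed. It yields Cauchy-Schwarz both for \<open>ip\<close> and for the
  form \<open>m * ip x y - ip (D x) y\<close>.\<close>

lemma discriminant_nonpos: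
  fixes A B C :: real
  assumes "\<And>s t. s\<^sup>2 * A + 2 * s * t * B + t\<^sup>2 * C \<ge> 0"
  shows "B\<^sup>2 \<le> A * C"
proof (cases "C = 0")
  case True
  have "B = 0"
  proof (rule ccontr)
    assume "B \<noteq> 0"
    \<comment> \<open>With \<open>C = 0\<close> and \<open>s = 1\<close>, the chosen
      \<open>t\<close> makes the form equal to -1.\<close>
    then show False
      using assms[of 1 "- (A + 1) / (2 * B)"] True by (simp add: field_simps)
  qed
  then show ?thesis using True by simp
next
  case False
  moreover have "C \<ge> 0" using assms[of 0 1] by simp
  ultimately have "C > 0" by simp
  have "C\<^sup>2 * A + 2 * C * (- B) * B + (- B)\<^sup>2 * C = C * (A * C - B\<^sup>2)"
    by (simp add: power2_eq_square algebra_simps)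
  then have "0 \<le> C * (A * C - B\<^sup>2)"
    using assms[of C "- B"] by simp
  then show ?thesis
    using \<open>C > 0\<close> by (simp add: zero_le_mult_iff)
qed

text \<open>The form \<open>ip\<close> may be degenerate: for functions it only sees their restrictions to a set.\<close>

locale compact_symmetric =
  fixes ip :: "'v::real_vector \<Rightarrow> 'v \<Rightarrow> real" and T :: "'v \<Rightarrow> 'v"
  assumes ip_add: "ip (x + y) z = ip x z + ip y z"
    and ip_scale: "ip (r *\<^sub>R x) z = r * ip x z"
    and ip_sym: "ip x y = ip y x"
    and ip_nonneg: "0 \<le> ip x x"
    and T_add: "T (x + y) = T x + T y"
    and T_scale: "T (r *\<^sub>R x) = r *\<^sub>R T x"
    and T_sym: "ip (T x) y = ip x (T y)"
    and T_square_le: "ip (T x) (T x) \<le> ip (T x) x"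
    and T_compact: "(\<And>n. ip (v n) (v n) \<le> 1) \<Longrightarrow>
       \<exists>u r. strict_mono r \<and> (\<lambda>n. ip (T (v (r n :: nat)) - u) (T (v (r n)) - u)) \<longlonglongrightarrow> 0"
begin

lemma ip_add_right: "ip z (x + y) = ip z x + ip z y"
  using ip_add ip_sym by metis

lemma ip_scale_right: "ip z (r *\<^sub>R x) = r * ip z x"
  using ip_scale ip_sym by metis

lemma ip_minus: "ip (- x) z = - ip x z"
  using ip_scale[of "-1" x z] by simp

lemma ip_minus_right: "ip z (- x) = - ip z x"
  using ip_minus ip_sym by metis

lemma ip_diff: "ip (x - y) z = ip x z - ip y z"
  using ip_add[of x "- y" z] ip_minus[of y z] by simp

lemma ip_diff_right: "ip z (x - y) = ip z x - ip z y"
  using ip_diff ip_sym by metis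

lemmas ip_simps = ip_add ip_add_right ip_scale ip_scale_right ip_diff ip_diff_right ip_minus ip_minus_right

lemma T_minus: "T (- x) = - T x"
  using T_scale[of "-1" x] by simp

lemma T_diff: "T (x - y) = T x - T y"
  using T_add[of x "- y"] by (simp add: T_minus)

lemma ip_zero: "ip 0 x = 0"
  using ip_scale[of 0 0 x] by simp

lemma ip_sum: "finite I \<Longrightarrow> ip (\<Sum>i\<in>I. f i) z = (\<Sum>i\<in>I. ip (f i) z)"
  by (induction I rule: finite_induct) (auto simp: ip_zero ip_add)

definition N :: "'v \<Rightarrow> real" where "N x = sqrt (ip x x)"

lemma N_square: "(N x)\<^sup>2 = ip x x"
  by (simp add: N_def ip_nonneg)

lemma N_nonneg: "0 \<le> N x"
  by (simp add: N_def ip_nonneg)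

lemma ip_Cauchy_Schwarz: "\<bar>ip x y\<bar> \<le> N x * N y"
proof -
  have "(ip x y)\<^sup>2 \<le> ip x x * ip y y"
  proof (rule discriminant_nonpos)
    fix s t
    have "s\<^sup>2 * ip x x + 2 * s * t * ip x y + t\<^sup>2 * ip y y = ip (s *\<^sub>R x + t *\<^sub>R y) (s *\<^sub>R x + t *\<^sub>R y)"
      by (simp add: ip_simps ip_sym[of y x] power2_eq_square algebra_simps)
    then show "0 \<le> s\<^sup>2 * ip x x + 2 * s * t * ip x y + t\<^sup>2 * ip y y"
      by (simp add: ip_nonneg)
  qed
  then have "\<bar>ip x y\<bar>\<^sup>2 \<le> (N x * N y)\<^sup>2"
    by (simp add: power_mult_distrib N_square)
  then show ?thesis
    by (rule power2_le_imp_le) (simp add: N_nonneg)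
qed

lemma N_triangle: "N (x + y) \<le> N x + N y"
proof (rule power2_le_imp_le)
  have "(N (x + y))\<^sup>2 = (N x)\<^sup>2 + 2 * ip x y + (N y)\<^sup>2"
    by (simp add: N_square ip_simps ip_sym[of y x])
  also have "\<dots> \<le> (N x)\<^sup>2 + 2 * (N x * N y) + (N y)\<^sup>2"
    using ip_Cauchy_Schwarz[of x y] by simp
  finally show "(N (x + y))\<^sup>2 \<le> (N x + N y)\<^sup>2"
    by (simp add: power2_sum)
qed (simp add: N_nonneg)

lemma N_scale: "N (r *\<^sub>R x) = \<bar>r\<bar> * N x"
proof -
  have "ip (r *\<^sub>R x) (r *\<^sub>R x) = r\<^sup>2 * ip x x"
    by (simp add: ip_simps power2_eq_square)
  then show ?thesis
    by (simp add: N_def real_sqrt_mult)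
qed

lemma N_minus: "N (- x) = N x"
  using N_scale[of "-1" x] by simp

lemma N_diff_triangle: "N (x - y) \<le> N x + N y"
  using N_triangle[of x "- y"] by (simp add: N_minus)

lemma N_T_le: "N (T x) \<le> N x"
proof (cases "N (T x) = 0")
  case True
  then show ?thesis by (simp add: N_nonneg)
next
  case False
  have "(N (T x))\<^sup>2 \<le> N (T x) * N x"
    using T_square_le[of x] ip_Cauchy_Schwarz[of "T x" x] by (simp add: N_square)
  then show ?thesis
    using False N_nonneg[of "T x"] by (simp add: power2_eq_square)
qed

lemma N_zero_ip: "N x = 0 \<Longrightarrow> ip x y = 0"
  using ip_Cauchy_Schwarz[of x y] by simp

text \<open>On an eigenvector of \<open>T\<close> for \<mu> it acts as
  \<open>\<mu> - \<mu>^2\<close>, which is small exactly when \<mu> is close to 0 or 1, given that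
  \<mu> lies in the unit interval.\<close>

definition D :: "'v \<Rightarrow> 'v" where "D x = T x - T (T x)"

lemma D_diff: "D (x - y) = D x - D y"
  by (simp add: D_def T_diff)

lemma N_D_le: "N (D x) \<le> 2 * N x"
  using N_diff_triangle[of "T x" "T (T x)"] N_T_le[of x] N_T_le[of "T x"] by (simp add: D_def)

lemma ip_D: "ip (D x) x = ip (T x) x - ip (T x) (T x)"
  by (simp add: D_def ip_simps T_sym[of "T x" x])

lemma D_sym: "ip (D x) y = ip x (D y)"
  by (simp add: D_def ip_simps T_sym)

lemma D_add: "D (x + y) = D x + D y"
  by (simp add: D_def T_add)

lemma D_scale: "D (r *\<^sub>R x) = r *\<^sub>R D x"
  by (simp add: D_def T_scale scaleR_diff_right)

lemma ip_D_nonneg: "0 \<le> ip (D x) x"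
  using T_square_le[of x] by (simp add: ip_D)

lemma ip_D_le: "ip (D x) x \<le> ip x x"
proof -
  have "ip (D x) x \<le> \<bar>ip (T x) x\<bar>"
    using ip_nonneg[of "T x"] by (simp add: ip_D)
  also have "\<dots> \<le> N (T x) * N x"
    by (rule ip_Cauchy_Schwarz)
  also have "\<dots> \<le> N x * N x"
    by (intro mult_right_mono N_T_le N_nonneg)
  finally show ?thesis
    by (simp add: N_square[symmetric] power2_eq_square)
qed

text \<open>
  Maximizing sequences for \<open>ip (D x) x\<close> on an invariant subspace converge along a subsequence:
  by Cauchy-Schwarz for the form \<open>m * ip x y - ip (D x) y\<close> they are approximate eigenvectors of \<open>D\<close>.
\<close>

lemma exists_D_eigenvector:
  assumes W: "W = {x. \<forall>i<n::nat. ip x (e i) = 0}"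
    and inv: "\<And>x. x \<in> W \<Longrightarrow> T x \<in> W"
    and x0: "x0 \<in> W" "ip x0 x0 = 1" "ip (D x0) x0 \<ge> \<kappa>" and \<kappa>: "\<kappa> > 0"
  shows "\<exists>m x. m \<ge> \<kappa> \<and> x \<in> W \<and> N x = 1 \<and> N (D x - m *\<^sub>R x) = 0"
proof -
  have W_comb: "s *\<^sub>R x + t *\<^sub>R y \<in> W" if "x \<in> W" "y \<in> W" for s t x y
    using that by (auto simp: W ip_simps)
  have W_scale: "s *\<^sub>R x \<in> W" and W_diff: "x - y \<in> W" if "x \<in> W" "y \<in> W" for s x y
    using W_comb[OF that, of s 0] W_comb[OF that, of 1 "-1"] by simp_all
  have W_D: "D x \<in> W" if "x \<in> W" for x
    unfolding D_def using that by (intro W_diff inv)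
  let ?S = "{ip (D x) x | x. x \<in> W \<and> ip x x = 1}"
  define m where "m = Sup ?S"
  have bdd: "bdd_above ?S"
    by (rule bdd_aboveI[of _ 1]) (auto intro: order_trans[OF ip_D_le])
  have ne: "?S \<noteq> {}" using x0 by auto
  have "ip (D x0) x0 \<le> m"
    unfolding m_def using x0 by (intro cSup_upper bdd) auto
  then have m: "m \<ge> \<kappa>" "m > 0" using x0 \<kappa> by auto
  have D_le: "ip (D x) x \<le> m * ip x x" if x: "x \<in> W" for x
  proof (cases "N x = 0")
    case True
    then show ?thesis
      using ip_D_le[of x] N_square[of x] by simp
  next
    case False
    then have pos: "N x > 0" using N_nonneg[of x] by simp
    let ?y = "(1 / N x) *\<^sub>R x"
    have "ip ?y ?y = 1"
      unfolding N_square[symmetric] N_scale using pos by simp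
    moreover have "?y \<in> W" using W_scale x by blast
    ultimately have "ip (D ?y) ?y \<le> m"
      unfolding m_def by (intro cSup_upper bdd) auto
    moreover have "ip (D ?y) ?y = ip (D x) x / (N x)\<^sup>2"
      by (simp add: D_scale ip_simps power2_eq_square)
    ultimately show ?thesis
      using pos by (simp add: N_square[symmetric] field_simps)
  qed
  have "\<exists>x. x \<in> W \<and> ip x x = 1 \<and> m - ip (D x) x < 1 / Suc k" for k
  proof -
    have "m - 1 / Suc k < Sup ?S" by (simp add: m_def)
    then show ?thesis
      using less_cSup_iff[OF ne bdd] by (auto simp: algebra_simps)
  qed
  then obtain v where v: "\<And>k. v k \<in> W" "\<And>k. ip (v k) (v k) = 1" "\<And>k. m - ip (D (v k)) (v k) < 1 / Suc k"
    by metis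
  define z where "z k = m *\<^sub>R v k - D (v k)" for k
  have zW: "z k \<in> W" for k
    unfolding z_def by (intro W_diff W_scale W_D v(1)) (rule v(1))
  have ip_z: "ip (z k) (z k) \<le> m * (1 / Suc k)" for k
  proof (cases "ip (z k) (z k) = 0")
    case True
    then show ?thesis using m by simp
  next
    case False
    define b where "b x y = m * ip x y - ip (D x) y" for x y
    have "(b (v k) (z k))\<^sup>2 \<le> b (v k) (v k) * b (z k) (z k)"
    proof (rule discriminant_nonpos)
      fix s t
      let ?w = "s *\<^sub>R v k + t *\<^sub>R z k"
      have "ip (D (z k)) (v k) = ip (D (v k)) (z k)"
        using D_sym ip_sym by metis
      then have "s\<^sup>2 * b (v k) (v k) + 2 * s * t * b (v k) (z k) + t\<^sup>2 * b (z k) (z k) = m * ip ?w ?w - ip (D ?w) ?w"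
        by (simp add: b_def D_add D_scale ip_simps ip_sym[of "z k" "v k"] power2_eq_square algebra_simps)
      moreover have "ip (D ?w) ?w \<le> m * ip ?w ?w"
        by (intro D_le W_comb v zW)
      ultimately show "0 \<le> s\<^sup>2 * b (v k) (v k) + 2 * s * t * b (v k) (z k) + t\<^sup>2 * b (z k) (z k)"
        by simp
    qed
    moreover have "b (v k) (z k) = ip (z k) (z k)"
      by (simp add: b_def z_def ip_diff ip_scale)
    moreover have "b (v k) (v k) \<le> 1 / Suc k"
      using v(3)[of k] by (simp add: b_def v(2))
    moreover have "0 \<le> b (v k) (v k)"
      using D_le[OF v(1)[of k]] by (simp add: b_def)
    \<comment> \<open>Here positivity of \<open>D\<close> enters; it allows one factor
      \<open>ip (z k) (z k)\<close> to be cancelled from the Cauchy-Schwarz inequality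
      below.\<close>
    moreover have "b (z k) (z k) \<le> m * ip (z k) (z k)"
      using ip_D_nonneg[of "z k"] by (simp add: b_def)
    moreover have "0 \<le> b (z k) (z k)"
      using D_le[OF zW[of k]] by (simp add: b_def)
    ultimately have "(ip (z k) (z k))\<^sup>2 \<le> 1 / Suc k * (m * ip (z k) (z k))"
      using mult_mono[of "b (v k) (v k)" "1 / Suc k" "b (z k) (z k)" "m * ip (z k) (z k)"] by simp
    then have "ip (z k) (z k) * ip (z k) (z k) \<le> (m * (1 / Suc k)) * ip (z k) (z k)"
      by (simp add: power2_eq_square mult_ac)
    moreover have "0 < ip (z k) (z k)"
      using False ip_nonneg[of "z k"] by simp
    ultimately show ?thesis
      by (rule mult_right_le_imp_le)
  qed
  have "(\<lambda>k. m * (1 / real (Suc k))) \<longlonglongrightarrow> m * 0"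
    using LIMSEQ_inverse_real_of_nat by (intro tendsto_intros) (simp add: inverse_eq_divide)
  then have "(\<lambda>k. ip (z k) (z k)) \<longlonglongrightarrow> 0"
    using tendsto_sandwich[of "\<lambda>_. 0" "\<lambda>k. ip (z k) (z k)" sequentially "\<lambda>k. m * (1 / Suc k)" 0] ip_z ip_nonneg
    by auto
  then have Nz: "(\<lambda>k. N (z k)) \<longlonglongrightarrow> 0"
    unfolding N_def using tendsto_real_sqrt by fastforce
  obtain u r where r: "strict_mono r" and u: "(\<lambda>k. ip (T (v (r k)) - u) (T (v (r k)) - u)) \<longlonglongrightarrow> 0"
    using T_compact[of v] v(2) by auto
  have Nu: "(\<lambda>k. N (T (v (r k)) - u)) \<longlonglongrightarrow> 0"
    unfolding N_def using tendsto_real_sqrt[OF u] by simp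
  \<comment> \<open>Since \<open>m v = z + T v - T (T v)\<close> with \<open>z\<close> tending to 0
    and \<open>T v\<close> to \<open>u\<close> along the subsequence, this is the only possible
    limit of \<open>v\<close>. Naming it explicitly stands in for completeness of the space.\<close>
  define x where "x = (1 / m) *\<^sub>R (u - T u)"
  have diff_le: "N (v (r k) - x) \<le> (1 / m) * (N (z (r k)) + 2 * N (T (v (r k)) - u))" for k
  proof -
    let ?d = "T (v (r k)) - u"
    have eq: "v (r k) - x = (1 / m) *\<^sub>R (z (r k) + (?d - T ?d))"
      using m by (simp add: x_def z_def D_def T_diff scaleR_diff_right scaleR_add_right)
    have "N (z (r k) + (?d - T ?d)) \<le> N (z (r k)) + (N ?d + N (T ?d))"
      using N_triangle[of "z (r k)" "?d - T ?d"] N_diff_triangle[of ?d "T ?d"] by linarith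
    also have "\<dots> \<le> N (z (r k)) + 2 * N ?d"
      using N_T_le[of ?d] by simp
    finally show ?thesis
      unfolding eq N_scale using m by (simp add: divide_right_mono)
  qed
  have Nzr: "(\<lambda>k. N (z (r k))) \<longlonglongrightarrow> 0"
    using LIMSEQ_subseq_LIMSEQ[OF Nz r] by (simp add: o_def)
  have "(\<lambda>k. (1 / m) * (N (z (r k)) + 2 * N (T (v (r k)) - u))) \<longlonglongrightarrow> (1 / m) * (0 + 2 * 0)"
    by (intro tendsto_intros Nzr Nu)
  then have lim: "(\<lambda>k. N (v (r k) - x)) \<longlonglongrightarrow> 0"
    using tendsto_sandwich[of "\<lambda>_. 0" "\<lambda>k. N (v (r k) - x)" sequentially
        "\<lambda>k. (1 / m) * (N (z (r k)) + 2 * N (T (v (r k)) - u))" 0] diff_le N_nonneg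
    by auto
  have Nv: "N (v k) = 1" for k
    by (simp add: N_def v(2))
  have "N x = 1"
  proof -
    have "\<bar>N x - 1\<bar> \<le> N (v (r k) - x)" for k
      using N_diff_triangle[of "v (r k)" "v (r k) - x"] N_triangle[of "v (r k) - x" x] Nv[of "r k"] by simp
    then have "\<bar>N x - 1\<bar> \<le> 0"
      by (intro LIMSEQ_le_const[OF lim]) auto
    then show ?thesis by simp
  qed
  moreover have "x \<in> W"
  proof -
    have "ip x (e i) = 0" if i: "i < n" for i
    proof -
      have "\<bar>ip x (e i)\<bar> \<le> N (v (r k) - x) * N (e i)" for k
      proof -
        have "ip (v (r k)) (e i) = 0"
          using v(1)[of "r k"] i by (simp add: W)
        then have "ip x (e i) = - ip (v (r k) - x) (e i)"
          by (simp add: ip_simps)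
        then show ?thesis using ip_Cauchy_Schwarz[of "v (r k) - x" "e i"] by simp
      qed
      moreover have "(\<lambda>k. N (v (r k) - x) * N (e i)) \<longlonglongrightarrow> 0 * N (e i)"
        by (intro tendsto_intros lim)
      ultimately have "\<bar>ip x (e i)\<bar> \<le> 0 * N (e i)"
        by (intro LIMSEQ_le_const) auto
      then show ?thesis by simp
    qed
    then show ?thesis by (simp add: W)
  qed
  moreover have "N (D x - m *\<^sub>R x) = 0"
  proof -
    have "N (D x - m *\<^sub>R x) \<le> (2 + m) * N (v (r k) - x) + N (z (r k))" for k
    proof -
      let ?d = "v (r k) - x"
      have eq: "D x - m *\<^sub>R x = (m *\<^sub>R ?d - D ?d) - z (r k)"
        by (simp add: z_def D_diff scaleR_diff_right)
      have "N ((m *\<^sub>R ?d - D ?d) - z (r k)) \<le> N (m *\<^sub>R ?d) + N (D ?d) + N (z (r k))"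
        using N_diff_triangle[of "m *\<^sub>R ?d - D ?d" "z (r k)"] N_diff_triangle[of "m *\<^sub>R ?d" "D ?d"] by linarith
      also have "\<dots> \<le> m * N ?d + 2 * N ?d + N (z (r k))"
        using N_D_le[of ?d] m by (simp add: N_scale)
      finally show ?thesis
        unfolding eq by (simp add: algebra_simps)
    qed
    moreover have "(\<lambda>k. (2 + m) * N (v (r k) - x) + N (z (r k))) \<longlonglongrightarrow> (2 + m) * 0 + 0"
      by (intro tendsto_intros lim Nzr)
    ultimately have "N (D x - m *\<^sub>R x) \<le> (2 + m) * 0 + 0"
      by (intro LIMSEQ_le_const) auto
    then show ?thesis using N_nonneg[of "D x - m *\<^sub>R x"] by simp
  qed
  ultimately show ?thesis
    using m(1) by blast
qed

text \<open>The polynomial \<open>t^2 - t + m\<close> has the roots \<open>1/2 - s\<close> and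
  \<open>1/2 + s\<close>, where \<open>s^2 = 1/4 - m\<close>, and it annihilates \<open>x\<close>
  when \<open>T\<close> is inserted. Either \<open>x\<close> is already an eigenvector for the first
  root, or \<open>T x - (1/2 - s) x\<close> is nonzero and an eigenvector for the second. All
  equalities are modulo vectors of seminorm 0.\<close>

lemma T_eigenvector_of_D_eigenvector:
  assumes W: "\<And>s t x y. x \<in> W \<Longrightarrow> y \<in> W \<Longrightarrow> s *\<^sub>R x + t *\<^sub>R y \<in> W" and inv: "\<And>x. x \<in> W \<Longrightarrow> T x \<in> W"
    and x: "x \<in> W" "N x = 1" "N (D x - m *\<^sub>R x) = 0"
  shows "\<exists>\<mu> y. \<mu> - \<mu>\<^sup>2 = m \<and> y \<in> W \<and> N y = 1 \<and> N (T y - \<mu> *\<^sub>R y) = 0"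
proof -
  have xx: "ip x x = 1"
    using x(2) N_square[of x] by simp
  have "ip (D x) x = m"
    using N_zero_ip[OF x(3), of x] by (simp add: ip_simps xx)
  then have "ip (T x) x - ip (T x) (T x) = m"
    by (simp add: ip_D)
  \<comment> \<open>Expanding this square gives \<open>1/4 - m\<close>, so the roots are
    real.\<close>
  moreover have "0 \<le> ip (T x - (1/2) *\<^sub>R x) (T x - (1/2) *\<^sub>R x)"
    by (rule ip_nonneg)
  ultimately have "m \<le> 1/4"
    by (simp add: ip_simps ip_sym[of x "T x"] xx)
  define s where "s = sqrt (1/4 - m)"
  have s: "s\<^sup>2 = 1/4 - m"
    using \<open>m \<le> 1/4\<close> by (simp add: s_def)
  have \<mu>: "(1/2 - s) - (1/2 - s)\<^sup>2 = m" "(1/2 + s) - (1/2 + s)\<^sup>2 = m"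
    using s by (simp_all add: power2_eq_square algebra_simps)
  let ?f = "T x - (1/2 - s) *\<^sub>R x"
  show ?thesis
  proof (cases "N ?f = 0")
    case True
    then show ?thesis using \<mu>(1) x by blast
  next
    case False
    then have pos: "N ?f > 0" using N_nonneg[of ?f] by simp
    let ?y = "(1 / N ?f) *\<^sub>R ?f"
    have fW: "?f \<in> W"
      using W[OF inv[OF x(1)] x(1), of 1 "- (1/2 - s)"]
      by (simp only: scaleR_one scaleR_minus_left add_uminus_conv_diff)
    have "(1/2 - s) * (1/2 + s) = m"
      using s by (simp add: algebra_simps power2_eq_square)
    then have "(1/2 + s) *\<^sub>R ((1/2 - s) *\<^sub>R x) = m *\<^sub>R x"
      by (simp only: scaleR_scaleR mult.commute)
    moreover have "T ?f - (1/2 + s) *\<^sub>R ?f =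
        T (T x) - ((1/2 - s) *\<^sub>R T x + (1/2 + s) *\<^sub>R T x) + (1/2 + s) *\<^sub>R ((1/2 - s) *\<^sub>R x)"
      by (simp only: T_diff T_scale scaleR_diff_right) (simp add: algebra_simps)
    moreover have "(1/2 - s) *\<^sub>R T x + (1/2 + s) *\<^sub>R T x = T x"
      by (simp add: scaleR_add_left[symmetric])
    ultimately have "T ?f - (1/2 + s) *\<^sub>R ?f = - (D x - m *\<^sub>R x)"
      by (simp add: D_def)
    then have "N (T ?f - (1/2 + s) *\<^sub>R ?f) = 0"
      using x(3) N_minus by metis
    moreover have "T ?y - (1/2 + s) *\<^sub>R ?y = (1 / N ?f) *\<^sub>R (T ?f - (1/2 + s) *\<^sub>R ?f)"
    proof -
      have "T (c *\<^sub>R f) - d *\<^sub>R (c *\<^sub>R f) = c *\<^sub>R (T f - d *\<^sub>R f)" for c d f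
        by (simp add: T_scale scaleR_diff_right mult.commute)
      then show ?thesis .
    qed
    ultimately have "N (T ?y - (1/2 + s) *\<^sub>R ?y) = 0"
      by (simp only: N_scale mult_zero_right)
    moreover have "N ?y = 1"
      using pos by (simp only: N_scale) simp
    moreover have "?y \<in> W"
      using W[OF fW fW, of "1 / N ?f" 0] by (simp only: scaleR_zero_left add_0_right)
    ultimately show ?thesis using \<mu>(2) by blast
  qed
qed

text \<open>Induction on the number of eigenvectors. Their orthogonal complement \<open>W\<close> is
  invariant by symmetry of \<open>T\<close> and, for dimension reasons, still contains a nonzero
  vector of the trial space. There the form of \<open>D\<close> is at least \<open>\<kappa>\<close>
  times the norm squared, so the maximum of the form over unit vectors of \<open>W\<close> is at
  least \<open>\<kappa>\<close> as well.\<close>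

theorem exists_orthonormal_eigenvectors:
  assumes \<kappa>: "\<kappa> > 0" and w: "finite I"
    and q: "\<And>a. ip (T (\<Sum>i\<in>I. a i *\<^sub>R w i)) (\<Sum>i\<in>I. a i *\<^sub>R w i) -
        ip (T (\<Sum>i\<in>I. a i *\<^sub>R w i)) (T (\<Sum>i\<in>I. a i *\<^sub>R w i)) \<ge> \<kappa> * ip (\<Sum>i\<in>I. a i *\<^sub>R w i) (\<Sum>i\<in>I. a i *\<^sub>R w i)"
    and indep: "\<And>a i. ip (\<Sum>i\<in>I. a i *\<^sub>R w i) (\<Sum>i\<in>I. a i *\<^sub>R w i) = 0 \<Longrightarrow> i \<in> I \<Longrightarrow> a i = 0"
  shows "\<exists>e \<mu>. \<forall>i<card I. N (e i) = 1 \<and> (\<forall>j<i. ip (e i) (e j) = 0) \<and> \<mu> i - (\<mu> i)\<^sup>2 \<ge> \<kappa> \<and> N (T (e i) - \<mu> i *\<^sub>R e i) = 0"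
proof -
  have "\<exists>e \<mu>. \<forall>i<n. N (e i) = 1 \<and> (\<forall>j<i. ip (e i) (e j) = 0) \<and> \<mu> i - (\<mu> i)\<^sup>2 \<ge> \<kappa> \<and> N (T (e i) - \<mu> i *\<^sub>R e i) = 0"
    if "n \<le> card I" for n
    using that
  proof (induction n)
    case (Suc n)
    then obtain e \<mu> where e: "\<And>i. i < n \<Longrightarrow> N (e i) = 1 \<and> (\<forall>j<i. ip (e i) (e j) = 0) \<and>
        \<mu> i - (\<mu> i)\<^sup>2 \<ge> \<kappa> \<and> N (T (e i) - \<mu> i *\<^sub>R e i) = 0"
      by (metis Suc_leD)
    define W where "W = {x. \<forall>i<n. ip x (e i) = 0}"
    have inv: "T x \<in> W" if x: "x \<in> W" for x
    proof -
      have "ip (T x) (e i) = 0" if i: "i < n" for i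
      proof -
        have "ip (T (e i) - \<mu> i *\<^sub>R e i) x = 0"
          using e[OF i] N_zero_ip by blast
        moreover have "ip (e i) x = 0"
          using x i ip_sym by (auto simp: W_def)
        ultimately have "ip (T (e i)) x = 0"
          by (simp add: ip_simps)
        then show ?thesis by (metis ip_sym T_sym)
      qed
      then show ?thesis by (simp add: W_def)
    qed
    \<comment> \<open>There are \<open>n\<close> linear conditions on \<open>card I > n\<close>
      coefficients; \<open>indep\<close> turns a nonzero coefficient vector into a vector of nonzero
      norm.\<close>
    obtain a where a: "\<exists>i\<in>I. a i \<noteq> 0" "\<forall>j<n. (\<Sum>i\<in>I. a i * ip (w i) (e j)) = 0"
      using nontrivial_solution[OF w, of n "\<lambda>i j. ip (w i) (e j)"] Suc.prems by auto
    define x where "x = (\<Sum>i\<in>I. a i *\<^sub>R w i)"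
    have "x \<in> W"
      using a(2) by (simp add: W_def x_def ip_sum[OF w] ip_scale)
    have "ip x x \<noteq> 0"
      using a(1) indep[of a, folded x_def] by blast
    then have pos: "ip x x > 0" using ip_nonneg[of x] by simp
    have qx: "ip (D x) x \<ge> \<kappa> * ip x x"
      using q[of a, folded x_def] by (simp only: ip_D)
    let ?y = "(1 / N x) *\<^sub>R x"
    have Npos: "N x > 0" using pos by (simp add: N_def)
    have "ip ?y ?y = 1"
      unfolding N_square[symmetric] N_scale using Npos by simp
    moreover have "?y \<in> W"
      using \<open>x \<in> W\<close> by (simp add: W_def ip_simps)
    moreover have "ip (D ?y) ?y \<ge> \<kappa>"
    proof -
      have "ip (D ?y) ?y = ip (D x) x / (N x)\<^sup>2"
        by (simp add: D_scale ip_simps power2_eq_square)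
      then have "ip (D ?y) ?y = ip (D x) x / ip x x"
        by (simp only: N_square)
      moreover have "\<kappa> \<le> ip (D x) x / ip x x" using qx pos by (simp add: pos_le_divide_eq)
      ultimately show ?thesis by (simp only:)
    qed
    ultimately obtain m z where z: "m \<ge> \<kappa>" "z \<in> W" "N z = 1" "N (D z - m *\<^sub>R z) = 0"
      using exists_D_eigenvector[OF W_def inv _ _ _ \<kappa>] by blast
    have "s *\<^sub>R x + t *\<^sub>R y \<in> W" if "x \<in> W" "y \<in> W" for s t x y
      using that by (auto simp: W_def ip_simps)
    then obtain \<nu> y where y: "\<nu> - \<nu>\<^sup>2 = m" "y \<in> W" "N y = 1" "N (T y - \<nu> *\<^sub>R y) = 0"
      using T_eigenvector_of_D_eigenvector[OF _ inv z(2-4)] by blast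
    show ?case
    proof (intro exI allI impI)
      fix i assume "i < Suc n"
      then show "N ((e(n := y)) i) = 1 \<and> (\<forall>j<i. ip ((e(n := y)) i) ((e(n := y)) j) = 0) \<and>
          (\<mu>(n := \<nu>)) i - ((\<mu>(n := \<nu>)) i)\<^sup>2 \<ge> \<kappa> \<and>
          N (T ((e(n := y)) i) - (\<mu>(n := \<nu>)) i *\<^sub>R (e(n := y)) i) = 0"
        using e[of i] y z(1) by (cases "i = n") (auto simp: W_def)
    qed
  qed auto
  then show ?thesis by blast
qed

end

section \<open>The concentration operator on bounded functions\<close>

text \<open>Functions, not classes: \<open>T f\<close> then has values at every point, also outside
  the set \<open>A\<close> that the form \<open>ip\<close> sees. Boundedness makes all integrals
  over \<open>A\<close> exist and is kept by \<open>T\<close> and by the limits in the compactness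
  argument.\<close>

typedef (overloaded) 'a bfun = "{f :: 'a::euclidean_space \<Rightarrow> real. f \<in> borel_measurable borel \<and> (\<exists>C. \<forall>x. \<bar>f x\<bar> \<le> C)}"
  morphisms fn Bfun
  by (rule exI[of _ "\<lambda>_. 0"]) auto

lemma borel_measurable_fn [measurable]: "fn f \<in> borel_measurable borel"
  using fn[of f] by auto

lemma fn_bounded: "\<exists>C. \<forall>x. \<bar>fn f x\<bar> \<le> C"
  using fn[of f] by auto

lemma fn_Bfun:
  assumes "f \<in> borel_measurable borel" "\<And>x. \<bar>f x\<bar> \<le> C"
  shows "fn (Bfun f) = f"
  using assms by (intro Bfun_inverse) auto

lemma bfun_eqI: "(\<And>x. fn f x = fn g x) \<Longrightarrow> f = g"
  by (metis ext fn_inject)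

instantiation bfun :: (euclidean_space) real_vector
begin

definition "0 = Bfun (\<lambda>_. 0)"
definition "f + g = Bfun (\<lambda>x. fn f x + fn g x)"
definition "- f = Bfun (\<lambda>x. - fn f x)"
definition "f - g = Bfun (\<lambda>x. fn f x - fn g x)"
definition "r *\<^sub>R f = Bfun (\<lambda>x. r * fn f x)"

lemma fn_zero: "fn 0 x = 0"
  unfolding zero_bfun_def by (subst fn_Bfun[of _ 0]) auto

lemma fn_add: "fn (f + g) x = fn f x + fn g x"
proof -
  obtain C D where "\<And>x. \<bar>fn f x\<bar> \<le> C" "\<And>x. \<bar>fn g x\<bar> \<le> D" using fn_bounded by metis
  then have "\<bar>fn f x + fn g x\<bar> \<le> C + D" for x
    by (rule order_trans[OF abs_triangle_ineq add_mono])
  then show ?thesis unfolding plus_bfun_def by (subst fn_Bfun) auto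
qed

lemma fn_minus: "fn (- f) x = - fn f x"
proof -
  obtain C where "\<And>x. \<bar>fn f x\<bar> \<le> C" using fn_bounded by metis
  then show ?thesis unfolding uminus_bfun_def by (subst fn_Bfun[of _ C]) auto
qed

lemma fn_scale: "fn (r *\<^sub>R f) x = r * fn f x"
proof -
  obtain C where "\<And>x. \<bar>fn f x\<bar> \<le> C" using fn_bounded by metis
  then have "\<bar>r * fn f x\<bar> \<le> \<bar>r\<bar> * C" for x
    by (auto simp: abs_mult intro: mult_left_mono)
  then show ?thesis unfolding scaleR_bfun_def by (subst fn_Bfun) auto
qed

lemma fn_diff: "fn (f - g) x = fn f x - fn g x"
proof -
  have "f - g = f + - g"
    by (simp add: plus_bfun_def minus_bfun_def fn_minus)
  then show ?thesis by (simp add: fn_add fn_minus)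
qed

instance
  by standard (auto intro!: bfun_eqI simp: fn_zero fn_add fn_minus fn_scale fn_diff algebra_simps)

end

lemma fn_sum: "finite I \<Longrightarrow> fn (\<Sum>i\<in>I. f i) x = (\<Sum>i\<in>I. fn (f i) x)"
  by (induction I rule: finite_induct) (auto simp: fn_zero fn_add)

text \<open>Convexity gives both sets null boundaries. Symmetry of \<open>B\<close> makes the
  convolution kernel real and even, so that \<open>T\<close> acts on real functions and is symmetric
  for a real form.\<close>

locale concentration =
  fixes A B :: "'a::euclidean_space set"
  assumes A: "bounded A" "convex A" "A \<in> sets borel"
    and B: "bounded B" "convex B" "B \<in> sets borel"
    and B_sym: "- \<xi> \<in> B \<longleftrightarrow> \<xi> \<in> B"
begin

lemmas AB_measurable [measurable] = A(3) B(3)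

definition cut :: "'a bfun \<Rightarrow> 'a \<Rightarrow> complex" where
  "cut f x = of_real (indicator A x * fn f x)"

definition K :: "'a \<Rightarrow> real" where
  "K t = Re (fourier_integral (indicator B) t)"

text \<open>The outer cut to \<open>A\<close> is omitted: this is the band projection of
  \<open>f\<close> cut to \<open>A\<close>, defined on the whole space. For \<open>ip\<close> the
  difference is invisible, while the values off \<open>A\<close> carry the energy that has to be
  bounded below.\<close>

definition T :: "'a bfun \<Rightarrow> 'a bfun" where
  "T f = Bfun (\<lambda>x. LINT y|lborel. indicator A y * K (x - y) * fn f y)"

definition ip :: "'a bfun \<Rightarrow> 'a bfun \<Rightarrow> real" where
  "ip f g = (LINT x|lborel. indicator A x * (fn f x * fn g x))"

lemma integrable_indicator_B: "integrable lborel (indicator B :: 'a \<Rightarrow> complex)"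
  by (rule integrable_bounded_on_bounded_set[OF _ B(1), of _ 1]) (auto simp: indicator_def)

lemma K_eq: "of_real (K t) = fourier_integral (indicator B) t" and K_even: "K (- t) = K t"
proof -
  have even: "fourier_integral (indicator B) (- t) = fourier_integral (indicator B) t" for t
  proof -
    let ?h = "\<lambda>x. indicator B x * exp (- 2 * pi * \<i> * of_real (x \<bullet> t)) :: complex"
    have "?h \<in> borel_measurable borel" by measurable
    then have "(LINT x|lborel. ?h (- x)) = (LINT x|lborel. ?h x)"
      by (rule integral_lborel_minus)
    then show ?thesis
      by (simp add: fourier_integral_def B_sym indicator_def cong: if_cong)
  qed
  have "cnj (fourier_integral (indicator B) t) = fourier_integral (\<lambda>x. cnj (indicator B x)) (- t)"
    by (rule cnj_fourier_integral)
  also have "(\<lambda>x. cnj (indicator B x)) = indicator B"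
    by (auto simp: indicator_def)
  finally have "cnj (fourier_integral (indicator B) t) = fourier_integral (indicator B) t"
    by (simp add: even)
  then show "of_real (K t) = fourier_integral (indicator B) t"
    by (metis K_def Reals_cnj_iff of_real_Re)
  show "K (- t) = K t"
    by (simp add: K_def even)
qed

lemma continuous_K: "continuous_on UNIV K"
  unfolding K_def[abs_def] by (intro continuous_intros continuous_fourier_integral integrable_indicator_B)

lemma borel_measurable_K [measurable]: "K \<in> borel_measurable borel"
  by (rule borel_measurable_continuous_onI[OF continuous_K])

lemma K_bounded: "\<exists>C. \<forall>t. \<bar>K t\<bar> \<le> C"
  unfolding K_def
  by (intro exI[of _ "LINT x|lborel. cmod (indicator B x)"] allI order_trans[OF abs_Re_le_cmod fourier_integral_bound])

lemma integrable_A: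
  fixes f :: "'a \<Rightarrow> real"
  assumes "f \<in> borel_measurable borel" "\<And>x. \<bar>f x\<bar> \<le> C"
  shows "integrable lborel (\<lambda>x. indicator A x * f x)"
proof (rule integrable_bounded_on_bounded_set[OF _ A(1), of _ C])
  show "norm (indicator A x * f x) \<le> C" for x
    using assms(2)[of x] by (auto simp: indicator_def)
qed (use assms in auto)

lemma integrable_A_fn: "integrable lborel (\<lambda>x. indicator A x * fn f x)"
  using fn_bounded[of f] by (auto intro: integrable_A)

lemma bounded_fn_mult: "\<exists>C. \<forall>x. \<bar>fn f x * fn g x\<bar> \<le> C"
proof -
  obtain C D where *: "\<And>x. \<bar>fn f x\<bar> \<le> C" "\<And>x. \<bar>fn g x\<bar> \<le> D" using fn_bounded by metis
  have "\<bar>fn f x * fn g x\<bar> \<le> C * D" for x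
    unfolding abs_mult by (intro mult_mono * abs_ge_zero order_trans[OF abs_ge_zero *(1)])
  then show ?thesis by blast
qed

lemma integrable_A_mult: "integrable lborel (\<lambda>x. indicator A x * (fn f x * fn g x))"
proof -
  obtain C where "\<And>x. \<bar>fn f x * fn g x\<bar> \<le> C" using bounded_fn_mult by metis
  then show ?thesis by (intro integrable_A) auto
qed

lemma integrable_A_abs: "integrable lborel (\<lambda>x. indicator A x * \<bar>fn f x\<bar>)"
proof -
  obtain C where "\<And>x. \<bar>fn f x\<bar> \<le> C" using fn_bounded by metis
  then show ?thesis by (intro integrable_A[of _ C]) auto
qed

lemma integral_abs_le: "(LINT x|lborel. indicator A x * \<bar>fn f x\<bar>) \<le> measure lborel A + ip f f"
proof -
  have 1: "integrable lborel (indicator A :: 'a \<Rightarrow> real)"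
    using integrable_A[of "\<lambda>_. 1" 1] by simp
  have "(LINT x|lborel. indicator A x * \<bar>fn f x\<bar>) \<le>
      (LINT x|lborel. indicator A x + indicator A x * (fn f x * fn f x))"
  proof (rule integral_mono[OF integrable_A_abs Bochner_Integration.integrable_add[OF 1 integrable_A_mult]])
    fix x
    have "0 \<le> (\<bar>fn f x\<bar> - 1)\<^sup>2" "0 \<le> \<bar>fn f x\<bar>\<^sup>2" by simp_all
    then have "0 \<le> \<bar>fn f x\<bar>\<^sup>2 - 2 * \<bar>fn f x\<bar> + 1" "0 \<le> \<bar>fn f x\<bar>\<^sup>2" by (simp_all add: power2_diff)
    then have "\<bar>fn f x\<bar> \<le> 1 + \<bar>fn f x\<bar>\<^sup>2" by linarith
    then show "indicator A x * \<bar>fn f x\<bar> \<le> indicator A x + indicator A x * (fn f x * fn f x)"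
      by (auto simp: indicator_def power2_eq_square)
  qed
  also have "\<dots> = measure lborel A + ip f f"
    using 1 integrable_A_mult[of f f] by (simp add: ip_def)
  finally show ?thesis .
qed

lemma kernel_integrable: "integrable lborel (\<lambda>y. indicator A y * K (x - y) * fn f y)"
proof -
  obtain C D where *: "\<And>x. \<bar>K x\<bar> \<le> C" "\<And>x. \<bar>fn f x\<bar> \<le> D" using fn_bounded K_bounded by metis
  have "\<bar>K (x - y) * fn f y\<bar> \<le> C * D" for y
    unfolding abs_mult by (intro mult_mono * abs_ge_zero order_trans[OF abs_ge_zero *(1)])
  then have "integrable lborel (\<lambda>y. indicator A y * (K (x - y) * fn f y))"
    by (intro integrable_A) auto
  then show ?thesis by (simp only: mult.assoc)
qed

text \<open>The function \<open>k\<close> is left free so that the estimate serves twice: with a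
  translate of \<open>K\<close> for uniform bounds, and with the difference of two translates for
  equicontinuity. The constant stays bounded over the unit ball of \<open>ip\<close>.\<close>

lemma kernel_diff_bound:
  assumes "\<And>y. y \<in> A \<Longrightarrow> \<bar>k y\<bar> \<le> \<epsilon>" "integrable lborel (\<lambda>y. indicator A y * k y * fn f y)" "\<epsilon> \<ge> 0"
  shows "\<bar>LINT y|lborel. indicator A y * k y * fn f y\<bar> \<le> \<epsilon> * (measure lborel A + ip f f)"
proof -
  have "\<bar>LINT y|lborel. indicator A y * k y * fn f y\<bar> \<le> (LINT y|lborel. \<bar>indicator A y * k y * fn f y\<bar>)"
    by (rule integral_abs_bound)
  also have "\<dots> \<le> (LINT y|lborel. \<epsilon> * (indicator A y * \<bar>fn f y\<bar>))"
  proof (rule integral_mono)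
    show "integrable lborel (\<lambda>y. \<bar>indicator A y * k y * fn f y\<bar>)"
      using assms(2) by (rule integrable_abs)
    show "integrable lborel (\<lambda>y. \<epsilon> * (indicator A y * \<bar>fn f y\<bar>))"
      by (intro integrable_mult_right integrable_A_abs)
    show "\<bar>indicator A y * k y * fn f y\<bar> \<le> \<epsilon> * (indicator A y * \<bar>fn f y\<bar>)" for y
      using assms(1)[of y] by (auto simp: indicator_def abs_mult intro: mult_right_mono)
  qed
  also have "\<dots> \<le> \<epsilon> * (measure lborel A + ip f f)"
    using integral_abs_le[of f] assms(3) by (simp add: mult_left_mono)
  finally show ?thesis .
qed

lemma fn_T: "fn (T f) x = (LINT y|lborel. indicator A y * K (x - y) * fn f y)"
proof -
  obtain C where C: "\<And>x. \<bar>K x\<bar> \<le> C" using K_bounded by metis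
  have "\<bar>LINT y|lborel. indicator A y * K (x - y) * fn f y\<bar> \<le> C * (measure lborel A + ip f f)" for x
    using order_trans[OF abs_ge_zero C] by (intro kernel_diff_bound C kernel_integrable)
  then show ?thesis
    unfolding T_def by (subst fn_Bfun) auto
qed

lemma borel_measurable_cut [measurable]: "cut f \<in> borel_measurable borel"
  unfolding cut_def[abs_def] by measurable

lemma integrable_cut: "integrable lborel (cut f)"
  unfolding cut_def[abs_def] by (intro integrable_of_real integrable_A_fn)

definition spec :: "'a bfun \<Rightarrow> 'a \<Rightarrow> complex" where
  "spec f \<xi> = indicator B \<xi> * fourier_integral (cut f) \<xi>"

lemma
  shows integrable_spec: "integrable lborel (spec f)"
    and spec_bound: "cmod (spec f \<xi>) \<le> (LINT x|lborel. cmod (cut f x))"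
    and spec_cont: "AE x in lborel. isCont (spec f) x"
proof -
  have [measurable]: "fourier_integral (cut f) \<in> borel_measurable borel"
    by (rule borel_measurable_fourier_integral[OF integrable_cut])
  show b: "cmod (spec f \<xi>) \<le> (LINT x|lborel. cmod (cut f x))" for \<xi>
    using fourier_integral_bound[of "cut f" \<xi>] order_trans[OF norm_ge_zero fourier_integral_bound[of "cut f" \<xi>]]
    by (auto simp: spec_def indicator_def)
  show "integrable lborel (spec f)"
    by (rule integrable_bounded_on_bounded_set[OF _ B(1) b]) (auto simp: spec_def[abs_def])
  show "AE x in lborel. isCont (spec f) x"
    using AE_notin_frontier_convex[OF B(2)] unfolding spec_def[abs_def]
    by eventually_elim
       (intro isCont_indicator_mult, use continuous_fourier_integral[OF integrable_cut] in
         \<open>auto simp: continuous_on_eq_continuous_at\<close>)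
qed

text \<open>The multiplication formula applied to \<open>cut f\<close> and the modulated indicator
  of \<open>B\<close>: the Fourier integral of the latter is a translate of \<open>K\<close>. This
  identifies the kernel operator with a restriction of the spectrum to \<open>B\<close>.\<close>

lemma fn_T_eq: "of_real (fn (T f) x) = fourier_integral (spec f) (- x)"
proof -
  let ?m = "\<lambda>\<xi>. exp (2 * pi * \<i> * of_real (x \<bullet> \<xi>)) * indicator B \<xi>"
  have m: "integrable lborel ?m"
    by (rule Bochner_Integration.integrable_bound[OF integrable_indicator_B]) (auto simp: norm_mult norm_exp_eq_Re)
  have "fourier_integral (spec f) (- x) = (LINT \<xi>|lborel. fourier_integral (cut f) (1 *\<^sub>R \<xi>) * ?m \<xi>)"
    unfolding fourier_integral_def[of "spec f"] spec_def
    by (intro Bochner_Integration.integral_cong refl) (simp add: inner_commute)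
  also have "\<dots> = (LINT y|lborel. cut f y * fourier_integral ?m (1 *\<^sub>R y))"
    by (rule fourier_multiplication_formula[OF integrable_cut m])
  also have "\<dots> = (LINT y|lborel. of_real (indicator A y * K (x - y) * fn f y))"
  proof (intro Bochner_Integration.integral_cong refl)
    fix y
    have "K (y - x) = K (x - y)" using K_even[of "x - y"] by simp
    then have *: "fourier_integral ?m (1 *\<^sub>R y) = of_real (K (x - y))"
      by (simp only: scaleR_one fourier_integral_modulate K_eq[symmetric])
    show "cut f y * fourier_integral ?m (1 *\<^sub>R y) = of_real (indicator A y * K (x - y) * fn f y)"
      unfolding * cut_def by simp
  qed
  also have "\<dots> = of_real (fn (T f) x)"
    by (simp only: integral_complex_of_real fn_T)
  finally show ?thesis ..
qed

lemma continuous_T: "continuous_on UNIV (fn (T f))"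
proof -
  have "fn (T f) = (\<lambda>x. Re (fourier_integral (spec f) (- x)))"
    by (simp add: fn_T_eq[symmetric])
  then show ?thesis
    by (auto intro!: continuous_intros continuous_on_compose2[OF continuous_fourier_integral[OF integrable_spec]])
qed

lemma ip_T_eq: "of_real (ip (T f) g) = (LINT \<xi>|lborel. cnj (fourier_integral (cut g) \<xi>) * spec f \<xi>)"
proof -
  have "(LINT \<xi>|lborel. cnj (fourier_integral (cut g) \<xi>) * spec f \<xi>) =
      (LINT \<xi>|lborel. fourier_integral (cut g) (- 1 *\<^sub>R \<xi>) * spec f \<xi>)"
    by (simp add: cnj_fourier_integral) (simp add: cut_def[abs_def])
  also have "\<dots> = (LINT x|lborel. cut g x * fourier_integral (spec f) (- 1 *\<^sub>R x))"
    by (rule fourier_multiplication_formula[OF integrable_cut integrable_spec])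
  also have "\<dots> = (LINT x|lborel. of_real (indicator A x * (fn (T f) x * fn g x)))"
    by (intro Bochner_Integration.integral_cong refl) (simp add: fn_T_eq[symmetric] cut_def)
  also have "\<dots> = of_real (ip (T f) g)"
    by (simp only: integral_complex_of_real ip_def)
  finally show ?thesis ..
qed

lemma T_sym: "ip (T f) g = ip (T g) f"
proof -
  have "of_real (ip (T f) g) = cnj (of_real (ip (T f) g))" by simp
  also have "\<dots> = (LINT \<xi>|lborel. cnj (fourier_integral (cut f) \<xi>) * spec g \<xi>)"
    unfolding ip_T_eq Bochner_Integration.integral_cnj[symmetric] spec_def
    by (intro Bochner_Integration.integral_cong refl) (simp add: indicator_def)
  also have "\<dots> = of_real (ip (T g) f)"
    by (simp only: ip_T_eq)
  finally show ?thesis by simp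
qed

text \<open>In operator terms \<open>ip_T_self\<close> says that the projection onto band-limited
  functions is idempotent and self-adjoint: both sides equal the spectral energy of
  \<open>cut f\<close> in \<open>B\<close>. The squares are integrated over the whole space, not
  only over \<open>A\<close>.\<close>

lemma
  shows integrable_T_square: "integrable lborel (\<lambda>x. (fn (T f) x)\<^sup>2)"
    and integral_T_square: "(LINT x|lborel. (fn (T f) x)\<^sup>2) = (LINT \<xi>|lborel. (cmod (spec f \<xi>))\<^sup>2)"
    and ip_T_self: "ip (T f) f = (LINT x|lborel. (fn (T f) x)\<^sup>2)"
proof -
  let ?h = "\<lambda>x. (cmod (fourier_integral (spec f) x))\<^sup>2"
  have sq: "(fn (T f) x)\<^sup>2 = ?h (- x)" for x
    by (simp add: fn_T_eq[symmetric])
  have m: "?h \<in> borel_measurable borel"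
    using borel_measurable_fourier_integral[OF integrable_spec[of f]] by measurable
  show "integrable lborel (\<lambda>x. (fn (T f) x)\<^sup>2)"
    unfolding sq integrable_lborel_minus[OF m]
    by (rule integrable_fourier_integral_square[OF integrable_spec spec_bound spec_cont])
  show 1: "(LINT x|lborel. (fn (T f) x)\<^sup>2) = (LINT \<xi>|lborel. (cmod (spec f \<xi>))\<^sup>2)"
    unfolding sq integral_lborel_minus[OF m]
    by (rule plancherel_bounded[OF integrable_spec spec_bound spec_cont])
  have "cnj (fourier_integral (cut f) \<xi>) * spec f \<xi> = of_real ((cmod (spec f \<xi>))\<^sup>2)" for \<xi>
    unfolding complex_norm_square by (simp add: spec_def indicator_def mult.commute)
  then have "complex_of_real (ip (T f) f) = of_real (LINT \<xi>|lborel. (cmod (spec f \<xi>))\<^sup>2)"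
    unfolding ip_T_eq by (simp only: integral_complex_of_real)
  then show "ip (T f) f = (LINT x|lborel. (fn (T f) x)\<^sup>2)"
    unfolding 1 of_real_eq_iff .
qed

lemma ip_T_minus:
  "ip (T f) f - ip (T f) (T f) = (LINT x|lborel. indicator (- A) x * (fn (T f) x)\<^sup>2)"
proof -
  have i: "integrable lborel (\<lambda>x. indicator A x * (fn (T f) x * fn (T f) x))"
    by (rule integrable_A_mult)
  have "(LINT x|lborel. (fn (T f) x)\<^sup>2) - (LINT x|lborel. indicator A x * (fn (T f) x * fn (T f) x)) =
     (LINT x|lborel. (fn (T f) x)\<^sup>2 - indicator A x * (fn (T f) x * fn (T f) x))"
    by (rule Bochner_Integration.integral_diff[symmetric, OF integrable_T_square i])
  also have "\<dots> = (LINT x|lborel. indicator (- A) x * (fn (T f) x)\<^sup>2)"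
    by (intro Bochner_Integration.integral_cong refl) (auto simp: indicator_def power2_eq_square)
  finally show ?thesis
    unfolding ip_T_self unfolding ip_def .
qed

text \<open>The kernel is bounded and uniformly continuous on bounded sets, so \<open>T\<close>
  sends the unit ball of \<open>ip\<close> to a bounded equicontinuous family on a ball containing
  \<open>A\<close>. The uniform limit from Arzela-Ascoli is also a limit for \<open>ip\<close>,
  because \<open>A\<close> has finite measure.\<close>

lemma T_compact:
  assumes v: "\<And>n::nat. ip (v n) (v n) \<le> 1"
  shows "\<exists>u r. strict_mono r \<and> (\<lambda>n. ip (T (v (r n)) - u) (T (v (r n)) - u)) \<longlonglongrightarrow> 0"
proof -
  obtain R where R: "A \<subseteq> cball 0 R"
    using A(1) by (auto simp: bounded_iff subset_iff)
  let ?S = "cball (0::'a) R"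
  let ?m = "measure lborel A + 1"
  \<comment> \<open>The added 1 is the bound for \<open>ip (v n) (v n)\<close>; it also keeps the
    constant positive when \<open>A\<close> is a null set.\<close>
  have m: "?m > 0" by (simp add: add_nonneg_pos)
  have half: "x / (2 * y) * y < x" if "0 < x" "0 < y" for x y :: real
    using that by simp
  obtain C where C: "\<And>x. \<bar>K x\<bar> \<le> C" using K_bounded by metis
  have C0: "C \<ge> 0" using C abs_ge_zero order_trans by blast
  have bd: "norm (fn (T (v n)) x) \<le> C * ?m" for n x
  proof -
    have "\<bar>fn (T (v n)) x\<bar> \<le> C * (measure lborel A + ip (v n) (v n))"
      unfolding fn_T by (intro kernel_diff_bound C kernel_integrable C0)
    also have "\<dots> \<le> C * ?m"
      using v[of n] C0 by (intro mult_left_mono) auto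
    finally show ?thesis by simp
  qed
  have equi: "\<exists>d>0. \<forall>n y. y \<in> ?S \<and> norm (x - y) < d \<longrightarrow> norm (fn (T (v n)) x - fn (T (v n)) y) < e"
    if x: "x \<in> ?S" and e: "0 < e" for x e
  proof -
    \<comment> \<open>Differences of two points of the ball of radius \<open>R\<close> lie in the
      ball of radius \<open>2 * R\<close>.\<close>
    have "uniformly_continuous_on (cball 0 (2 * R)) K"
      by (intro compact_uniformly_continuous continuous_on_subset[OF continuous_K]) auto
    moreover have "e / (2 * ?m) > 0" using e m by simp
    ultimately obtain d where d: "d > 0" "\<And>s t. s \<in> cball 0 (2 * R) \<Longrightarrow> t \<in> cball 0 (2 * R) \<Longrightarrow>
        dist t s < d \<Longrightarrow> dist (K t) (K s) < e / (2 * ?m)"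
      unfolding uniformly_continuous_on_def by metis
    have "norm (fn (T (v n)) x - fn (T (v n)) y) < e" if y: "y \<in> ?S" "norm (x - y) < d" for n y
    proof -
      have k: "\<bar>K (x - z) - K (y - z)\<bar> \<le> e / (2 * ?m)" if z: "z \<in> A" for z
      proof -
        have "norm z \<le> R" using R z by auto
        then have "norm (x - z) \<le> 2 * R" "norm (y - z) \<le> 2 * R"
          using x y norm_triangle_ineq4[of x z] norm_triangle_ineq4[of y z] by auto
        moreover have "dist (x - z) (y - z) < d"
          using y by (simp add: dist_norm)
        ultimately have "dist (K (x - z)) (K (y - z)) < e / (2 * ?m)"
          by (intro d(2)) auto
        then show ?thesis by (simp add: dist_real_def)
      qed
      have eq: "indicator A z * (K (x - z) - K (y - z)) * fn (v n) z =
          indicator A z * K (x - z) * fn (v n) z - indicator A z * K (y - z) * fn (v n) z" for z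
        by (simp add: algebra_simps)
      have "fn (T (v n)) x - fn (T (v n)) y = (LINT z|lborel. indicator A z * (K (x - z) - K (y - z)) * fn (v n) z)"
        unfolding fn_T eq by (rule Bochner_Integration.integral_diff[symmetric, OF kernel_integrable kernel_integrable])
      also have "\<bar>\<dots>\<bar> \<le> e / (2 * ?m) * (measure lborel A + ip (v n) (v n))"
      proof (rule kernel_diff_bound[OF k])
        show "integrable lborel (\<lambda>z. indicator A z * (K (x - z) - K (y - z)) * fn (v n) z)"
          unfolding eq by (intro Bochner_Integration.integrable_diff kernel_integrable)
      qed (use e m in auto)
      also have "\<dots> \<le> e / (2 * ?m) * ?m"
        using v[of n] e m by (intro mult_left_mono) auto
      also have "\<dots> < e"
        by (rule half[OF e m])
      finally show ?thesis by simp
    qed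
    then show ?thesis using d(1) by blast
  qed
  obtain g r where g: "continuous_on ?S g" and r: "strict_mono (r :: nat \<Rightarrow> nat)"
    and conv: "\<And>e. 0 < e \<Longrightarrow> \<exists>N. \<forall>n x. n \<ge> N \<and> x \<in> ?S \<longrightarrow> norm (fn (T (v (r n))) x - g x) < e"
    using Arzela_Ascoli[OF compact_cball, of 0 R "\<lambda>n. fn (T (v n))" "C * ?m", OF bd equi] by metis
  \<comment> \<open>The limit exists on the ball only; extension by 0 makes it a bounded Borel
    function without changing it on \<open>A\<close>.\<close>
  define u where "u = Bfun (\<lambda>x. indicator ?S x * g x)"
  have "compact (g ` ?S)"
    by (intro compact_continuous_image g compact_cball)
  then obtain G where G: "\<And>x. x \<in> ?S \<Longrightarrow> \<bar>g x\<bar> \<le> G"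
    using compact_imp_bounded bounded_iff by (metis imageI real_norm_def)
  have u: "fn u x = indicator ?S x * g x" for x
  proof -
    have "(\<lambda>x. indicator ?S x * g x) = (\<lambda>x. if x \<in> ?S then g x else 0)"
      by (auto simp: indicator_def)
    moreover have "(\<lambda>x. if x \<in> ?S then g x else 0) \<in> borel_measurable borel"
      by (intro borel_measurable_continuous_on_if g continuous_on_const) auto
    ultimately have "(\<lambda>x. indicator ?S x * g x) \<in> borel_measurable borel" by simp
    moreover have "\<bar>indicator ?S x * g x\<bar> \<le> max 0 G" for x
      using G[of x] by (auto simp: indicator_def)
    ultimately show ?thesis
      unfolding u_def by (subst fn_Bfun) auto
  qed
  have "(\<lambda>n. ip (T (v (r n)) - u) (T (v (r n)) - u)) \<longlonglongrightarrow> 0"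
  proof (rule LIMSEQ_I)
    fix e :: real assume e: "0 < e"
    define d where "d = sqrt (e / (2 * ?m))"
    have d: "d > 0" "d\<^sup>2 = e / (2 * ?m)"
      using e m by (auto simp: d_def)
    obtain M where M: "\<And>n x. n \<ge> M \<Longrightarrow> x \<in> ?S \<Longrightarrow> norm (fn (T (v (r n))) x - g x) < d"
      using conv[OF d(1)] by blast
    have "norm (ip (T (v (r n)) - u) (T (v (r n)) - u) - 0) < e" if n: "n \<ge> M" for n
    proof -
      let ?f = "T (v (r n)) - u"
      have "0 \<le> ip ?f ?f"
        unfolding ip_def by (intro Bochner_Integration.integral_nonneg) auto
      have iA: "integrable lborel (indicator A :: 'a \<Rightarrow> real)"
        using integrable_A[of "\<lambda>_. 1" 1] by simp
      have "ip ?f ?f \<le> (LINT x|lborel. d\<^sup>2 * indicator A x)"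
        unfolding ip_def
      proof (rule integral_mono[OF integrable_A_mult integrable_mult_right[OF iA]])
        fix x
        show "indicator A x * (fn ?f x * fn ?f x) \<le> d\<^sup>2 * indicator A x"
        proof (cases "x \<in> A")
          case True
          then have x: "x \<in> ?S" using R by auto
          have "\<bar>fn ?f x\<bar> \<le> d"
            using M[OF n x] x by (simp add: fn_diff u)
          then have "\<bar>fn ?f x\<bar>\<^sup>2 \<le> d\<^sup>2"
            by (rule power_mono) simp
          then show ?thesis using True by (simp add: power2_eq_square)
        qed simp
      qed
      also have "\<dots> = e / (2 * ?m) * measure lborel A"
        using iA by (simp add: d)
      also have "\<dots> \<le> e / (2 * ?m) * ?m"
        using e m by (intro mult_left_mono) auto
      also have "\<dots> < e"
        by (rule half[OF e m])
      finally show ?thesis using \<open>0 \<le> ip ?f ?f\<close> by simp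
    qed
    then show "\<exists>M. \<forall>n\<ge>M. norm (ip (T (v (r n)) - u) (T (v (r n)) - u) - 0) < e" by blast
  qed
  then show ?thesis using r by blast
qed

sublocale compact_symmetric ip T
proof
  show "ip (f + g) h = ip f h + ip g h" for f g h
    unfolding ip_def fn_add distrib_right distrib_left
    by (rule Bochner_Integration.integral_add[OF integrable_A_mult integrable_A_mult])
  show "ip (r *\<^sub>R f) h = r * ip f h" for r f h
    unfolding ip_def by (simp add: fn_scale mult_ac flip: integral_mult_right_zero)
  show "ip f g = ip g f" for f g
    by (simp add: ip_def mult.commute)
  then show "ip (T f) g = ip f (T g)" for f g
    using T_sym[of f g] by simp
  show "0 \<le> ip f f" for f
    unfolding ip_def by (intro Bochner_Integration.integral_nonneg) auto
  have *: "indicator A y * K (x - y) * (fn f y + fn g y) = indicator A y * K (x - y) * fn f y + indicator A y * K (x - y) * fn g y" for f g x y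
    by (simp add: algebra_simps)
  show "T (f + g) = T f + T g" for f g
    by (rule bfun_eqI)
       (simp only: fn_T fn_add * Bochner_Integration.integral_add[OF kernel_integrable kernel_integrable])
  show "T (r *\<^sub>R f) = r *\<^sub>R T f" for r f
    by (rule bfun_eqI) (simp add: fn_T fn_scale mult_ac flip: integral_mult_right_zero)
  show "ip (T f) (T f) \<le> ip (T f) f" for f
  proof -
    have "0 \<le> (LINT x|lborel. indicator (- A) x * (fn (T f) x)\<^sup>2)"
      by (intro Bochner_Integration.integral_nonneg) auto
    then show ?thesis using ip_T_minus[of f] by linarith
  qed
qed (rule T_compact)

end

section \<open>From eigenvectors of the kernel operator to the eigenspaces in
  \<open>L2\<close>\<close>

context concentration
begin

text \<open>An eigenvector for \<open>ip\<close> may be discontinuous everywhere, so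
  \<open>band_projection_eq\<close> does not apply to it. On \<open>A\<close> it agrees almost
  everywhere with \<open>T f / \<mu>\<close>, and \<open>T f\<close> is continuous. The cut version
  \<open>\<phi>\<close> is thus continuous off the boundary and has the Fourier integral of
  \<open>cut f\<close>, so its band projection is \<open>T f\<close>, which on \<open>A\<close> is
  \<open>\<mu>\<close> times \<open>\<phi>\<close>.\<close>

lemma
  assumes \<mu>: "\<mu> \<noteq> 0" and f: "N (T f - \<mu> *\<^sub>R f) = 0"
  defines "\<phi> \<equiv> \<lambda>x. complex_of_real (indicator A x * (fn (T f) x / \<mu>))"
  shows eigenvector_AE_eq: "AE x in lborel. \<phi> x = cut f x"
    and eigenvector_in_eigenspace: "\<phi> \<in> eigenspace A B \<mu>"
proof -
  let ?d = "T f - \<mu> *\<^sub>R f"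
  have "ip ?d ?d = 0"
    using f N_square[of ?d] by simp
  then have "AE x in lborel. indicator A x * (fn ?d x * fn ?d x) = 0"
    unfolding ip_def using integral_nonneg_eq_0_iff_AE[OF integrable_A_mult[of ?d ?d]] by simp
  then show eq: "AE x in lborel. \<phi> x = cut f x"
  proof eventually_elim
    case (elim x)
    then show ?case
      using \<mu> by (cases "x \<in> A") (auto simp: \<phi>_def cut_def fn_diff fn_scale)
  qed
  have \<phi>_meas [measurable]: "\<phi> \<in> borel_measurable borel"
    unfolding \<phi>_def by measurable
  obtain C where C: "\<And>x. \<bar>fn (T f) x\<bar> \<le> C" using fn_bounded by metis
  have \<phi>_bound: "cmod (\<phi> x) \<le> C / \<bar>\<mu>\<bar>" for x
    using C[of x] order_trans[OF abs_ge_zero C[of x]]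
    by (auto simp: \<phi>_def indicator_def norm_divide intro: divide_right_mono)
  obtain R where R: "A \<subseteq> cball 0 R"
    using A(1) by (auto simp: bounded_iff subset_iff)
  have \<phi>_supp: "\<phi> x = 0" if "x \<notin> cball 0 R" for x
    using that R by (auto simp: \<phi>_def indicator_def)
  have \<phi>_eq: "\<phi> = (\<lambda>x. indicator A x * complex_of_real (fn (T f) x / \<mu>))"
    by (auto simp: \<phi>_def indicator_def)
  have \<phi>_cont: "AE x in lborel. isCont \<phi> x"
    using AE_notin_frontier_convex[OF A(2)] unfolding \<phi>_eq
  proof eventually_elim
    case (elim x)
    have "isCont (fn (T f)) x"
      using continuous_T by (auto simp: continuous_on_eq_continuous_at)
    then have "isCont (\<lambda>x. complex_of_real (fn (T f) x / \<mu>)) x"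
      using \<mu> by (intro continuous_intros) auto
    then show ?case by (rule isCont_indicator_mult[OF elim])
  qed
  have \<phi>_int: "integrable lborel \<phi>"
    by (rule integrable_bounded_on_bounded_set[OF \<phi>_meas bounded_cball \<phi>_bound \<phi>_supp])
  have FT: "fourier_integral \<phi> = fourier_integral (cut f)"
  proof
    fix \<xi>
    show "fourier_integral \<phi> \<xi> = fourier_integral (cut f) \<xi>"
      unfolding fourier_integral_def
    proof (rule integral_cong_AE)
      show "AE x in lborel. \<phi> x * exp (- 2 * pi * \<i> * of_real (x \<bullet> \<xi>)) = cut f x * exp (- 2 * pi * \<i> * of_real (x \<bullet> \<xi>))"
        using eq by eventually_elim simp
    qed auto
  qed
  have sp: "space_projection A \<phi> = \<phi>"
    by (auto simp: space_projection_def \<phi>_def indicator_def)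
  have "AE x in lborel. band_projection B \<phi> x = fourier_integral (spec f) (- x)"
    using band_projection_eq[OF \<phi>_meas \<phi>_bound \<phi>_supp \<phi>_cont B] unfolding FT spec_def[abs_def] .
  then have "AE x in lborel. concentration_operator A B \<phi> x = of_real \<mu> * \<phi> x"
  proof eventually_elim
    case (elim x)
    then show ?case
      using \<mu> by (simp add: concentration_operator_def sp space_projection_def[of A "band_projection B \<phi>"]
          fn_T_eq[symmetric]) (simp add: \<phi>_def indicator_def)
  qed
  then show "\<phi> \<in> eigenspace A B \<mu>"
    using L2_bounded[OF \<phi>_int \<phi>_bound] by (simp add: eigenspace_def)
qed

end

section \<open>Cubes and product structure\<close>

lemma bij_betw_axis_Basis: "bij_betw (\<lambda>i. axis i 1) UNIV (Basis :: (real ^ 'n) set)"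
  by (auto simp: bij_betw_def inj_on_def Basis_vec_def axis_eq_axis)

lemma
  fixes f :: "'n::finite \<Rightarrow> real \<Rightarrow> 'b::{real_normed_field,banach,second_countable_topology}"
  assumes f: "\<And>i. integrable lborel (f i)"
  shows integrable_prod_vec: "integrable lborel (\<lambda>x::real ^ 'n. \<Prod>i\<in>UNIV. f i (x $ i))"
    and integral_prod_vec:
      "(LINT x|lborel. (\<Prod>i\<in>UNIV. f i ((x::real ^ 'n) $ i))) = (\<Prod>i\<in>UNIV. (LINT t|lborel. f i t))"
proof -
  define g where "g b = f (the_inv_into UNIV (\<lambda>i. axis i 1) (b::real ^ 'n))" for b
  have g: "g (axis i 1) = f i" for i
    unfolding g_def using bij_betw_axis_Basis
    by (subst the_inv_into_f_f) (auto simp: bij_betw_def)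
  have gi: "integrable lborel (g b)" for b
    by (simp add: g_def f)
  have 1: "(\<Prod>b\<in>Basis. g b (x \<bullet> b)) = (\<Prod>i\<in>UNIV. f i (x $ i))" for x :: "real ^ 'n"
    by (subst prod.reindex_bij_betw[OF bij_betw_axis_Basis, symmetric]) (simp add: g inner_axis)
  have 2: "(\<Prod>b\<in>Basis. (LINT t|lborel. g b t)) = (\<Prod>i\<in>UNIV. (LINT t|lborel. f i t))"
    by (subst prod.reindex_bij_betw[OF bij_betw_axis_Basis, symmetric]) (simp add: g)
  show "integrable lborel (\<lambda>x::real ^ 'n. \<Prod>i\<in>UNIV. f i (x $ i))"
    using integrable_prod_Basis[of g] gi by (simp add: 1)
  show "(LINT x|lborel. (\<Prod>i\<in>UNIV. f i ((x::real ^ 'n) $ i))) = (\<Prod>i\<in>UNIV. (LINT t|lborel. f i t))"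
    using integral_prod_Basis[of g] gi by (simp add: 1 2)
qed

lemma space_cube_eq_box: "space_cube c = box 0 (\<chi> i. c)"
  by (auto simp: space_cube_def mem_box_cart)

lemma frequency_cube_eq_box: "frequency_cube = box (\<chi> i. - 1/2) (\<chi> i. 1/2)"
  by (auto simp: frequency_cube_def mem_box_cart)

lemma concentration_cubes: "concentration (space_cube c) (frequency_cube :: (real ^ 'n) set)"
proof
  fix \<xi> :: "real ^ 'n"
  show "- \<xi> \<in> frequency_cube \<longleftrightarrow> \<xi> \<in> frequency_cube"
    unfolding frequency_cube_def mem_Collect_eq by (intro iff_allI) auto
qed (auto simp: space_cube_eq_box frequency_cube_eq_box)

abbreviation unit_band :: "real set" where
  "unit_band \<equiv> {- (1/2)<..<1/2}"

lemma concentration_intervals: "concentration {0<..<s} unit_band"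
  by standard auto

text \<open>The threshold 1/6 keeps the phase within \<open>pi / 3\<close>, where the cosine is at
  least 1/2.\<close>

lemma Re_fourier_integral_indicator_ge:
  fixes S :: "'a::euclidean_space set"
  assumes S: "S \<in> sets borel" "bounded S" and x: "\<And>x. x \<in> S \<Longrightarrow> \<bar>x \<bullet> \<xi>\<bar> \<le> 1/6"
  shows "Re (fourier_integral (indicator S) \<xi>) \<ge> measure lborel S / 2"
proof -
  note [measurable] = S(1)
  have i: "integrable lborel (indicator S :: 'a \<Rightarrow> complex)"
    by (rule integrable_bounded_on_bounded_set[OF _ S(2), of _ 1]) (auto simp: indicator_def)
  have i': "integrable lborel (indicator S :: 'a \<Rightarrow> real)"
    by (rule integrable_bounded_on_bounded_set[OF _ S(2), of _ 1]) (auto simp: indicator_def)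
  have "Re (fourier_integral (indicator S) \<xi>) =
      (LINT x|lborel. Re (indicator S x * exp (- 2 * pi * \<i> * of_real (x \<bullet> \<xi>))))"
    unfolding fourier_integral_def by (rule integral_Re[OF integrable_mult_fourier_kernel[OF i], symmetric])
  also have "\<dots> \<ge> (LINT x|lborel. indicator S x * (1/2))"
  proof (rule integral_mono[OF integrable_mult_left[OF i'] integrable_Re[OF integrable_mult_fourier_kernel[OF i]]])
    fix y :: 'a
    show "indicator S y * (1/2) \<le> Re (indicator S y * exp (- 2 * pi * \<i> * of_real (y \<bullet> \<xi>)))"
    proof (cases "y \<in> S")
      case True
      have "\<bar>2 * pi * (y \<bullet> \<xi>)\<bar> = 2 * pi * \<bar>y \<bullet> \<xi>\<bar>" by (simp add: abs_mult)
      also have "\<dots> \<le> 2 * pi * (1/6)"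
        by (rule mult_left_mono[OF x[OF True]]) simp
      finally have "\<bar>2 * pi * (y \<bullet> \<xi>)\<bar> \<le> pi / 3" by simp
      then have "cos (pi / 3) \<le> cos \<bar>2 * pi * (y \<bullet> \<xi>)\<bar>"
        by (intro cos_monotone_0_pi_le) auto
      then have "1/2 \<le> cos (2 * pi * (y \<bullet> \<xi>))"
        by (simp add: cos_60)
      then show ?thesis
        using True by (simp add: Re_exp)
    qed simp
  qed
  also have "(LINT x|lborel. indicator S x * (1/2)) = measure lborel S / 2"
    using i' by simp
  finally show ?thesis .
qed

section \<open>The one-dimensional kernel and the projected interval\<close>

text \<open>This is \<open>sin (pi t) / (pi t)\<close>; the values computed are those at integers,
  and near 0 a lower bound is derived.\<close>

abbreviation K1 :: "real \<Rightarrow> real" where "K1 \<equiv> concentration.K unit_band"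

lemma K1_eq: "of_real (K1 t) = fourier_integral (indicator unit_band) t"
  by (rule concentration.K_eq[OF concentration_intervals])

lemma K_frequency_cube: "concentration.K frequency_cube (t::real ^ 'n) = (\<Prod>i\<in>UNIV. K1 (t $ i))"
proof -
  have i: "integrable lborel (indicator unit_band :: real \<Rightarrow> complex)"
    by (rule concentration.integrable_indicator_B[OF concentration_intervals])
  have eq: "indicator frequency_cube \<xi> * exp (- 2 * pi * \<i> * of_real (\<xi> \<bullet> t)) =
      (\<Prod>j\<in>UNIV. indicator unit_band (\<xi> $ j) * exp (- 2 * pi * \<i> * of_real (\<xi> $ j \<bullet> t $ j)))" for \<xi> :: "real ^ 'n"
  proof -
    have "indicator frequency_cube \<xi> = (\<Prod>j\<in>UNIV. indicator unit_band (\<xi> $ j) :: complex)"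
      by (auto simp: frequency_cube_def indicator_def)
    moreover have "exp (- 2 * pi * \<i> * of_real (\<xi> \<bullet> t)) = (\<Prod>j\<in>UNIV. exp (- 2 * pi * \<i> * of_real (\<xi> $ j \<bullet> t $ j)))"
      unfolding exp_sum[OF finite, symmetric] inner_vec_def of_real_sum sum_distrib_left ..
    ultimately show ?thesis by (simp only: prod.distrib)
  qed
  have "complex_of_real (concentration.K frequency_cube t) = fourier_integral (indicator frequency_cube) t"
    by (rule concentration.K_eq[OF concentration_cubes])
  also have "\<dots> = (\<Prod>j\<in>UNIV. fourier_integral (indicator unit_band) (t $ j))"
    unfolding fourier_integral_def eq by (rule integral_prod_vec[OF integrable_mult_fourier_kernel[OF i]])
  also have "\<dots> = of_real (\<Prod>j\<in>UNIV. K1 (t $ j))"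
    by (simp only: of_real_prod K1_eq)
  finally show ?thesis
    by (simp only: of_real_eq_iff)
qed

text \<open>Orthonormality on the unit band of exponentials with integer frequencies. For nonzero
  \<open>m\<close> the antiderivative takes equal values at both end points, since the exponents
  there differ by a multiple of \<open>2 pi i\<close>.\<close>

lemma K1_int: "K1 (of_int m) = (if m = 0 then 1 else 0)"
proof (cases "m = 0")
  case True
  have "complex_of_real (K1 0) = (LINT x|lborel. complex_of_real (indicator unit_band x))"
    unfolding K1_eq fourier_integral_def by (intro Bochner_Integration.integral_cong) (auto simp: indicator_def)
  also have "\<dots> = 1"
    unfolding integral_complex_of_real by simp
  finally show ?thesis using True by simp
next
  case False
  let ?c = "- 2 * pi * \<i> * of_int m :: complex"
  have c: "?c \<noteq> 0" using False by simp
  let ?F = "\<lambda>\<xi>::real. exp (?c * of_real \<xi>) / ?c"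
  have "has_bochner_integral lborel (\<lambda>\<xi>. indicator {- 1/2 .. 1/2} \<xi> *\<^sub>R exp (?c * of_real \<xi>)) (?F (1/2) - ?F (- 1/2))"
  proof (rule has_bochner_integral_FTC_Icc)
    fix \<xi> :: real assume "- 1/2 \<le> \<xi>" "\<xi> \<le> 1/2"
    have "((\<lambda>z. exp (?c * z) / ?c) has_field_derivative exp (?c * of_real \<xi>)) (at (of_real \<xi>))"
      using c by (auto intro!: derivative_eq_intros)
    then have "(?F has_vector_derivative exp (?c * of_real \<xi>)) (at \<xi>)"
      by (rule has_vector_derivative_real_field)
    then show "(?F has_vector_derivative exp (?c * of_real \<xi>)) (at \<xi> within {- 1/2..1/2})"
      by (rule has_vector_derivative_at_within)
  qed (auto intro!: continuous_intros)
  moreover have "exp (?c * of_real (1/2)) = exp (?c * of_real (- 1/2))"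
  proof -
    have "exp (?c * of_real (- 1/2) - ?c * of_real (1/2)) = exp (2 * of_int m * pi * \<i>)"
      by (intro arg_cong[where f=exp]) (simp add: algebra_simps)
    also have "\<dots> = 1" by (rule exp_integer_2pi) simp
    finally have 1: "exp (?c * of_real (- 1/2) - ?c * of_real (1/2)) = 1" .
    have "exp b = exp a" if "exp (a - b) = 1" for a b :: complex
      using that by (simp add: exp_diff)
    from this[OF 1] show ?thesis .
  qed
  ultimately have "(LINT \<xi>|lborel. indicator {- 1/2 .. 1/2} \<xi> *\<^sub>R exp (?c * of_real \<xi>)) = 0"
    by (simp only: has_bochner_integral_integral_eq diff_self)
  moreover have "(LINT \<xi>|lborel. indicator {- 1/2 .. 1/2} \<xi> *\<^sub>R exp (?c * of_real \<xi>)) =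
      fourier_integral (indicator unit_band) (of_int m)"
    unfolding fourier_integral_def
  proof (rule integral_cong_AE)
    have "AE \<xi> in lborel. \<xi> \<noteq> (1/2::real)" "AE \<xi> in lborel. \<xi> \<noteq> (- 1/2::real)"
      by (rule AE_lborel_singleton)+
    then show "AE \<xi> in lborel. indicator {- 1/2 .. 1/2} \<xi> *\<^sub>R exp (?c * of_real \<xi>) =
        indicator unit_band \<xi> * exp (- 2 * pi * \<i> * of_real (\<xi> \<bullet> of_int m))"
      by eventually_elim (auto simp: indicator_def mult_ac)
  qed auto
  ultimately have "complex_of_real (K1 (of_int m)) = 0"
    by (simp only: K1_eq)
  then show ?thesis using False by simp
qed

lemma K1_lower:
  assumes "\<bar>t\<bar> \<le> 1/3"
  shows "K1 t \<ge> 1/2"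
proof -
  have "K1 t = Re (fourier_integral (indicator unit_band) t)"
    by (rule concentration.K_def[OF concentration_intervals])
  moreover have "measure lborel unit_band / 2 \<le> Re (fourier_integral (indicator unit_band) t)"
  proof (rule Re_fourier_integral_indicator_ge)
    fix x :: real assume "x \<in> unit_band"
    then have "\<bar>x\<bar> \<le> 1/2" by auto
    then have "\<bar>x\<bar> * \<bar>t\<bar> \<le> 1/2 * (1/3)" using assms by (intro mult_mono) auto
    then show "\<bar>x \<bullet> t\<bar> \<le> 1/6" by (simp add: abs_mult)
  qed auto
  ultimately show ?thesis by simp
qed

text \<open>The one-dimensional band projection of the indicator of the interval from 0 to
  \<open>s\<close>. Its translates are the factors of the projected cell indicators.\<close>

definition profile :: "real \<Rightarrow> real \<Rightarrow> real" where
  "profile s u = (LINT t|lborel. indicator {0<..<s} t * K1 (u - t))"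

text \<open>Square-integrability is inherited from \<open>T\<close> applied to the constant 1 on the
  interval. For \<open>u\<close> between -1/6 and 0 and \<open>t\<close> between 0 and
  \<open>s \<le> 1/6\<close>, the argument \<open>u - t\<close> is within 1/3 of 0, so the profile
  is at least \<open>s / 2\<close> there: some energy leaks to the left of the interval.\<close>

lemma
  assumes s: "0 < s" "s \<le> 1/6"
  shows profile_measurable [measurable]: "profile s \<in> borel_measurable borel"
    and integrable_profile_square: "integrable lborel (\<lambda>u. (profile s u)\<^sup>2)"
    and profile_left_pos: "(LINT u|lborel. indicator {..<0} u * (profile s u)\<^sup>2) > 0"
proof -
  interpret concentration "{0<..<s}" unit_band by (rule concentration_intervals)
  have 1: "fn (Bfun (\<lambda>_. 1)) = (\<lambda>_::real. 1)"
    by (rule fn_Bfun[of _ 1]) auto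
  have eq: "profile s = fn (T (Bfun (\<lambda>_. 1)))"
    by (rule ext) (simp only: profile_def fn_T 1 mult_1_right)
  show [measurable]: "profile s \<in> borel_measurable borel"
    by (simp add: eq)
  show sq: "integrable lborel (\<lambda>u. (profile s u)\<^sup>2)"
    unfolding eq by (rule integrable_T_square)
  have low: "s / 2 \<le> profile s u" if u: "- 1/6 < u" "u < 0" for u
  proof -
    have i: "integrable lborel (\<lambda>t. indicator {0<..<s} t * K1 (u - t))"
      using kernel_integrable[of u "Bfun (\<lambda>_. 1)"] by (simp add: 1)
    have "(LINT t|lborel. indicator {0<..<s} t * (1/2)) \<le> profile s u"
      unfolding profile_def
    proof (rule integral_mono[OF _ i])
      show "integrable lborel (\<lambda>t. indicator {0<..<s} t * (1/2) :: real)"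
        using s by (intro integrable_mult_left integrable_real_indicator) auto
      show "indicator {0<..<s} t * (1/2) \<le> indicator {0<..<s} t * K1 (u - t)" for t
        using K1_lower[of "u - t"] u s by (auto simp: indicator_def)
    qed
    then show ?thesis using s by simp
  qed
  have "(LINT u|lborel. indicator {- 1/6<..<0::real} u * (s / 2)\<^sup>2) \<le> (LINT u|lborel. indicator {..<0} u * (profile s u)\<^sup>2)"
  proof (rule integral_mono)
    show "integrable lborel (\<lambda>u. indicator {..<0} u * (profile s u)\<^sup>2)"
      by (rule Bochner_Integration.integrable_bound[OF sq]) (auto simp: indicator_def)
    show "indicator {- 1/6<..<0::real} u * (s / 2)\<^sup>2 \<le> indicator {..<0} u * (profile s u)\<^sup>2" for u
      using low[of u] s by (auto simp: indicator_def intro!: power_mono)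
  qed auto
  moreover have "(LINT u|lborel. indicator {- 1/6<..<0::real} u * (s / 2)\<^sup>2) > (0::real)"
    using s by simp
  ultimately show "(LINT u|lborel. indicator {..<0} u * (profile s u)\<^sup>2) > 0"
    by linarith
qed

section \<open>Trial functions at a face of the cube\<close>

lemma (in compact_symmetric) T_sum: "finite I \<Longrightarrow> T (\<Sum>k\<in>I. f k) = (\<Sum>k\<in>I. T (f k))"
proof (induction I rule: finite_induct)
  case empty
  show ?case using T_scale[of 0 0] by simp
qed (simp add: T_add)

lemma integrable_interval_K1: "integrable lborel (\<lambda>t. indicator {p<..<q} t * K1 (u - t))"
proof -
  interpret concentration "{0<..<1}" unit_band by (rule concentration_intervals)
  obtain C where C: "\<And>t. \<bar>K1 t\<bar> \<le> C" using K_bounded by metis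
  show ?thesis
    by (rule integrable_bounded_on_bounded_set[where A="{p<..<q}" and C=C])
       (use C order_trans[OF abs_ge_zero C] in \<open>auto simp: indicator_def\<close>)
qed

lemma integral_interval_K1: "(LINT t|lborel. indicator {p<..<p + s} t * K1 (u - t)) = profile s (u - p)"
proof -
  interpret concentration "{0<..<1}" unit_band by (rule concentration_intervals)
  have "(LINT t|lborel. indicator {p<..<p + s} t * K1 (u - t)) =
      \<bar>1\<bar> ^ DIM(real) *\<^sub>R (LINT t|lborel. indicator {p<..<p + s} (p + 1 *\<^sub>R t) * K1 (u - (p + 1 *\<^sub>R t)))"
    by (rule integral_lborel_affine[where f="\<lambda>t. indicator {p<..<p + s} t * K1 (u - t)" and t=p and c=1]) auto
  also have "\<dots> = profile s (u - p)"
    unfolding profile_def by (simp add: indicator_def algebra_simps cong: if_cong)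
  finally show ?thesis .
qed

lemma integrable_profile_mult:
  assumes s: "0 < s" "s \<le> 1/6"
  shows "integrable lborel (\<lambda>u. profile s (u - p) * profile s (u - q))"
proof -
  note [measurable] = profile_measurable[OF s]
  have "integrable lborel (\<lambda>u. (profile s (- p + 1 *\<^sub>R u))\<^sup>2)" for p
    by (subst integrable_lborel_affine[of 1 "\<lambda>u. (profile s u)\<^sup>2" "- p"]) (auto intro: integrable_profile_square[OF s])
  then have sq: "integrable lborel (\<lambda>u. (profile s (u - p))\<^sup>2)" for p
    by simp
  have le: "\<bar>a * b\<bar> \<le> a\<^sup>2 + b\<^sup>2" for a b :: real
    using cmod_mult_le_squares[of "of_real a" "of_real b"] by (simp add: norm_mult abs_mult)
  show ?thesis
    by (rule Bochner_Integration.integrable_bound[OF Bochner_Integration.integrable_add[OF sq[of p] sq[of q]]])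
       (auto intro!: AE_I2 order_trans[OF le])
qed

text \<open>The quotient is the share of the profile's energy left of 0. The factor
  \<open>s ^ n / 4\<close> is the square of \<open>s ^ n / 2\<close>, the lower bound for the
  transform of a cell, divided by \<open>s ^ n\<close>, the squared norm of its indicator.\<close>

definition face_const :: "real \<Rightarrow> nat \<Rightarrow> real" where
  "face_const s n = (LINT u|lborel. indicator {..<0} u * (profile s u)\<^sup>2) / (LINT u|lborel. (profile s u)\<^sup>2) * (s ^ n / 4)"

text \<open>The bound 1/6 on \<open>s\<close> is the one of the profile estimate. The bound on
  \<open>s * CARD('n)\<close> keeps \<open>x \<bullet> \<xi>\<close> within 1/6 for \<open>x\<close>
  in the cell at the origin and \<open>\<xi>\<close> in the band. The inequality
  \<open>k $ i + 1 \<le> c\<close> leaves room for a cell of side \<open>s < 1\<close> inside the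
  cube.\<close>

locale face_cells =
  fixes c s :: real and j :: "'n::finite" and I :: "(real ^ 'n) set"
  assumes s: "0 < s" "s \<le> 1/6" "s * real CARD('n) \<le> 1/3"
    and I: "finite I" "\<And>k i. k \<in> I \<Longrightarrow> k $ i \<in> \<int>" "\<And>k. k \<in> I \<Longrightarrow> k $ j = 0"
      "\<And>k i. k \<in> I \<Longrightarrow> 0 \<le> k $ i" "\<And>k i. k \<in> I \<Longrightarrow> k $ i + 1 \<le> c"
begin

sublocale concentration "space_cube c" "frequency_cube :: (real ^ 'n) set"
  by (rule concentration_cubes)

abbreviation band :: "(real ^ 'n) set" where "band \<equiv> frequency_cube"

lemma borel_measurable_profile [measurable]: "profile s \<in> borel_measurable borel"
  by (rule profile_measurable[OF s(1,2)])

definition cell :: "real ^ 'n \<Rightarrow> (real ^ 'n) set" where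
  "cell k = {x. \<forall>i. k $ i < x $ i \<and> x $ i < k $ i + s}"

definition w :: "real ^ 'n \<Rightarrow> (real ^ 'n) bfun" where
  "w k = Bfun (indicator (cell k))"

definition comb :: "(real ^ 'n \<Rightarrow> real) \<Rightarrow> (real ^ 'n) bfun" where
  "comb a = (\<Sum>k\<in>I. a k *\<^sub>R w k)"

lemma cell_eq_box: "cell k = box k (\<chi> i. k $ i + s)"
  by (auto simp: cell_def mem_box_cart)

lemma cell_sets [measurable]: "cell k \<in> sets borel"
  by (simp add: cell_eq_box)

lemma bounded_cell: "bounded (cell k)"
  by (simp add: cell_eq_box)

lemma fn_w: "fn (w k) = indicator (cell k)"
  unfolding w_def by (rule fn_Bfun[of _ 1]) auto

lemma fn_comb: "fn (comb a) x = (\<Sum>k\<in>I. a k * indicator (cell k) x)"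
  by (simp add: comb_def fn_sum[OF I(1)] fn_scale fn_w)

lemma cell_subset: "k \<in> I \<Longrightarrow> cell k \<subseteq> space_cube c"
proof
  fix x assume k: "k \<in> I" and x: "x \<in> cell k"
  show "x \<in> space_cube c"
    unfolding space_cube_def mem_Collect_eq
  proof
    fix i
    have "k $ i < x $ i" "x $ i < k $ i + s" using x by (auto simp: cell_def)
    then show "0 < x $ i \<and> x $ i < c"
      using I(4)[OF k, of i] I(5)[OF k, of i] s by linarith
  qed
qed

lemma Ints_close_eq: "(a::real) \<in> \<int> \<Longrightarrow> b \<in> \<int> \<Longrightarrow> \<bar>a - b\<bar> < 1 \<Longrightarrow> a = b"
  by (metis Ints_diff Ints_nonzero_abs_less1 eq_iff_diff_eq_0)

lemma cell_disjoint:
  assumes k: "k \<in> I" "l \<in> I" and x: "x \<in> cell k" "x \<in> cell l"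
  shows "k = l"
  unfolding vec_eq_iff
proof
  fix i
  have "k $ i < x $ i" "x $ i < k $ i + s" "l $ i < x $ i" "x $ i < l $ i + s"
    using x by (auto simp: cell_def)
  then have "\<bar>k $ i - l $ i\<bar> < 1" using s by linarith
  then show "k $ i = l $ i" using I(2) k by (intro Ints_close_eq) auto
qed

lemma integral_cell: "(LINT x|lborel. indicator (cell k) x) = s ^ CARD('n)"
  and integrable_cell: "integrable lborel (indicator (cell k) :: real ^ 'n \<Rightarrow> real)"
proof -
  have eq: "indicator (cell k) x = (\<Prod>i\<in>UNIV. indicator {k $ i<..<k $ i + s} (x $ i) :: real)" for x
    by (auto simp: cell_def indicator_def)
  have i: "integrable lborel (indicator {k $ i<..<k $ i + s} :: real \<Rightarrow> real)" for i
    using s by (intro integrable_real_indicator) auto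
  show "integrable lborel (indicator (cell k) :: real ^ 'n \<Rightarrow> real)"
    unfolding eq[abs_def] by (rule integrable_prod_vec[OF i])
  have "(LINT x|lborel. indicator (cell k) x) = (\<Prod>i\<in>UNIV. (LINT t|lborel. indicator {k $ i<..<k $ i + s} t :: real))"
    unfolding eq by (rule integral_prod_vec[OF i])
  also have "\<dots> = s ^ CARD('n)"
    using s by simp
  finally show "(LINT x|lborel. indicator (cell k) x) = s ^ CARD('n)" .
qed

lemma fn_comb_square: "fn (comb a) x * fn (comb a) x = (\<Sum>k\<in>I. (a k)\<^sup>2 * indicator (cell k) x)"
proof (cases "\<exists>k\<in>I. x \<in> cell k")
  case True
  then obtain k0 where k0: "k0 \<in> I" "x \<in> cell k0" by blast
  have ind: "indicator (cell k) x = (if k = k0 then 1 else 0 :: real)" if "k \<in> I" for k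
  proof (cases "x \<in> cell k")
    case True
    then have "k = k0" using cell_disjoint[OF that k0(1) True k0(2)] by simp
    then show ?thesis using True by simp
  next
    case False
    then have "k \<noteq> k0" using k0(2) by metis
    then show ?thesis using False by simp
  qed
  have "(\<Sum>k\<in>I. b k * indicator (cell k) x) = b k0" for b :: "real ^ 'n \<Rightarrow> real"
  proof -
    have "(\<Sum>k\<in>I. b k * indicator (cell k) x) = (\<Sum>k\<in>I. if k = k0 then b k else 0)"
      by (intro sum.cong) (auto simp: ind)
    then show ?thesis using k0 I(1) by simp
  qed
  then show ?thesis by (simp add: fn_comb power2_eq_square)
next
  case False
  then show ?thesis by (simp add: fn_comb)
qed

lemma ip_comb: "ip (comb a) (comb a) = s ^ CARD('n) * (\<Sum>k\<in>I. (a k)\<^sup>2)"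
proof -
  have "ip (comb a) (comb a) = (LINT x|lborel. (\<Sum>k\<in>I. (a k)\<^sup>2 * indicator (cell k) x))"
    unfolding ip_def fn_comb_square
  proof (intro Bochner_Integration.integral_cong refl)
    fix x
    show "indicator (space_cube c) x * (\<Sum>k\<in>I. (a k)\<^sup>2 * indicator (cell k) x) = (\<Sum>k\<in>I. (a k)\<^sup>2 * indicator (cell k) x)"
      unfolding sum_distrib_left using cell_subset
      by (intro sum.cong) (auto simp: indicator_def)
  qed
  also have "\<dots> = (\<Sum>k\<in>I. LINT x|lborel. (a k)\<^sup>2 * indicator (cell k) x)"
    by (intro Bochner_Integration.integral_sum integrable_mult_right integrable_cell)
  also have "\<dots> = (\<Sum>k\<in>I. (a k)\<^sup>2 * s ^ CARD('n))"
    by (simp only: integral_mult_right_zero integral_cell)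
  finally show ?thesis
    unfolding sum_distrib_left by (simp only: mult.commute)
qed

lemma fn_T_w:
  assumes k: "k \<in> I"
  shows "fn (T (w k)) x = (\<Prod>i\<in>UNIV. profile s (x $ i - k $ i))"
proof -
  have "fn (T (w k)) x = (LINT y|lborel. (\<Prod>i\<in>UNIV. indicator {k $ i<..<k $ i + s} (y $ i) * K1 (x $ i - y $ i)))"
    unfolding fn_T
  proof (intro Bochner_Integration.integral_cong refl)
    fix y :: "real ^ 'n"
    have 1: "indicator (cell k) y = (\<Prod>i\<in>UNIV. indicator {k $ i<..<k $ i + s} (y $ i) :: real)"
      by (auto simp: cell_def indicator_def)
    have 2: "indicator (space_cube c) y * indicator (cell k) y = (indicator (cell k) y :: real)"
      using cell_subset[OF k] by (auto simp: indicator_def)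
    have "indicator (space_cube c) y * K (x - y) * fn (w k) y = (indicator (space_cube c) y * indicator (cell k) y) * K (x - y)"
      by (simp only: fn_w mult_ac)
    also have "\<dots> = indicator (cell k) y * K (x - y)"
      by (simp only: 2)
    also have "\<dots> = (\<Prod>i\<in>UNIV. indicator {k $ i<..<k $ i + s} (y $ i) * K1 (x $ i - y $ i))"
      by (simp only: 1 K_frequency_cube prod.distrib vector_minus_component)
    finally show "indicator (space_cube c) y * K (x - y) * fn (w k) y =
        (\<Prod>i\<in>UNIV. indicator {k $ i<..<k $ i + s} (y $ i) * K1 (x $ i - y $ i))" .
  qed
  also have "\<dots> = (\<Prod>i\<in>UNIV. profile s (x $ i - k $ i))"
    by (simp only: integral_prod_vec[OF integrable_interval_K1]
        integral_interval_K1)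
  finally show ?thesis .
qed

lemma fn_T_comb: "fn (T (comb a)) x = (\<Sum>k\<in>I. a k * (\<Prod>i\<in>UNIV. profile s (x $ i - k $ i)))"
  by (simp add: comb_def T_sum[OF I(1)] T_scale fn_sum[OF I(1)] fn_scale fn_T_w)

text \<open>The quadratic form in the coefficients that remains when the variable normal to the face
  has been integrated out. It is never evaluated, since it cancels when the energy of a slab is
  compared with the total energy.\<close>

definition cross :: "(real ^ 'n \<Rightarrow> real) \<Rightarrow> real" where
  "cross a = (\<Sum>k\<in>I. \<Sum>l\<in>I. a k * a l *
     (\<Prod>i\<in>UNIV - {j}. LINT u|lborel. profile s (u - k $ i) * profile s (u - l $ i)))"

text \<open>All cells touch the face \<open>x $ j = 0\<close>, so the \<open>j\<close>-th variable splits off.\<close>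

lemma integral_T_comb_slab:
  assumes S [measurable]: "S \<in> sets borel"
  shows "(LINT x|lborel. indicator S (x $ j) * (fn (T (comb a)) x)\<^sup>2) =
     (LINT u|lborel. indicator S u * (profile s u)\<^sup>2) * cross a"
proof -
  define f where "f k l i u = (if i = j then indicator S u else 1) * (profile s (u - k $ i) * profile s (u - l $ i))"
    for k l :: "real ^ 'n" and i u
  have fi: "integrable lborel (f k l i)" for k l i
    by (rule Bochner_Integration.integrable_bound[OF integrable_profile_mult[OF s(1,2), of "k $ i" "l $ i"]])
       (auto simp: f_def[abs_def] indicator_def)
  have pf: "(\<Prod>i\<in>UNIV. f k l i (x $ i)) = indicator S (x $ j) *
      ((\<Prod>i\<in>UNIV. profile s (x $ i - k $ i)) * (\<Prod>i\<in>UNIV. profile s (x $ i - l $ i)))" for k l x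
  proof -
    have "(\<Prod>i\<in>UNIV. if i = j then indicator S (x $ i) else 1 :: real) = indicator S (x $ j)"
      by (simp add: prod.delta)
    then show ?thesis
      by (simp add: f_def prod.distrib)
  qed
  have "(LINT x|lborel. indicator S (x $ j) * (fn (T (comb a)) x)\<^sup>2) =
      (LINT x|lborel. (\<Sum>k\<in>I. \<Sum>l\<in>I. a k * a l * (\<Prod>i\<in>UNIV. f k l i (x $ i))))"
  proof (intro Bochner_Integration.integral_cong refl)
    fix x :: "real ^ 'n"
    have "(fn (T (comb a)) x)\<^sup>2 = (\<Sum>k\<in>I. \<Sum>l\<in>I. (a k * (\<Prod>i\<in>UNIV. profile s (x $ i - k $ i))) *
        (a l * (\<Prod>i\<in>UNIV. profile s (x $ i - l $ i))))"
      unfolding fn_T_comb power2_eq_square by (rule sum_product)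
    then show "indicator S (x $ j) * (fn (T (comb a)) x)\<^sup>2 = (\<Sum>k\<in>I. \<Sum>l\<in>I. a k * a l * (\<Prod>i\<in>UNIV. f k l i (x $ i)))"
      unfolding pf by (simp only: sum_distrib_left mult_ac)
  qed
  also have "\<dots> = (\<Sum>k\<in>I. \<Sum>l\<in>I. LINT x|lborel. a k * a l * (\<Prod>i\<in>UNIV. f k l i (x $ i)))"
    by (subst Bochner_Integration.integral_sum;
        (intro Bochner_Integration.integrable_sum integrable_mult_right integrable_prod_vec fi)?)
       (intro sum.cong refl Bochner_Integration.integral_sum integrable_mult_right integrable_prod_vec fi)
  also have "\<dots> = (\<Sum>k\<in>I. \<Sum>l\<in>I. a k * a l * ((LINT u|lborel. indicator S u * (profile s u)\<^sup>2) *
     (\<Prod>i\<in>UNIV - {j}. LINT u|lborel. profile s (u - k $ i) * profile s (u - l $ i))))"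
  proof (intro sum.cong refl)
    fix k l assume kl: "k \<in> I" "l \<in> I"
    have "(LINT x|lborel. a k * a l * (\<Prod>i\<in>UNIV. f k l i (x $ i))) = a k * a l * (\<Prod>i\<in>UNIV. LINT u|lborel. f k l i u)"
      by (simp only: integral_mult_right_zero integral_prod_vec[OF fi])
    also have "(\<Prod>i\<in>UNIV. LINT u|lborel. f k l i u) = (LINT u|lborel. f k l j u) * (\<Prod>i\<in>UNIV - {j}. LINT u|lborel. f k l i u)"
      by (rule prod.remove) auto
    \<comment> \<open>All points of \<open>I\<close> have \<open>j\<close>-th coordinate 0, so this
      factor is the same for every pair and can be taken out of the double sum.\<close>
    also have "(LINT u|lborel. f k l j u) = (LINT u|lborel. indicator S u * (profile s u)\<^sup>2)"
      by (simp add: f_def I(3)[OF kl(1)] I(3)[OF kl(2)] power2_eq_square)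
    also have "(\<Prod>i\<in>UNIV - {j}. LINT u|lborel. f k l i u) =
       (\<Prod>i\<in>UNIV - {j}. LINT u|lborel. profile s (u - k $ i) * profile s (u - l $ i))"
      by (intro prod.cong) (auto simp: f_def)
    finally show "(LINT x|lborel. a k * a l * (\<Prod>i\<in>UNIV. f k l i (x $ i))) =
       a k * a l * ((LINT u|lborel. indicator S u * (profile s u)\<^sup>2) *
       (\<Prod>i\<in>UNIV - {j}. LINT u|lborel. profile s (u - k $ i) * profile s (u - l $ i)))" .
  qed
  also have "\<dots> = (LINT u|lborel. indicator S u * (profile s u)\<^sup>2) * cross a"
    unfolding cross_def sum_distrib_left by (intro sum.cong refl) (simp only: mult_ac)
  finally show ?thesis .
qed

lemma fourier_integral_cell:
  "fourier_integral (indicator (cell k)) \<xi> = exp (- 2 * pi * \<i> * of_real (k \<bullet> \<xi>)) * fourier_integral (indicator (cell 0)) \<xi>"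
proof -
  let ?h = "\<lambda>x. indicator (cell k) x * exp (- 2 * pi * \<i> * of_real (x \<bullet> \<xi>)) :: complex"
  have "fourier_integral (indicator (cell k)) \<xi> = \<bar>1\<bar> ^ DIM(real ^ 'n) *\<^sub>R (LINT x|lborel. ?h (k + 1 *\<^sub>R x))"
    unfolding fourier_integral_def by (rule integral_lborel_affine[where f="?h" and t=k and c=1]) auto
  also have "\<dots> = (LINT x|lborel. exp (- 2 * pi * \<i> * of_real (k \<bullet> \<xi>)) *
      (indicator (cell 0) x * exp (- 2 * pi * \<i> * of_real (x \<bullet> \<xi>))))"
  proof -
    have "?h (k + 1 *\<^sub>R x) = exp (- 2 * pi * \<i> * of_real (k \<bullet> \<xi>)) *
      (indicator (cell 0) x * exp (- 2 * pi * \<i> * of_real (x \<bullet> \<xi>)))" for x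
    proof -
      have "exp (- 2 * pi * \<i> * of_real ((k + x) \<bullet> \<xi>)) =
         exp (- 2 * pi * \<i> * of_real (k \<bullet> \<xi>)) * exp (- 2 * pi * \<i> * of_real (x \<bullet> \<xi>))"
        by (simp only: exp_add[symmetric] inner_add_left of_real_add distrib_left)
      moreover have "indicator (cell k) (k + x) = (indicator (cell 0) x :: complex)"
        by (auto simp: cell_def indicator_def)
      ultimately show ?thesis by (simp only: scaleR_one mult_ac)
    qed
    then show ?thesis by simp
  qed
  also have "\<dots> = exp (- 2 * pi * \<i> * of_real (k \<bullet> \<xi>)) * fourier_integral (indicator (cell 0)) \<xi>"
    unfolding fourier_integral_def by (rule integral_mult_right_zero)
  finally show ?thesis .
qed

section \<open>Lower bound for the energy in the frequency cube\<close>

definition trig :: "(real ^ 'n \<Rightarrow> real) \<Rightarrow> real ^ 'n \<Rightarrow> complex" where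
  "trig a \<xi> = (\<Sum>k\<in>I. of_real (a k) * exp (- 2 * pi * \<i> * of_real (k \<bullet> \<xi>)))"

lemma fourier_integral_comb:
  "fourier_integral (cut (comb a)) \<xi> = trig a \<xi> * fourier_integral (indicator (cell 0)) \<xi>"
proof -
  have ci: "integrable lborel (indicator (cell k) :: _ \<Rightarrow> complex)" for k
    by (rule integrable_bounded_on_bounded_set[where A="cell k" and C=1]) (auto simp: bounded_cell indicator_def)
  have "cut (comb a) x = (\<Sum>k\<in>I. of_real (a k) * indicator (cell k) x)" for x
  proof -
    have "indicator (space_cube c) x * fn (comb a) x = (\<Sum>k\<in>I. a k * indicator (cell k) x)"
      unfolding fn_comb sum_distrib_left using cell_subset
      by (intro sum.cong) (auto simp: indicator_def)
    then have "cut (comb a) x = of_real (\<Sum>k\<in>I. a k * indicator (cell k) x)"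
      by (simp only: cut_def)
    moreover have "complex_of_real (indicator S x) = indicator S x" for S
      by (simp add: indicator_def)
    ultimately show ?thesis
      by (simp only: of_real_sum of_real_mult)
  qed
  then have "fourier_integral (cut (comb a)) \<xi> = (LINT x|lborel. (\<Sum>k\<in>I. of_real (a k) *
      (indicator (cell k) x * exp (- 2 * pi * \<i> * of_real (x \<bullet> \<xi>)))))"
    unfolding fourier_integral_def by (simp only: sum_distrib_right mult.assoc)
  also have "\<dots> = (\<Sum>k\<in>I. LINT x|lborel. of_real (a k) *
      (indicator (cell k) x * exp (- 2 * pi * \<i> * of_real (x \<bullet> \<xi>))))"
  proof (rule Bochner_Integration.integral_sum)
    fix k
    show "integrable lborel (\<lambda>x. of_real (a k) * (indicator (cell k) x * exp (- 2 * pi * \<i> * of_real (x \<bullet> \<xi>))))"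
      by (rule integrable_mult_right) (rule integrable_mult_fourier_kernel[OF ci])
  qed
  also have "\<dots> = (\<Sum>k\<in>I. of_real (a k) * fourier_integral (indicator (cell k)) \<xi>)"
    unfolding fourier_integral_def by (simp only: integral_mult_right_zero)
  also have "\<dots> = (\<Sum>k\<in>I. of_real (a k) * exp (- 2 * pi * \<i> * of_real (k \<bullet> \<xi>)) * fourier_integral (indicator (cell 0)) \<xi>)"
    by (intro sum.cong refl, subst fourier_integral_cell) (simp only: mult.assoc)
  finally show ?thesis
    by (simp only: trig_def sum_distrib_right)
qed

text \<open>\<open>K (k - l)\<close> is the inner product over the band of the exponentials
  belonging to \<open>k\<close> and \<open>l\<close>, and the kernel of a cube is a product over the
  coordinates.\<close>

lemma K_lattice:
  assumes "k \<in> I" "l \<in> I"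
  shows "K (k - l) = (if k = l then 1 else 0)"
proof -
  have "K1 ((k - l) $ i) = (if k $ i = l $ i then 1 else 0)" for i
  proof -
    obtain m where m: "(k - l) $ i = of_int m"
      using I(2)[OF assms(1), of i] I(2)[OF assms(2), of i] by (metis Ints_cases Ints_diff vector_minus_component)
    then show ?thesis
      using K1_int[of m] by (auto simp del: vector_minus_component) (auto simp: vector_minus_component)
  qed
  then have "K (k - l) = (\<Prod>i\<in>UNIV. if k $ i = l $ i then 1 else 0)"
    unfolding K_frequency_cube by simp
  also have "\<dots> = (if k = l then 1 else 0)"
    by (auto simp: vec_eq_iff)
  finally show ?thesis .
qed

text \<open>Parseval for a trigonometric polynomial: expand the square and integrate term by term;
  only the diagonal terms survive by \<open>K_lattice\<close>.\<close>

lemma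
  shows integral_trig_square: "(LINT \<xi>|lborel. indicator band \<xi> * (cmod (trig a \<xi>))\<^sup>2) = (\<Sum>k\<in>I. (a k)\<^sup>2)"
    and integrable_trig_square: "integrable lborel (\<lambda>\<xi>. indicator band \<xi> * (cmod (trig a \<xi>))\<^sup>2)"
proof -
  let ?e = "\<lambda>k l \<xi>. indicator band \<xi> * exp (- 2 * pi * \<i> * of_real (\<xi> \<bullet> (k - l))) :: complex"
  have eq: "complex_of_real (indicator band \<xi> * (cmod (trig a \<xi>))\<^sup>2) =
      (\<Sum>k\<in>I. \<Sum>l\<in>I. of_real (a k * a l) * ?e k l \<xi>)" for \<xi>
  proof -
    have e: "exp (- 2 * pi * \<i> * of_real (k \<bullet> \<xi>)) * cnj (exp (- 2 * pi * \<i> * of_real (l \<bullet> \<xi>))) =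
        exp (- 2 * pi * \<i> * of_real (\<xi> \<bullet> (k - l)))" for k l
    proof -
      have "- 2 * pi * \<i> * of_real (k \<bullet> \<xi>) + cnj (- 2 * pi * \<i> * of_real (l \<bullet> \<xi>)) =
         - 2 * pi * \<i> * of_real (\<xi> \<bullet> (k - l))"
        by (simp add: inner_diff_right inner_commute[of \<xi>] right_diff_distrib)
      then show ?thesis by (simp only: exp_cnj exp_add[symmetric])
    qed
    have "complex_of_real ((cmod (trig a \<xi>))\<^sup>2) = trig a \<xi> * cnj (trig a \<xi>)"
      by (simp only: complex_norm_square)
    also have "\<dots> = (\<Sum>k\<in>I. \<Sum>l\<in>I. of_real (a k * a l) * exp (- 2 * pi * \<i> * of_real (\<xi> \<bullet> (k - l))))"
    proof -
      have e: "of_real p * exp (- 2 * pi * \<i> * of_real (k \<bullet> \<xi>)) * (of_real q * cnj (exp (- 2 * pi * \<i> * of_real (l \<bullet> \<xi>)))) =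
          of_real (p * q) * exp (- 2 * pi * \<i> * of_real (\<xi> \<bullet> (k - l)))" for p q k l
        unfolding e[symmetric] of_real_mult[of p q] by (simp only: mult_ac)
      show ?thesis
        unfolding trig_def cnj_sum sum_product complex_cnj_mult complex_cnj_complex_of_real
        by (simp only: e)
    qed
    finally have "complex_of_real ((cmod (trig a \<xi>))\<^sup>2) =
       (\<Sum>k\<in>I. \<Sum>l\<in>I. of_real (a k * a l) * exp (- 2 * pi * \<i> * of_real (\<xi> \<bullet> (k - l))))" .
    then have "complex_of_real (indicator band \<xi> * (cmod (trig a \<xi>))\<^sup>2) = indicator band \<xi> *
       (\<Sum>k\<in>I. \<Sum>l\<in>I. of_real (a k * a l) * exp (- 2 * pi * \<i> * of_real (\<xi> \<bullet> (k - l))))"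
      by (simp add: indicator_def)
    then show ?thesis
      unfolding sum_distrib_left by (simp only: mult_ac)
  qed
  have ei: "integrable lborel (\<lambda>\<xi>. of_real (a k * a l) * ?e k l \<xi>)" for k l
    by (rule integrable_mult_right) (rule integrable_mult_fourier_kernel[OF integrable_indicator_B])
  have "integrable lborel (\<lambda>\<xi>. complex_of_real (indicator band \<xi> * (cmod (trig a \<xi>))\<^sup>2))"
    unfolding eq by (intro Bochner_Integration.integrable_sum ei)
  from integrable_Re[OF this] show "integrable lborel (\<lambda>\<xi>. indicator band \<xi> * (cmod (trig a \<xi>))\<^sup>2)"
    by simp
  have "complex_of_real (LINT \<xi>|lborel. indicator band \<xi> * (cmod (trig a \<xi>))\<^sup>2) =
      (LINT \<xi>|lborel. (\<Sum>k\<in>I. \<Sum>l\<in>I. of_real (a k * a l) * ?e k l \<xi>))"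
    unfolding eq[symmetric] integral_complex_of_real ..
  also have "\<dots> = (\<Sum>k\<in>I. \<Sum>l\<in>I. LINT \<xi>|lborel. of_real (a k * a l) * ?e k l \<xi>)"
    by (subst Bochner_Integration.integral_sum; (intro Bochner_Integration.integrable_sum ei)?)
       (intro sum.cong refl Bochner_Integration.integral_sum ei)
  also have "\<dots> = (\<Sum>k\<in>I. \<Sum>l\<in>I. of_real (a k * a l) * of_real (K (k - l)))"
    unfolding K_eq fourier_integral_def by (simp only: integral_mult_right_zero)
  also have "\<dots> = (\<Sum>k\<in>I. \<Sum>l\<in>I. if l = k then of_real (a k * a l) else 0)"
    by (intro sum.cong refl) (auto simp: K_lattice)
  also have "\<dots> = of_real (\<Sum>k\<in>I. (a k)\<^sup>2)"
    using I(1) by (simp add: power2_eq_square)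
  finally show "(LINT \<xi>|lborel. indicator band \<xi> * (cmod (trig a \<xi>))\<^sup>2) = (\<Sum>k\<in>I. (a k)\<^sup>2)"
    by (simp only: of_real_eq_iff)
qed

lemma cmod_fourier_cell_ge:
  assumes "\<xi> \<in> band"
  shows "cmod (fourier_integral (indicator (cell 0)) \<xi>) \<ge> s ^ CARD('n) / 2"
proof -
  have "measure lborel (cell 0) / 2 \<le> Re (fourier_integral (indicator (cell 0)) \<xi>)"
  proof (rule Re_fourier_integral_indicator_ge[OF cell_sets bounded_cell])
    fix x assume x: "x \<in> cell 0"
    have "\<bar>x \<bullet> \<xi>\<bar> \<le> (\<Sum>i\<in>UNIV. \<bar>x $ i * \<xi> $ i\<bar>)"
      unfolding inner_vec_def inner_real_def by (rule sum_abs)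
    also have "\<dots> \<le> (\<Sum>i\<in>(UNIV :: 'n set). s * (1/2))"
    proof (rule sum_mono)
      fix i
      have "0 < x $ i" "x $ i < s" "- 1/2 < \<xi> $ i" "\<xi> $ i < 1/2"
        using x assms by (auto simp: cell_def frequency_cube_def)
      then show "\<bar>x $ i * \<xi> $ i\<bar> \<le> s * (1/2)"
        unfolding abs_mult by (intro mult_mono) auto
    qed
    also have "\<dots> \<le> 1/6" using s(3) by (simp add: mult.commute)
    finally show "\<bar>x \<bullet> \<xi>\<bar> \<le> 1/6" .
  qed
  moreover have "measure lborel (cell 0) = s ^ CARD('n)"
    using integral_cell[of 0] by simp
  ultimately show ?thesis
    using complex_Re_le_cmod[of "fourier_integral (indicator (cell 0)) \<xi>"] by simp
qed

text \<open>On the band the spectrum is \<open>trig a\<close> times the transform of a single cell,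
  because translating the cell contributes only an exponential. The second factor is bounded below
  pointwise, the first one has its energy given exactly by Parseval.\<close>

lemma spec_comb_energy: "(LINT \<xi>|lborel. (cmod (spec (comb a) \<xi>))\<^sup>2) \<ge> (s ^ CARD('n) / 2)\<^sup>2 * (\<Sum>k\<in>I. (a k)\<^sup>2)"
proof -
  have "(s ^ CARD('n) / 2)\<^sup>2 * (\<Sum>k\<in>I. (a k)\<^sup>2) =
      (LINT \<xi>|lborel. (s ^ CARD('n) / 2)\<^sup>2 * (indicator band \<xi> * (cmod (trig a \<xi>))\<^sup>2))"
    by (simp only: integral_trig_square integral_mult_right_zero)
  also have "\<dots> \<le> (LINT \<xi>|lborel. (cmod (spec (comb a) \<xi>))\<^sup>2)"
  proof (rule integral_mono)
    show "integrable lborel (\<lambda>\<xi>. (cmod (spec (comb a) \<xi>))\<^sup>2)"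
      by (rule L2_D(2)[OF L2_bounded[OF integrable_spec spec_bound]])
    show "integrable lborel (\<lambda>\<xi>. (s ^ CARD('n) / 2)\<^sup>2 * (indicator band \<xi> * (cmod (trig a \<xi>))\<^sup>2))"
      by (intro integrable_mult_right integrable_trig_square)
    fix \<xi> :: "real ^ 'n"
    show "(s ^ CARD('n) / 2)\<^sup>2 * (indicator band \<xi> * (cmod (trig a \<xi>))\<^sup>2) \<le> (cmod (spec (comb a) \<xi>))\<^sup>2"
    proof (cases "\<xi> \<in> band")
      case True
      have "(s ^ CARD('n) / 2)\<^sup>2 \<le> (cmod (fourier_integral (indicator (cell 0)) \<xi>))\<^sup>2"
        using s by (intro power_mono cmod_fourier_cell_ge True) auto
      from mult_right_mono[OF this zero_le_power2] True show ?thesis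
        by (simp add: spec_def fourier_integral_comb norm_mult power_mult_distrib mult.commute)
    qed simp
  qed
  finally show ?thesis .
qed

lemma profile_integral_pos: "(LINT u|lborel. (profile s u)\<^sup>2) > 0"
proof -
  have sq: "integrable lborel (\<lambda>u. (profile s u)\<^sup>2)"
    by (rule integrable_profile_square[OF s(1,2)])
  have "(LINT u|lborel. indicator {..<0} u * (profile s u)\<^sup>2) \<le> (LINT u|lborel. (profile s u)\<^sup>2)"
  proof (rule integral_mono[OF _ sq])
    show "integrable lborel (\<lambda>u. indicator {..<0} u * (profile s u)\<^sup>2)"
      by (rule Bochner_Integration.integrable_bound[OF sq]) (auto simp: indicator_def)
  qed (auto simp: indicator_def)
  then show ?thesis
    using profile_left_pos[OF s(1,2)] by linarith
qed

lemma face_const_pos: "face_const s CARD('n) > 0"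
  unfolding face_const_def using profile_integral_pos profile_left_pos[OF s(1,2)] s(1) by simp

text \<open>For every coefficient vector the slab \<open>x $ j < 0\<close> carries the same share
  \<open>?\<theta> / ?G\<close> of the total energy, since \<open>cross a\<close> is common to both
  integrals. The slab misses the cube, so it bounds the energy outside from below, and the total is
  controlled by \<open>spec_comb_energy\<close>.\<close>

lemma comb_energy_outside: "ip (T (comb a)) (comb a) - ip (T (comb a)) (T (comb a)) \<ge> face_const s CARD('n) * ip (comb a) (comb a)"
proof -
  let ?\<theta> = "LINT u|lborel. indicator {..<0} u * (profile s u)\<^sup>2" and ?G = "LINT u|lborel. (profile s u)\<^sup>2"
  let ?E = "LINT x|lborel. (fn (T (comb a)) x)\<^sup>2"
  have G: "?G > 0" and \<theta>: "?\<theta> > 0"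
    using profile_integral_pos profile_left_pos[OF s(1,2)] by auto
  have "?E = ?G * cross a"
    using integral_T_comb_slab[of UNIV a] by simp
  moreover have "(LINT x|lborel. indicator {..<0} (x $ j) * (fn (T (comb a)) x)\<^sup>2) = ?\<theta> * cross a"
    by (rule integral_T_comb_slab) auto
  ultimately have slab: "(LINT x|lborel. indicator {..<0} (x $ j) * (fn (T (comb a)) x)\<^sup>2) = ?\<theta> / ?G * ?E"
    using G by simp
  have "face_const s CARD('n) * ip (comb a) (comb a) = ?\<theta> / ?G * ((s ^ CARD('n) / 2)\<^sup>2 * (\<Sum>k\<in>I. (a k)\<^sup>2))"
    by (simp add: face_const_def ip_comb power2_eq_square)
  also have "\<dots> \<le> ?\<theta> / ?G * ?E"
    unfolding integral_T_square using G \<theta> by (intro mult_left_mono spec_comb_energy) auto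
  also have "\<dots> = (LINT x|lborel. indicator {..<0} (x $ j) * (fn (T (comb a)) x)\<^sup>2)"
    by (rule slab[symmetric])
  also have "\<dots> \<le> (LINT x|lborel. indicator (- space_cube c) x * (fn (T (comb a)) x)\<^sup>2)"
  proof (rule integral_mono)
    show "integrable lborel (\<lambda>x. indicator {..<0} (x $ j) * (fn (T (comb a)) x)\<^sup>2)"
      by (rule Bochner_Integration.integrable_bound[OF integrable_T_square[of "comb a"]]) (auto simp: indicator_def)
    show "integrable lborel (\<lambda>x. indicator (- space_cube c) x * (fn (T (comb a)) x)\<^sup>2)"
      by (rule Bochner_Integration.integrable_bound[OF integrable_T_square[of "comb a"]]) (auto simp: indicator_def)
    show "indicator {..<0} (x $ j) * (fn (T (comb a)) x)\<^sup>2 \<le> indicator (- space_cube c) x * (fn (T (comb a)) x)\<^sup>2" for x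
    proof (cases "x $ j < 0")
      case True
      then have "x \<notin> space_cube c" by (auto simp: space_cube_def intro!: exI[of _ j])
      then show ?thesis using True by simp
    qed simp
  qed
  finally show ?thesis
    unfolding ip_T_minus .
qed

theorem exists_plunge_eigenvectors:
  "\<exists>e \<mu>. \<forall>i<card I. N (e i) = 1 \<and> (\<forall>j<i. ip (e i) (e j) = 0) \<and> \<mu> i - (\<mu> i)\<^sup>2 \<ge> face_const s CARD('n) \<and> N (T (e i) - \<mu> i *\<^sub>R e i) = 0"
proof (rule exists_orthonormal_eigenvectors[OF face_const_pos I(1), of w])
  fix a
  show "ip (T (\<Sum>i\<in>I. a i *\<^sub>R w i)) (\<Sum>i\<in>I. a i *\<^sub>R w i) -
        ip (T (\<Sum>i\<in>I. a i *\<^sub>R w i)) (T (\<Sum>i\<in>I. a i *\<^sub>R w i)) \<ge> face_const s CARD('n) * ip (\<Sum>i\<in>I. a i *\<^sub>R w i) (\<Sum>i\<in>I. a i *\<^sub>R w i)"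
    using comb_energy_outside[of a] by (simp only: comb_def)
  fix k
  assume "ip (\<Sum>i\<in>I. a i *\<^sub>R w i) (\<Sum>i\<in>I. a i *\<^sub>R w i) = 0" and k: "k \<in> I"
  then have "(\<Sum>i\<in>I. (a i)\<^sup>2) = 0"
    using ip_comb[of a] s(1) by (simp add: comb_def)
  then show "a k = 0"
    using k I(1) by (simp add: sum_nonneg_eq_0_iff)
qed

end

section \<open>Counting eigenvalues\<close>

lemma L2_independent_orthonormal:
  assumes f: "\<And>i. i < n \<Longrightarrow> f i \<in> L2"
    and on: "\<And>i j. i < n \<Longrightarrow> j < n \<Longrightarrow> L2_inner (f i) (f j) = (if i = j then 1 else 0)"
  shows "L2_independent n f"
  unfolding L2_independent_def
proof (intro allI impI)
  fix a :: "nat \<Rightarrow> complex" and m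
  assume z: "AE x in lborel. (\<Sum>i<n. a i * f i x) = 0" and m: "m < n"
  have fm [measurable]: "f i \<in> borel_measurable borel" if "i < n" for i
    using f[OF that] by (rule L2_D)
  have int: "integrable lborel (\<lambda>x. a i * (f i x * cnj (f m x)))" if "i < n" for i
    by (rule integrable_mult_right) (rule integrable_L2_mult_cnj[OF f[OF that] f[OF m]])
  have "(LINT x|lborel. (\<Sum>i<n. a i * (f i x * cnj (f m x)))) = (\<Sum>i<n. LINT x|lborel. a i * (f i x * cnj (f m x)))"
    by (rule Bochner_Integration.integral_sum) (use int in auto)
  also have "\<dots> = (\<Sum>i<n. a i * L2_inner (f i) (f m))"
    by (simp only: L2_inner_def integral_mult_right_zero)
  also have "\<dots> = (\<Sum>i<n. if i = m then a i else 0)"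
    by (intro sum.cong) (auto simp: on m)
  also have "\<dots> = a m" using m by simp
  finally have "(LINT x|lborel. (\<Sum>i<n. a i * (f i x * cnj (f m x)))) = a m" .
  moreover have "AE x in lborel. (\<Sum>i<n. a i * (f i x * cnj (f m x))) = 0"
    using z
  proof eventually_elim
    case (elim x)
    have "(\<Sum>i<n. a i * (f i x * cnj (f m x))) = (\<Sum>i<n. a i * f i x) * cnj (f m x)"
      by (simp only: sum_distrib_right mult.assoc)
    then show ?case using elim by simp
  qed
  then have "(LINT x|lborel. (\<Sum>i<n. a i * (f i x * cnj (f m x)))) = 0"
    by (rule integral_eq_zero_AE)
  ultimately show "a m = 0" by simp
qed

lemma L2_dim_ge:
  assumes "finite S" "\<And>i. i \<in> S \<Longrightarrow> f i \<in> V" "V \<subseteq> L2"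
    and on: "\<And>i j. i \<in> S \<Longrightarrow> j \<in> S \<Longrightarrow> L2_inner (f i) (f j) = (if i = j then 1 else 0)"
  shows "enat (card S) \<le> L2_dim V"
proof -
  obtain b where b: "bij_betw b {..<card S} S"
    using ex_bij_betw_nat_finite[OF \<open>finite S\<close>] by (auto simp: atLeast0LessThan)
  then have bS: "b i \<in> S" if "i < card S" for i
    using that by (auto simp: bij_betw_def)
  have inj: "b i = b k \<longleftrightarrow> i = k" if "i < card S" "k < card S" for i k
    using b that by (auto simp: bij_betw_def inj_on_def)
  have "L2_independent (card S) (\<lambda>i. f (b i))"
  proof (rule L2_independent_orthonormal)
    show "f (b i) \<in> L2" if "i < card S" for i
      using assms(2)[OF bS[OF that]] assms(3) by (rule set_mp[rotated])
    show "L2_inner (f (b i)) (f (b k)) = (if i = k then 1 else 0)" if "i < card S" "k < card S" for i k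
      using on[OF bS[OF that(1)] bS[OF that(2)]] inj[OF that] by simp
  qed
  moreover have "\<forall>i<card S. f (b i) \<in> V"
    by (intro allI impI assms(2) bS)
  ultimately have "\<exists>f. (\<forall>i<card S. f i \<in> V) \<and> L2_independent (card S) f"
    by (intro exI[of _ "\<lambda>i. f (b i)"] conjI)
  then have "enat (card S) \<in> {enat n | n. \<exists>f. (\<forall>i<n. f i \<in> V) \<and> L2_independent n f}"
    by (intro CollectI exI[of _ "card S"] conjI refl)
  then show ?thesis
    unfolding L2_dim_def by (rule Sup_upper)
qed

lemma enat_sum: "finite S \<Longrightarrow> (\<Sum>x\<in>S. enat (g x)) = enat (\<Sum>x\<in>S. g x)"
  by (induction S rule: finite_induct) (auto simp: zero_enat_def)

text \<open>The indices are grouped by their eigenvalue. Each group is an orthonormal family in one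
  eigenspace and so bounds its multiplicity from below; the resulting finite sum is one of those
  over which the infinite sum is the supremum.\<close>

lemma plunge_count_ge_orthonormal:
  fixes f :: "nat \<Rightarrow> real ^ 'n::finite \<Rightarrow> complex"
  assumes f: "\<And>i. i < M \<Longrightarrow> f i \<in> eigenspace (space_cube c) frequency_cube (\<mu> i)"
    and \<mu>: "\<And>i. i < M \<Longrightarrow> \<mu> i \<in> {\<delta><..1 - \<delta>}"
    and on: "\<And>i j. i < M \<Longrightarrow> j < M \<Longrightarrow> L2_inner (f i) (f j) = (if i = j then 1 else 0)"
  shows "enat M \<le> plunge_count TYPE('n) \<delta> c"
proof -
  let ?m = "multiplicity_of (space_cube c :: (real ^ 'n) set) frequency_cube"
  let ?S = "\<lambda>\<nu>. {i \<in> {..<M}. \<mu> i = \<nu>}"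
  have "M = (\<Sum>i<M. 1)" by simp
  also have "\<dots> = (\<Sum>\<nu>\<in>\<mu> ` {..<M}. \<Sum>i\<in>?S \<nu>. 1)"
    by (rule sum.image_gen) simp
  finally have "enat M = (\<Sum>\<nu>\<in>\<mu> ` {..<M}. enat (card (?S \<nu>)))"
    by (simp add: enat_sum)
  also have "\<dots> \<le> (\<Sum>\<nu>\<in>\<mu> ` {..<M}. ?m \<nu>)"
  proof (rule sum_mono)
    fix \<nu>
    show "enat (card (?S \<nu>)) \<le> ?m \<nu>"
      unfolding multiplicity_of_def
      by (rule L2_dim_ge[where f=f]) (use f on in \<open>auto simp: eigenspace_def\<close>)
  qed
  also have "\<dots> \<le> (SUP F\<in>{F. finite F \<and> F \<subseteq> {\<delta><..1 - \<delta>}}. sum ?m F)"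
    using \<mu> by (intro SUP_upper) auto
  also have "\<dots> = plunge_count TYPE('n) \<delta> c"
    unfolding plunge_count_def by (rule nonneg_infsum_complete[symmetric]) auto
  finally show ?thesis .
qed

lemma (in face_cells) plunge_count_ge_card:
  assumes \<delta>: "\<delta> < face_const s CARD('n)"
  shows "enat (card I) \<le> plunge_count TYPE('n) \<delta> c"
proof -
  obtain e \<mu> where e: "\<And>i. i < card I \<Longrightarrow> N (e i) = 1 \<and> (\<forall>j<i. ip (e i) (e j) = 0) \<and>
      \<mu> i - (\<mu> i)\<^sup>2 \<ge> face_const s CARD('n) \<and> N (T (e i) - \<mu> i *\<^sub>R e i) = 0"
    using exists_plunge_eigenvectors by blast
  \<comment> \<open>Both bounds come from \<open>\<mu> - \<mu>^2 \<ge> \<kappa>\<close> with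
    \<kappa> the face constant: add \<open>\<mu>^2 \<ge> 0\<close> for the first and
    \<open>(1 - \<mu>)^2 \<ge> 0\<close> for the second.\<close>
  have range: "\<mu> i \<ge> face_const s CARD('n)" "1 - \<mu> i \<ge> face_const s CARD('n)" if "i < card I" for i
  proof -
    have "\<mu> i - (\<mu> i)\<^sup>2 \<ge> face_const s CARD('n)" using e[OF that] by simp
    moreover have "0 \<le> (\<mu> i)\<^sup>2" "0 \<le> 1 - 2 * \<mu> i + (\<mu> i)\<^sup>2"
      using zero_le_power2[of "1 - \<mu> i"] by (simp_all add: power2_diff)
    ultimately show "\<mu> i \<ge> face_const s CARD('n)" "1 - \<mu> i \<ge> face_const s CARD('n)" by linarith+
  qed
  have ne: "\<mu> i \<noteq> 0" if "i < card I" for i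
    using range(1)[OF that] face_const_pos by simp
  \<comment> \<open>These representatives agree almost everywhere with \<open>cut (e i)\<close>, so
    their \<open>L2\<close> inner products are the values of \<open>ip\<close>.\<close>
  define \<phi> where "\<phi> i x = complex_of_real (indicator (space_cube c) x * (fn (T (e i)) x / \<mu> i))" for i x
  have AEeq: "AE x in lborel. \<phi> i x = cut (e i) x" and mem: "\<phi> i \<in> eigenspace (space_cube c) band (\<mu> i)"
    if "i < card I" for i
    using eigenvector_AE_eq[OF ne[OF that], of "e i"] eigenvector_in_eigenspace[OF ne[OF that], of "e i"] e[OF that]
    by (simp_all add: \<phi>_def[abs_def])
  have meas [measurable]: "\<phi> i \<in> borel_measurable borel" for i
    unfolding \<phi>_def[abs_def] by measurable
  have inner: "L2_inner (\<phi> i) (\<phi> k) = of_real (ip (e i) (e k))" if "i < card I" "k < card I" for i k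
  proof -
    have "L2_inner (\<phi> i) (\<phi> k) = (LINT x|lborel. cut (e i) x * cnj (cut (e k) x))"
      unfolding L2_inner_def
    proof (rule integral_cong_AE)
      show "AE x in lborel. \<phi> i x * cnj (\<phi> k x) = cut (e i) x * cnj (cut (e k) x)"
        using AEeq[OF that(1)] AEeq[OF that(2)] by eventually_elim simp
    qed measurable
    also have "\<dots> = (LINT x|lborel. of_real (indicator (space_cube c) x * (fn (e i) x * fn (e k) x)))"
      by (intro Bochner_Integration.integral_cong refl) (simp add: cut_def indicator_def)
    also have "\<dots> = of_real (ip (e i) (e k))"
      unfolding integral_complex_of_real ip_def ..
    finally show ?thesis .
  qed
  have ip_e: "ip (e i) (e k) = (if i = k then 1 else 0)" if "i < card I" "k < card I" for i k
  proof (cases i k rule: linorder_cases)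
    case less
    then show ?thesis using e[OF that(2)] ip_sym[of "e i" "e k"] by auto
  next
    case equal
    then show ?thesis using e[OF that(1)] N_square[of "e i"] by simp
  next
    case greater
    then show ?thesis using e[OF that(1)] by auto
  qed
  show ?thesis
  proof (rule plunge_count_ge_orthonormal[where f=\<phi> and \<mu>=\<mu>])
    show "L2_inner (\<phi> i) (\<phi> k) = (if i = k then 1 else 0)" if "i < card I" "k < card I" for i k
      using inner[OF that] ip_e[OF that] by simp
    show "\<mu> i \<in> {\<delta><..1 - \<delta>}" if "i < card I" for i
      using range[OF that] \<delta> by auto
  qed (rule mem)
qed

lemma plunge_count_ge_power:
  fixes s c \<delta> :: real
  assumes s: "0 < s" "s \<le> 1/6" "s * real CARD('n::finite) \<le> 1/3" and c: "1 \<le> c"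
    and \<delta>: "\<delta> < face_const s CARD('n)"
  shows "enat (nat \<lfloor>c\<rfloor> ^ (CARD('n) - 1)) \<le> plunge_count TYPE('n) \<delta> c"
proof -
  \<comment> \<open>An arbitrary coordinate, which selects the face.\<close>
  obtain j :: 'n where True by blast
  define n where "n = nat \<lfloor>c\<rfloor>"
  have n: "real n \<le> c" using c by (simp add: n_def)
  \<comment> \<open>Coordinates run up to \<open>n - 1\<close>, so that
    \<open>k $ i + 1 \<le> n \<le> c\<close>; fixing the one at \<open>j\<close> to 0 leaves
    \<open>n ^ (CARD('n) - 1)\<close> points.\<close>
  let ?P = "PiE (UNIV :: 'n set) (\<lambda>i. if i = j then {0} else {..<n})"
  let ?v = "\<lambda>f. (\<chi> i. real (f i)) :: real ^ 'n"
  have inj: "inj_on ?v ?P"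
    by (auto simp: inj_on_def vec_eq_iff)
  have "card ?P = (\<Prod>i\<in>(UNIV :: 'n set). if i = j then 1 else n)"
    by (subst card_PiE) (auto intro!: prod.cong)
  also have "\<dots> = n ^ (CARD('n) - 1)"
  proof -
    have "(\<Prod>i\<in>(UNIV :: 'n set). if i = j then 1 else n) = (\<Prod>i\<in>UNIV - {j}. n)"
      by (subst prod.remove[of _ j]) (auto intro!: prod.cong)
    then show ?thesis by (simp add: card_Diff_singleton)
  qed
  finally have card: "card (?v ` ?P) = n ^ (CARD('n) - 1)"
    using card_image[OF inj] by simp
  interpret face_cells c s j "?v ` ?P"
  proof
    show "finite (?v ` ?P)"
      by (intro finite_imageI finite_PiE) auto
    fix k assume "k \<in> ?v ` ?P"
    then obtain f where f: "k = ?v f" "f \<in> ?P" by blast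
    show "k $ j = 0" using PiE_mem[OF f(2), of j] f(1) by simp
    fix i
    show "k $ i \<in> \<int>" "0 \<le> k $ i" using f by auto
    show "k $ i + 1 \<le> c"
    proof (cases "i = j")
      case True
      then show ?thesis using \<open>k $ j = 0\<close> c by simp
    next
      case False
      then have "f i < n" using PiE_mem[OF f(2), of i] by simp
      then have "real (f i) + 1 \<le> real n" by simp
      then show ?thesis using n f(1) by simp
    qed
  qed (use s in auto)
  show ?thesis
    using plunge_count_ge_card[OF \<delta>] by (simp only: card n_def[symmetric])
qed

section \<open>Choice of the constants and comparison of growth rates\<close>

theorem corollary1p10:
  fixes \<eta> :: real
  assumes "CARD('n::finite) \<ge> 2" and "0 < \<eta>" and "\<eta> < 1"
  shows "\<exists>L\<^sub>0 c\<^sub>0 :: real. \<forall>c \<delta> L :: real.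
           c \<ge> c\<^sub>0 \<longrightarrow> 0 < \<delta> \<longrightarrow> L = ln (1 / \<delta>) \<longrightarrow> L\<^sub>0 \<le> L \<longrightarrow> L \<le> c powr (1/3) \<longrightarrow>
           \<delta> \<le> 1 / 2 ^ CARD('n) \<longrightarrow>
           ereal_of_enat (plunge_count TYPE('n) \<delta> c)
             \<ge> ereal (((1 - \<eta>) * (L / pi\<^sup>2) * ln (4 * pi\<^sup>2 * c / L)) ^ CARD('n))"
proof -
  let ?d = "CARD('n)"
  \<comment> \<open>The largest value with \<open>s * ?d \<le> 1/3\<close>; it is at most 1/6
    because \<open>?d \<ge> 2\<close>.\<close>
  define s where "s = 1 / (3 * real ?d)"
  have s: "0 < s" "s \<le> 1/6" "s * real ?d \<le> 1/3"
    using assms(1) by (simp_all add: s_def field_simps)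
  define \<kappa> where "\<kappa> = face_const s ?d"
  have \<kappa>: "\<kappa> > 0"
  proof -
    \<comment> \<open>The constant depends on \<open>s\<close> and the dimension alone, so its
      positivity can be read off with an empty set of cells.\<close>
    interpret face_cells 1 s "undefined :: 'n" "{}" by standard (use s in auto)
    show ?thesis unfolding \<kappa>_def by (rule face_const_pos)
  qed
  \<comment> \<open>The square root is the target because its \<open>?d\<close>-th power is at most
    \<open>n ^ (?d - 1)\<close> for \<open>?d \<ge> 2\<close>, with \<open>n\<close> the integer
    part of \<open>c\<close>; the shift by 1 accounts for rounding \<open>c\<close> down.\<close>
  have "eventually (\<lambda>c::real. c powr (1/3) * ln (4 * pi\<^sup>2 * c) \<le> sqrt (c - 1)) at_top"
    by real_asymp
  then obtain C where C: "\<And>c. c \<ge> C \<Longrightarrow> c powr (1/3) * ln (4 * pi\<^sup>2 * c) \<le> sqrt (c - 1)"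
    by (auto simp: eventually_at_top_linorder)
  have pi2: "1 \<le> pi\<^sup>2"
    using pi_ge_two one_le_power[of pi 2] by linarith
  show ?thesis
  \<comment> \<open>The witnesses stay schematic and are read off from the assumptions:
    \<open>c\<^sub>0\<close> is \<open>max 2 C\<close>, and \<open>L\<^sub>0\<close> is
    \<open>max 1 (ln (1 / \<kappa>) + 1)\<close>, which forces
    \<open>\<delta> < \<kappa>\<close>.\<close>
  proof (intro exI allI impI)
    fix c \<delta> L :: real
    assume c: "max 2 C \<le> c" and \<delta>: "0 < \<delta>" and L: "L = ln (1 / \<delta>)" "max 1 (ln (1 / \<kappa>) + 1) \<le> L" "L \<le> c powr (1/3)"
    define n where "n = nat \<lfloor>c\<rfloor>"
    have n: "real n \<ge> c - 1" "n \<ge> 1" using c unfolding n_def by linarith+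
    have "ln (1 / \<kappa>) < ln (1 / \<delta>)" using L by simp
    then have "\<delta> < \<kappa>" using \<delta> \<kappa> by (simp add: ln_div)
    then have count: "enat (n ^ (?d - 1)) \<le> plunge_count TYPE('n) \<delta> c"
      unfolding n_def using c by (intro plunge_count_ge_power[OF s]) (auto simp: \<kappa>_def)
    have "c powr (1/3) \<le> c powr 1" using c by (intro powr_mono) auto
    then have Lc: "1 \<le> L" "L \<le> c" using L c by auto
    let ?l = "ln (4 * pi\<^sup>2 * c / L)"
    have "L \<le> 4 * pi\<^sup>2 * c"
      using mult_mono[of 1 "4 * pi\<^sup>2" L c] Lc pi2 by simp
    then have l0: "0 \<le> ?l" using Lc by simp
    have "4 * pi\<^sup>2 * c / L \<le> 4 * pi\<^sup>2 * c"
      using divide_left_mono[of 1 L "4 * pi\<^sup>2 * c"] Lc c by simp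
    then have l1: "?l \<le> ln (4 * pi\<^sup>2 * c)" using Lc c by simp
    let ?b = "(1 - \<eta>) * (L / pi\<^sup>2) * ?l"
    have b0: "0 \<le> ?b" using assms l0 Lc by simp
    have "L / pi\<^sup>2 \<le> L" using divide_left_mono[of 1 "pi\<^sup>2" L] pi2 Lc by simp
    then have "(1 - \<eta>) * (L / pi\<^sup>2) \<le> 1 * L" using assms Lc by (intro mult_mono) auto
    then have "?b \<le> L * ln (4 * pi\<^sup>2 * c)" using l0 l1 Lc by (intro mult_mono) auto
    also have "\<dots> \<le> c powr (1/3) * ln (4 * pi\<^sup>2 * c)" using L l0 l1 by (intro mult_right_mono) auto
    also have "\<dots> \<le> sqrt (c - 1)" using C c by simp
    also have "\<dots> \<le> sqrt (real n)" using n by simp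
    finally have "?b ^ ?d \<le> sqrt (real n) ^ ?d" using b0 by (rule power_mono)
    \<comment> \<open>Here \<open>?d \<le> 2 * (?d - 1)\<close> and
      \<open>sqrt (real n) \<ge> 1\<close> are used.\<close>
    also have "\<dots> \<le> sqrt (real n) ^ (2 * (?d - 1))"
      using n assms(1) by (intro power_increasing) auto
    also have "\<dots> = real (n ^ (?d - 1))"
      by (simp add: power_mult)
    finally have "ereal (?b ^ ?d) \<le> ereal_of_enat (enat (n ^ (?d - 1)))" by simp
    also have "\<dots> \<le> ereal_of_enat (plunge_count TYPE('n) \<delta> c)"
      using count by (simp only: ereal_of_enat_le_iff)
    finally show "ereal (?b ^ ?d) \<le> ereal_of_enat (plunge_count TYPE('n) \<delta> c)" .
  qed
qed

end
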